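(* Let $n\geq1$, $d\geq2$ and $q\in\mathbb{C}^\times$ with $q^k\neq1$ for $1\leq k\leq n$. Let $\mathfrak{h}_{\mathrm{reg}}/S_n$ be the local parametrization of the spin Ruijsenaars-Schneider phase space, and let $\{-,-\}_0$ (Chalykh-Fairon) and $\{-,-\}_-$ (Arutyunov-Olivucci) be the two Poisson brackets on $\mathfrak{h}_{\mathrm{reg}}/S_n$ written in the context. Then there is a Poisson pencil on $\mathfrak{h}_{\mathrm{reg}}/S_n$, of order $r$ with $\frac{(d-1)(d-2)}{2}\leq r\leq\frac{(d-1)d}{2}$, to which both $\{-,-\}_0$ and $\{-,-\}_-$ belong; hence these two Poisson brackets are compatible. Furthermore, any non-degenerate Poisson bracket $\{-,-\}$ from this Poisson pencil provides a Hamiltonian formulation for the trigonometric spin Ruijsenaars-Schneider system: there is a function $h$ on $\mathfrak{h}_{\mathrm{reg}}/S_n$ such that the derivation $\frac{d}{dt}:=\{h,-\}$ satisfies the trigonometric spin Ruijsenaars-Schneider equations $$\frac{dx_i}{dt}=2f_{ii}x_i,\qquad \frac{da_i^\alpha}{dt}=\sum_{k\neq i}V_{ik}f_{ik}(a_k^\alpha-a_i^\alpha),\qquad \frac{db_i^\alpha}{dt}=\sum_{k\neq i}\big(V_{ik}f_{ik}b_i^\alpha-V_{ki}f_{ki}b_k^\alpha\big),$$ where $V_{ik}=\frac{x_i+x_k}{x_i-x_k}-\frac{x_i+qx_k}{x_i-qx_k}$ and $f_{ij}=\sum_{\alpha=1}^da_i^\alpha b_j^\alpha$.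
   Context: **Space.** Let $(x_i,a_i^\alpha,b_i^\alpha)_{1\leq i\leq n}^{1\leq\alpha\leq d}$ be coordinates on $(\mathbb{C}^\times)^n\times\mathbb{C}^{2nd}$ and $$\mathfrak{h}_{\mathrm{reg}}=\Big\{x_i\neq x_j,\ x_i\neq qx_j\ \forall i\neq j;\ \sum_{\alpha=1}^da_i^\alpha=1\ \forall i;\ \det(\mathcal{Z}_\alpha)\neq0\ \forall\alpha\in\{0,1,\dots,d\}\Big\},$$ where $(\mathcal{Z}_\alpha)_{ij}=q\frac{\sum_{\beta=1}^da_i^\beta b_j^\beta}{x_ix_j^{-1}-q}+\sum_{\beta=1}^\alpha a_i^\beta b_j^\beta$. It has dimension $2nd$. $S_n$ acts by simultaneous permutation of the lower indices. Put $Z_{ij}:=(\mathcal{Z}_0)_{ij}$. Brackets on $\mathfrak{h}_{\mathrm{reg}}/S_n$ are described by their values on the functions $x_i,a_i^\alpha,b_i^\alpha$. **Notation.** $o(\alpha,\beta)=1$ if $\alpha<\beta$, $-1$ if $\alpha>\beta$, $0$ if $\alpha=\beta$; $\delta_{(\cdot)}$ is $1$ if the condition holds and $0$ otherwise. **Bracket $\{-,-\}_0$.** $\{x_i,x_j\}_0=0$, $\{x_i,a_j^\alpha\}_0=0$, $\{x_i,b_j^\alpha\}_0=\delta_{ij}x_ib_j^\alpha$, $$\{a_i^\alpha,a_j^\beta\}_0=\tfrac12\delta_{(i\neq j)}\tfrac{x_i+x_j}{x_i-x_j}(a_i^\alpha a_j^\beta+a_j^\alpha a_i^\beta-a_j^\alpha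 a_j^\beta-a_i^\alpha a_i^\beta)+\tfrac12o(\beta,\alpha)(a_i^\alpha a_j^\beta+a_j^\alpha a_i^\beta)+\tfrac12\sum_{\gamma=1}^do(\alpha,\gamma)a_j^\beta(a_i^\alpha a_j^\gamma+a_j^\alpha a_i^\gamma)-\tfrac12\sum_{\gamma=1}^do(\beta,\gamma)a_i^\alpha(a_j^\beta a_i^\gamma+a_i^\beta a_j^\gamma),$$ $$\{a_i^\alpha,b_j^\beta\}_0=a_i^\alpha Z_{ij}-\delta_{\alpha\beta}Z_{ij}-\tfrac12\delta_{(i\neq j)}\tfrac{x_i+x_j}{x_i-x_j}(a_i^\alpha-a_j^\alpha)b_j^\beta+\delta_{(\alpha<\beta)}a_i^\alpha b_j^\beta+a_i^\alpha\sum_{\gamma=1}^{\beta-1}a_i^\gamma(b_j^\gamma-b_j^\beta)-\delta_{\alpha\beta}\sum_{\gamma=1}^{\beta-1}a_i^\gamma b_j^\gamma-\tfrac12\sum_{\gamma=1}^do(\alpha,\gamma)b_j^\beta(a_i^\alpha a_j^\gamma+a_j^\alpha a_i^\gamma),$$ $$\{b_i^\alpha,b_j^\beta\}_0=\tfrac12\delta_{(i\neq j)}\tfrac{x_i+x_j}{x_i-x_j}(b_i^\alpha b_j^\beta+b_j^\alpha b_i^\beta)-b_i^\alpha Z_{ij}+b_j^\beta Z_{ji}+\tfrac12o(\beta,\alpha)(b_i^\alpha b_j^\beta-b_j^\alpha b_i^\beta)-b_i^\alpha\sum_{\gamma=1}^{\beta-1}a_i^\gamma(b_j^\gamma-b_j^\beta)+b_j^\beta\sum_{\gamma=1}^{\alpha-1}a_j^\gamma(b_i^\gamma-b_i^\alpha).$$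 **Bracket $\{-,-\}_-$.** With $\Sigma_{ij}:=\sum_{\gamma,\epsilon=1}^do(\epsilon,\gamma)a_i^\epsilon a_j^\gamma$: $\{x_i,x_j\}_-=0$, $\{x_i,a_j^\alpha\}_-=0$, $\{x_i,b_j^\alpha\}_-=\delta_{ij}x_ib_j^\alpha$, $$\{a_i^\alpha,a_j^\beta\}_-=\tfrac12\delta_{(i\neq j)}\tfrac{x_i+x_j}{x_i-x_j}(a_i^\alpha a_j^\beta+a_j^\alpha a_i^\beta-a_j^\alpha a_j^\beta-a_i^\alpha a_i^\beta)+\tfrac12o(\beta,\alpha)a_j^\alpha a_i^\beta+\tfrac12\sum_\gamma o(\alpha,\gamma)a_j^\beta a_j^\alpha a_i^\gamma-\tfrac12\sum_\gamma o(\beta,\gamma)a_i^\alpha a_i^\beta a_j^\gamma+\tfrac12\Sigma_{ij}a_i^\alpha a_j^\beta,$$ $$\{a_i^\alpha,b_j^\beta\}_-=a_i^\alpha Z_{ij}-\delta_{\alpha\beta}Z_{ij}-\tfrac12\delta_{(i\neq j)}\tfrac{x_i+x_j}{x_i-x_j}(a_i^\alpha-a_j^\alpha)b_j^\beta+a_i^\alpha\sum_{\gamma<\beta}a_i^\gamma b_j^\gamma-\delta_{\alpha\beta}\sum_{\gamma<\beta}a_i^\gamma b_j^\gamma-\tfrac12\sum_\gamma o(\alpha,\gamma)b_j^\beta a_j^\alpha a_i^\gamma-\tfrac12\Sigma_{ij}a_i^\alpha b_j^\beta+\tfrac12a_i^\alpha a_i^\beta b_j^\beta-\tfrac12\delta_{\alpha\beta}a_i^\alpha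 b_j^\beta,$$ $$\{b_i^\alpha,b_j^\beta\}_-=\tfrac12\delta_{(i\neq j)}\tfrac{x_i+x_j}{x_i-x_j}(b_i^\alpha b_j^\beta+b_j^\alpha b_i^\beta)-b_i^\alpha Z_{ij}+b_j^\beta Z_{ji}-\tfrac12o(\beta,\alpha)b_j^\alpha b_i^\beta-b_i^\alpha\sum_{\gamma<\beta}a_i^\gamma b_j^\gamma+b_j^\beta\sum_{\gamma<\alpha}a_j^\gamma b_i^\gamma+\tfrac12\Sigma_{ij}b_i^\alpha b_j^\beta+\tfrac12(a_j^\alpha-a_i^\beta)b_i^\alpha b_j^\beta.$$ It is known that $\{-,-\}_0$ is a well-defined non-degenerate Poisson bracket and that with $h=2\sum_if_{ii}$ the derivation $\{h,-\}_0$ gives the equations displayed in the claim. **Pencils.** A family of Poisson brackets (bivectors) $(P_j)_{j\in J}$ forms a Poisson pencil if every finite linear combination is Poisson; brackets "from" or "belonging to" the pencil are these linear combinations. The order is the largest $r$ for which there are $j_1,\dots,j_r\in J$ and a point at which the bivectors $P_{j_1},\dots,P_{j_r}$ are linearly independent. Two Poisson brackets are compatible if all their linear combinations are Poisson. *)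

theory Defs
  imports "HOL-Analysis.Analysis"
begin

(* The lower index i in {1..n} ranges over the finite type 'n (so n = CARD('n)); the upper index
   alpha in {1..d} ranges over the finite linearly ordered type 'd (so d = CARD('d)), which is
   order-isomorphic to {1..d}. A point is a triple (x, a, b). *)
type_synonym ('n, 'd) pt = "(complex ^ 'n) \<times> (complex ^ 'd ^ 'n) \<times> (complex ^ 'd ^ 'n)"
type_synonym ('n, 'd) bracket =
  "(('n, 'd) pt \<Rightarrow> complex) \<Rightarrow> (('n, 'd) pt \<Rightarrow> complex) \<Rightarrow> ('n, 'd) pt \<Rightarrow> complex"

definition xc :: "('n::finite, 'd::finite) pt \<Rightarrow> 'n \<Rightarrow> complex" where
  "xc p i = fst p $ i"
definition ac :: "('n::finite, 'd::finite) pt \<Rightarrow> 'n \<Rightarrow> 'd \<Rightarrow> complex" where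
  "ac p i \<alpha> = fst (snd p) $ i $ \<alpha>"
definition bc :: "('n::finite, 'd::finite) pt \<Rightarrow> 'n \<Rightarrow> 'd \<Rightarrow> complex" where
  "bc p i \<alpha> = snd (snd p) $ i $ \<alpha>"

definition fc :: "('n::finite, 'd::finite) pt \<Rightarrow> 'n \<Rightarrow> 'n \<Rightarrow> complex" where
  "fc p i j = (\<Sum>\<alpha>\<in>UNIV. ac p i \<alpha> * bc p j \<alpha>)"

(* The upper summation range {1..alpha} is passed as a set, so that alpha = 0 is the empty set. *)
definition Zc :: "complex \<Rightarrow> ('n::finite, 'd::finite) pt \<Rightarrow> 'd set \<Rightarrow> 'n \<Rightarrow> 'n \<Rightarrow> complex" where
  "Zc q p S i j = q * (fc p i j / (xc p i * inverse (xc p j) - q)) + (\<Sum>\<beta>\<in>S. ac p i \<beta> * bc p j \<beta>)"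

definition hreg :: "complex \<Rightarrow> ('n::finite, 'd::{finite, linorder}) pt set" where
  "hreg q = {p. (\<forall>i. xc p i \<noteq> 0) \<and>
     (\<forall>i j. i \<noteq> j \<longrightarrow> xc p i \<noteq> xc p j \<and> xc p i \<noteq> q * xc p j) \<and>
     (\<forall>i. (\<Sum>\<alpha>\<in>UNIV. ac p i \<alpha>) = 1) \<and>
     det (\<chi> i j. Zc q p {} i j) \<noteq> 0 \<and>
     (\<forall>\<alpha>. det (\<chi> i j. Zc q p {..\<alpha>} i j) \<noteq> 0)}"

definition act :: "('n \<Rightarrow> 'n) \<Rightarrow> ('n::finite, 'd::finite) pt \<Rightarrow> ('n, 'd) pt" where
  "act \<sigma> p = ((\<chi> i. fst p $ \<sigma> i), (\<chi> i. fst (snd p) $ \<sigma> i), (\<chi> i. snd (snd p) $ \<sigma> i))"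


inductive_set poly_fun :: "(('n::finite, 'd::finite) pt \<Rightarrow> complex) set" where
  const: "(\<lambda>p. c) \<in> poly_fun"
| x: "(\<lambda>p. xc p i) \<in> poly_fun"
| a: "(\<lambda>p. ac p i \<alpha>) \<in> poly_fun"
| b: "(\<lambda>p. bc p i \<alpha>) \<in> poly_fun"
| add: "P \<in> poly_fun \<Longrightarrow> Q \<in> poly_fun \<Longrightarrow> (\<lambda>p. P p + Q p) \<in> poly_fun"
| mult: "P \<in> poly_fun \<Longrightarrow> Q \<in> poly_fun \<Longrightarrow> (\<lambda>p. P p * Q p) \<in> poly_fun"

definition on_hreg :: "complex \<Rightarrow> (('n::finite, 'd::{finite, linorder}) pt \<Rightarrow> complex) \<Rightarrow> ('n, 'd) pt \<Rightarrow> complex" where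
  "on_hreg q f = (\<lambda>p. if p \<in> hreg q then f p else 0)"

(* The coordinate ring of hreg. Since hreg is a principal open subset of the affine space cut out
   by the equations sum_alpha a_i^alpha = 1, every regular function on it is globally a quotient
   of two polynomials. Functions on hreg are represented by their extension by 0, so that
   equality in the ring is equality of HOL functions. *)
definition regular :: "complex \<Rightarrow> (('n::finite, 'd::{finite, linorder}) pt \<Rightarrow> complex) set" where
  "regular q = {f. \<exists>P\<in>poly_fun. \<exists>Q\<in>poly_fun. (\<forall>p\<in>hreg q. Q p \<noteq> 0) \<and> f = on_hreg q (\<lambda>p. P p / Q p)}"

definition invariant_fun :: "(('n::finite, 'd::finite) pt \<Rightarrow> complex) \<Rightarrow> bool" where
  "invariant_fun f \<longleftrightarrow> (\<forall>\<sigma>. bij \<sigma> \<longrightarrow> f \<circ> act \<sigma> = f)"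


(* A Poisson bracket on hreg / S_n. As S_n acts freely on hreg, the quotient map is etale, and
   brackets on the quotient are the same as S_n-equivariant brackets on hreg; it is in this form
   that they can be evaluated on the (non-invariant) coordinate functions. Linearity in the second
   argument follows from antisymmetry. *)
definition poisson_bracket :: "complex \<Rightarrow> ('n::finite, 'd::{finite, linorder}) bracket \<Rightarrow> bool" where
  "poisson_bracket q B \<longleftrightarrow>
     (\<forall>f\<in>regular q. \<forall>g\<in>regular q. B f g \<in> regular q) \<and>
     (\<forall>f\<in>regular q. \<forall>g\<in>regular q. \<forall>h\<in>regular q. \<forall>c.
        B (\<lambda>p. c * f p + g p) h = (\<lambda>p. c * B f h p + B g h p)) \<and>
     (\<forall>f\<in>regular q. \<forall>g\<in>regular q. B f g = (\<lambda>p. - B g f p)) \<and>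
     (\<forall>f\<in>regular q. \<forall>g\<in>regular q. \<forall>h\<in>regular q.
        B (\<lambda>p. f p * g p) h = (\<lambda>p. f p * B g h p + B f h p * g p)) \<and>
     (\<forall>f\<in>regular q. \<forall>g\<in>regular q. \<forall>h\<in>regular q. \<forall>p.
        B f (B g h) p + B g (B h f) p + B h (B f g) p = 0) \<and>
     (\<forall>\<sigma>. bij \<sigma> \<longrightarrow> (\<forall>f\<in>regular q. \<forall>g\<in>regular q.
        B (f \<circ> act \<sigma>) (g \<circ> act \<sigma>) = B f g \<circ> act \<sigma>))"

(* Tangent vectors at p, as point derivations of the coordinate ring. *)
definition tangent_vector :: "complex \<Rightarrow> ('n::finite, 'd::{finite, linorder}) pt \<Rightarrow> ((('n, 'd) pt \<Rightarrow> complex) \<Rightarrow> complex) \<Rightarrow> bool" where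
  "tangent_vector q p D \<longleftrightarrow>
     (\<forall>f\<in>regular q. \<forall>g\<in>regular q. \<forall>c. D (\<lambda>p'. c * f p' + g p') = c * D f + D g) \<and>
     (\<forall>f\<in>regular q. \<forall>g\<in>regular q. D (\<lambda>p'. f p' * g p') = f p * D g + D f * g p)"

(* At every point p, the bilinear form (d_p f, d_p g) \<mapsto> {f, g}(p) on the cotangent space has
   trivial radical; d_p f = 0 means that every tangent vector at p annihilates f. *)
definition nondegenerate :: "complex \<Rightarrow> ('n::finite, 'd::{finite, linorder}) bracket \<Rightarrow> bool" where
  "nondegenerate q B \<longleftrightarrow>
     (\<forall>p\<in>hreg q. \<forall>f\<in>regular q. (\<forall>g\<in>regular q. B f g p = 0) \<longrightarrow>
        (\<forall>D. tangent_vector q p D \<longrightarrow> D f = 0))"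


definition lincomb :: "('j \<Rightarrow> ('n, 'd) bracket) \<Rightarrow> 'j set \<Rightarrow> ('j \<Rightarrow> complex) \<Rightarrow> ('n::finite, 'd::finite) bracket" where
  "lincomb P F c = (\<lambda>f g p. \<Sum>j\<in>F. c j * P j f g p)"

definition poisson_pencil :: "complex \<Rightarrow> 'j set \<Rightarrow> ('j \<Rightarrow> ('n::finite, 'd::{finite, linorder}) bracket) \<Rightarrow> bool" where
  "poisson_pencil q J P \<longleftrightarrow>
     (\<forall>j\<in>J. poisson_bracket q (P j)) \<and>
     (\<forall>F c. finite F \<and> F \<subseteq> J \<longrightarrow> poisson_bracket q (lincomb P F c))"

(* Brackets are compared on regular functions only; elsewhere their values are irrelevant. *)
definition from_pencil :: "complex \<Rightarrow> 'j set \<Rightarrow> ('j \<Rightarrow> ('n::finite, 'd::{finite, linorder}) bracket) \<Rightarrow> ('n, 'd) bracket \<Rightarrow> bool" where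
  "from_pencil q J P B \<longleftrightarrow>
     (\<exists>F c. finite F \<and> F \<subseteq> J \<and> (\<forall>f\<in>regular q. \<forall>g\<in>regular q. B f g = lincomb P F c f g))"

(* The bivector of a bracket at p vanishes iff {f, g}(p) = 0 for all f, g, because the differentials
   of regular functions span the cotangent space at p. *)
definition bivectors_independent_at ::
  "complex \<Rightarrow> ('n::finite, 'd::{finite, linorder}) pt \<Rightarrow> ('j \<Rightarrow> ('n, 'd) bracket) \<Rightarrow> 'j set \<Rightarrow> bool" where
  "bivectors_independent_at q p P F \<longleftrightarrow>
     (\<forall>c. (\<forall>f\<in>regular q. \<forall>g\<in>regular q. lincomb P F c f g p = 0) \<longrightarrow> (\<forall>j\<in>F. c j = 0))"

definition has_order :: "complex \<Rightarrow> 'j set \<Rightarrow> ('j \<Rightarrow> ('n::finite, 'd::{finite, linorder}) bracket) \<Rightarrow> nat \<Rightarrow> bool" where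
  "has_order q J P r \<longleftrightarrow>
     (\<exists>F. finite F \<and> F \<subseteq> J \<and> card F = r \<and> (\<exists>p\<in>hreg q. bivectors_independent_at q p P F)) \<and>
     (\<forall>F. finite F \<and> F \<subseteq> J \<and> (\<exists>p\<in>hreg q. bivectors_independent_at q p P F) \<longrightarrow> card F \<le> r)"

definition compatible :: "complex \<Rightarrow> ('n::finite, 'd::{finite, linorder}) bracket \<Rightarrow> ('n, 'd) bracket \<Rightarrow> bool" where
  "compatible q B B' \<longleftrightarrow> (\<forall>c c'. poisson_bracket q (\<lambda>f g p. c * B f g p + c' * B' f g p))"


definition ordsgn :: "'d::linorder \<Rightarrow> 'd \<Rightarrow> complex" where
  "ordsgn \<alpha> \<beta> = (if \<alpha> < \<beta> then 1 else if \<alpha> > \<beta> then -1 else 0)"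

definition phi :: "('n::finite, 'd::finite) pt \<Rightarrow> 'n \<Rightarrow> 'n \<Rightarrow> complex" where
  "phi p i j = of_bool (i \<noteq> j) * ((xc p i + xc p j) / (xc p i - xc p j))"

definition xf :: "complex \<Rightarrow> 'n \<Rightarrow> ('n::finite, 'd::{finite, linorder}) pt \<Rightarrow> complex" where
  "xf q i = on_hreg q (\<lambda>p. xc p i)"
definition af :: "complex \<Rightarrow> 'n \<Rightarrow> 'd \<Rightarrow> ('n::finite, 'd::{finite, linorder}) pt \<Rightarrow> complex" where
  "af q i \<alpha> = on_hreg q (\<lambda>p. ac p i \<alpha>)"
definition bf :: "complex \<Rightarrow> 'n \<Rightarrow> 'd \<Rightarrow> ('n::finite, 'd::{finite, linorder}) pt \<Rightarrow> complex" where
  "bf q i \<alpha> = on_hreg q (\<lambda>p. bc p i \<alpha>)"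

definition has_values ::
  "complex \<Rightarrow> ('n::finite, 'd::{finite, linorder}) bracket
    \<Rightarrow> (('n, 'd) pt \<Rightarrow> 'n \<Rightarrow> 'd \<Rightarrow> 'n \<Rightarrow> 'd \<Rightarrow> complex)
    \<Rightarrow> (('n, 'd) pt \<Rightarrow> 'n \<Rightarrow> 'd \<Rightarrow> 'n \<Rightarrow> 'd \<Rightarrow> complex)
    \<Rightarrow> (('n, 'd) pt \<Rightarrow> 'n \<Rightarrow> 'd \<Rightarrow> 'n \<Rightarrow> 'd \<Rightarrow> complex) \<Rightarrow> bool" where
  "has_values q B aa ab bb \<longleftrightarrow> (\<forall>p\<in>hreg q. \<forall>i j.
     B (xf q i) (xf q j) p = 0 \<and>
     (\<forall>\<alpha>. B (xf q i) (af q j \<alpha>) p = 0) \<and>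
     (\<forall>\<alpha>. B (xf q i) (bf q j \<alpha>) p = of_bool (i = j) * xc p i * bc p j \<alpha>) \<and>
     (\<forall>\<alpha> \<beta>. B (af q i \<alpha>) (af q j \<beta>) p = aa p i \<alpha> j \<beta>) \<and>
     (\<forall>\<alpha> \<beta>. B (af q i \<alpha>) (bf q j \<beta>) p = ab p i \<alpha> j \<beta>) \<and>
     (\<forall>\<alpha> \<beta>. B (bf q i \<alpha>) (bf q j \<beta>) p = bb p i \<alpha> j \<beta>))"

definition aa0 :: "('n::finite, 'd::{finite, linorder}) pt \<Rightarrow> 'n \<Rightarrow> 'd \<Rightarrow> 'n \<Rightarrow> 'd \<Rightarrow> complex" where
  "aa0 p i \<alpha> j \<beta> = (let a = ac p in
     1/2 * phi p i j * (a i \<alpha> * a j \<beta> + a j \<alpha> * a i \<beta> - a j \<alpha> * a j \<beta> - a i \<alpha> * a i \<beta>)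
   + 1/2 * ordsgn \<beta> \<alpha> * (a i \<alpha> * a j \<beta> + a j \<alpha> * a i \<beta>)
   + 1/2 * (\<Sum>\<gamma>\<in>UNIV. ordsgn \<alpha> \<gamma> * a j \<beta> * (a i \<alpha> * a j \<gamma> + a j \<alpha> * a i \<gamma>))
   - 1/2 * (\<Sum>\<gamma>\<in>UNIV. ordsgn \<beta> \<gamma> * a i \<alpha> * (a j \<beta> * a i \<gamma> + a i \<beta> * a j \<gamma>)))"

definition ab0 :: "complex \<Rightarrow> ('n::finite, 'd::{finite, linorder}) pt \<Rightarrow> 'n \<Rightarrow> 'd \<Rightarrow> 'n \<Rightarrow> 'd \<Rightarrow> complex" where
  "ab0 q p i \<alpha> j \<beta> = (let a = ac p; b = bc p; Z = Zc q p {} in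
     a i \<alpha> * Z i j - of_bool (\<alpha> = \<beta>) * Z i j
   - 1/2 * phi p i j * (a i \<alpha> - a j \<alpha>) * b j \<beta>
   + of_bool (\<alpha> < \<beta>) * a i \<alpha> * b j \<beta>
   + a i \<alpha> * (\<Sum>\<gamma>\<in>{..<\<beta>}. a i \<gamma> * (b j \<gamma> - b j \<beta>))
   - of_bool (\<alpha> = \<beta>) * (\<Sum>\<gamma>\<in>{..<\<beta>}. a i \<gamma> * b j \<gamma>)
   - 1/2 * (\<Sum>\<gamma>\<in>UNIV. ordsgn \<alpha> \<gamma> * b j \<beta> * (a i \<alpha> * a j \<gamma> + a j \<alpha> * a i \<gamma>)))"

definition bb0 :: "complex \<Rightarrow> ('n::finite, 'd::{finite, linorder}) pt \<Rightarrow> 'n \<Rightarrow> 'd \<Rightarrow> 'n \<Rightarrow> 'd \<Rightarrow> complex" where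
  "bb0 q p i \<alpha> j \<beta> = (let a = ac p; b = bc p; Z = Zc q p {} in
     1/2 * phi p i j * (b i \<alpha> * b j \<beta> + b j \<alpha> * b i \<beta>)
   - b i \<alpha> * Z i j + b j \<beta> * Z j i
   + 1/2 * ordsgn \<beta> \<alpha> * (b i \<alpha> * b j \<beta> - b j \<alpha> * b i \<beta>)
   - b i \<alpha> * (\<Sum>\<gamma>\<in>{..<\<beta>}. a i \<gamma> * (b j \<gamma> - b j \<beta>))
   + b j \<beta> * (\<Sum>\<gamma>\<in>{..<\<alpha>}. a j \<gamma> * (b i \<gamma> - b i \<alpha>)))"

definition chalykh_fairon :: "complex \<Rightarrow> ('n::finite, 'd::{finite, linorder}) bracket \<Rightarrow> bool" where
  "chalykh_fairon q B \<longleftrightarrow> poisson_bracket q B \<and> has_values q B aa0 (ab0 q) (bb0 q)"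

definition Sig :: "('n::finite, 'd::{finite, linorder}) pt \<Rightarrow> 'n \<Rightarrow> 'n \<Rightarrow> complex" where
  "Sig p i j = (\<Sum>\<gamma>\<in>UNIV. \<Sum>\<epsilon>\<in>UNIV. ordsgn \<epsilon> \<gamma> * ac p i \<epsilon> * ac p j \<gamma>)"

definition aam :: "('n::finite, 'd::{finite, linorder}) pt \<Rightarrow> 'n \<Rightarrow> 'd \<Rightarrow> 'n \<Rightarrow> 'd \<Rightarrow> complex" where
  "aam p i \<alpha> j \<beta> = (let a = ac p in
     1/2 * phi p i j * (a i \<alpha> * a j \<beta> + a j \<alpha> * a i \<beta> - a j \<alpha> * a j \<beta> - a i \<alpha> * a i \<beta>)
   + 1/2 * ordsgn \<beta> \<alpha> * a j \<alpha> * a i \<beta>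
   + 1/2 * (\<Sum>\<gamma>\<in>UNIV. ordsgn \<alpha> \<gamma> * a j \<beta> * a j \<alpha> * a i \<gamma>)
   - 1/2 * (\<Sum>\<gamma>\<in>UNIV. ordsgn \<beta> \<gamma> * a i \<alpha> * a i \<beta> * a j \<gamma>)
   + 1/2 * Sig p i j * a i \<alpha> * a j \<beta>)"

definition abm :: "complex \<Rightarrow> ('n::finite, 'd::{finite, linorder}) pt \<Rightarrow> 'n \<Rightarrow> 'd \<Rightarrow> 'n \<Rightarrow> 'd \<Rightarrow> complex" where
  "abm q p i \<alpha> j \<beta> = (let a = ac p; b = bc p; Z = Zc q p {} in
     a i \<alpha> * Z i j - of_bool (\<alpha> = \<beta>) * Z i j
   - 1/2 * phi p i j * (a i \<alpha> - a j \<alpha>) * b j \<beta>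
   + a i \<alpha> * (\<Sum>\<gamma>\<in>{..<\<beta>}. a i \<gamma> * b j \<gamma>)
   - of_bool (\<alpha> = \<beta>) * (\<Sum>\<gamma>\<in>{..<\<beta>}. a i \<gamma> * b j \<gamma>)
   - 1/2 * (\<Sum>\<gamma>\<in>UNIV. ordsgn \<alpha> \<gamma> * b j \<beta> * a j \<alpha> * a i \<gamma>)
   - 1/2 * Sig p i j * a i \<alpha> * b j \<beta>
   + 1/2 * a i \<alpha> * a i \<beta> * b j \<beta>
   - 1/2 * of_bool (\<alpha> = \<beta>) * a i \<alpha> * b j \<beta>)"

definition bbm :: "complex \<Rightarrow> ('n::finite, 'd::{finite, linorder}) pt \<Rightarrow> 'n \<Rightarrow> 'd \<Rightarrow> 'n \<Rightarrow> 'd \<Rightarrow> complex" where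
  "bbm q p i \<alpha> j \<beta> = (let a = ac p; b = bc p; Z = Zc q p {} in
     1/2 * phi p i j * (b i \<alpha> * b j \<beta> + b j \<alpha> * b i \<beta>)
   - b i \<alpha> * Z i j + b j \<beta> * Z j i
   - 1/2 * ordsgn \<beta> \<alpha> * b j \<alpha> * b i \<beta>
   - b i \<alpha> * (\<Sum>\<gamma>\<in>{..<\<beta>}. a i \<gamma> * b j \<gamma>)
   + b j \<beta> * (\<Sum>\<gamma>\<in>{..<\<alpha>}. a j \<gamma> * b i \<gamma>)
   + 1/2 * Sig p i j * b i \<alpha> * b j \<beta>
   + 1/2 * (a j \<alpha> - a i \<beta>) * b i \<alpha> * b j \<beta>)"

definition arutyunov_olivucci :: "complex \<Rightarrow> ('n::finite, 'd::{finite, linorder}) bracket \<Rightarrow> bool" where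
  "arutyunov_olivucci q B \<longleftrightarrow> poisson_bracket q B \<and> has_values q B aam (abm q) (bbm q)"


definition Vc :: "complex \<Rightarrow> ('n::finite, 'd::finite) pt \<Rightarrow> 'n \<Rightarrow> 'n \<Rightarrow> complex" where
  "Vc q p i k = (xc p i + xc p k) / (xc p i - xc p k) - (xc p i + q * xc p k) / (xc p i - q * xc p k)"

definition spin_RS_equations ::
  "complex \<Rightarrow> ((('n::finite, 'd::{finite, linorder}) pt \<Rightarrow> complex) \<Rightarrow> ('n, 'd) pt \<Rightarrow> complex) \<Rightarrow> bool" where
  "spin_RS_equations q ddt \<longleftrightarrow> (\<forall>p\<in>hreg q. \<forall>i.
     ddt (xf q i) p = 2 * fc p i i * xc p i \<and>
     (\<forall>\<alpha>. ddt (af q i \<alpha>) p = (\<Sum>k\<in>UNIV - {i}. Vc q p i k * fc p i k * (ac p k \<alpha> - ac p i \<alpha>))) \<and>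
     (\<forall>\<alpha>. ddt (bf q i \<alpha>) p =
        (\<Sum>k\<in>UNIV - {i}. Vc q p i k * fc p i k * bc p i \<alpha> - Vc q p k i * fc p k i * bc p k \<alpha>)))"

definition hamiltonian_for_spin_RS :: "complex \<Rightarrow> ('n::finite, 'd::{finite, linorder}) bracket \<Rightarrow> bool" where
  "hamiltonian_for_spin_RS q B \<longleftrightarrow>
     (\<exists>h\<in>regular q. invariant_fun h \<and> spin_RS_equations q (B h))"

end

theory Submission
  imports Defs
begin

text \<open>
The torus $(\<complex>^\<times>)^d$ rescales $a^\<alpha>$ and $b^\<alpha>$ inversely. After the gauge
$\sum_\<alpha> a_i^\<alpha> = 1$ its generators become commuting vector fields $T_\<mu>$ with
$\sum_\<mu> T_\<mu> = 0$ that preserve the bracket $B_0 = \{-,-\}_0$. Hence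
$\<lambda> B_0 + \sum c_{\<mu>\<nu>} T_\<mu> \<and> T_\<nu>$ is Poisson for all coefficients, and
$\{-,-\}_- = B_0 + \frac12 \sum_{\<mu>,\<nu>} o(\<mu>,\<nu>)\, T_\<mu> \otimes T_\<nu>$ is of this form.
Using $T_\<mu>$ for all $\<mu>$ but the largest, the $(d-1)(d-2)/2$ wedges are linearly independent at any point all of
whose $a_i^\<alpha>$ are nonzero; such a point is found with $b = 1$ and $a_i^\<alpha> = c_\<alpha>$,
where the matrices $\mathcal Z_\<alpha>$ are rank-one perturbations of a Cauchy matrix.
The function $\sum_i f_{ii}$ is torus invariant, so its Hamiltonian vector field only depends on the coefficient
of $B_0$, and this coefficient is nonzero for a non-degenerate bracket because the
$x_i$ are Casimirs of every $T_\<mu> \<and> T_\<nu>$. With the sign convention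
$\{x_i, b_i^\<alpha>\}_0 = x_i b_i^\<alpha>$ and $\frac{d}{dt} = \{h,-\}_0$ the Hamiltonian is $h = -2\sum_i f_{ii}$.
\<close>

section \<open>Directional derivatives of regular functions\<close>

text \<open>A bracket is an arbitrary operation on the ring of regular functions, of which only the
  values on coordinates are known. So each identity that is needed (two fields commute, a field
  preserves a bracket, the fields add up to zero) is phrased as the vanishing of a defect that is a
  derivation in each of its arguments. At a point of \<open>hreg\<close> such a defect vanishes as
  soon as it vanishes on coordinates. The remaining coordinate checks would be sums over upper
  indices with order-dependent signs. They are rewritten in a few quantities, \<open>osum\<close>,
  \<open>psum\<close>, \<open>phi\<close> and \<open>Zc\<close>, that together with the coordinates
  are closed under torus derivatives; what is left are identities without sums. The number
  (d-1)(d-2)/2 counts pairs among d-1 independent fields. The bracket B0 can raise the order by at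
  most one, and the two bounds differ by d-1, which leaves room for it. For d = 2 there are no pairs
  and the two brackets coincide.\<close>

definition line :: "('n::finite, 'd::finite) pt \<Rightarrow> ('n, 'd) pt \<Rightarrow> complex \<Rightarrow> ('n, 'd) pt" where
  "line p v t = ((\<chi> i. xc p i + t * xc v i), (\<chi> i \<alpha>. ac p i \<alpha> + t * ac v i \<alpha>),
     (\<chi> i \<alpha>. bc p i \<alpha> + t * bc v i \<alpha>))"

lemma coords_line [simp]:
  "xc (line p v t) i = xc p i + t * xc v i"
  "ac (line p v t) i \<alpha> = ac p i \<alpha> + t * ac v i \<alpha>"
  "bc (line p v t) i \<alpha> = bc p i \<alpha> + t * bc v i \<alpha>"
  by (simp_all add: line_def xc_def ac_def bc_def)

lemma pt_eqI:
  assumes "\<And>i. xc p i = xc p' i" "\<And>i \<alpha>. ac p i \<alpha> = ac p' i \<alpha>" "\<And>i \<alpha>. bc p i \<alpha> = bc p' i \<alpha>"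
  shows "p = p'"
  using assms unfolding xc_def ac_def bc_def by (simp add: prod_eq_iff vec_eq_iff)

lemma line_0 [simp]: "line p v 0 = p"
  by (rule pt_eqI) simp_all

section \<open>Permutation symmetry and openness of the phase space\<close>

lemma coords_act [simp]:
  "xc (act \<sigma> p) i = xc p (\<sigma> i)"
  "ac (act \<sigma> p) i \<alpha> = ac p (\<sigma> i) \<alpha>"
  "bc (act \<sigma> p) i \<alpha> = bc p (\<sigma> i) \<alpha>"
  by (simp_all add: act_def xc_def ac_def bc_def)

lemma fc_act [simp]: "fc (act \<sigma> p) i j = fc p (\<sigma> i) (\<sigma> j)"
  by (simp add: fc_def)

lemma Zc_act [simp]: "Zc q (act \<sigma> p) S i j = Zc q p S (\<sigma> i) (\<sigma> j)"
  by (simp add: Zc_def)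

text \<open>The signs of the row and the column permutation cancel. This makes the determinant
  conditions in \<open>hreg\<close> invariant under \<open>act\<close>.\<close>

lemma det_permute_both:
  fixes A :: "complex ^ 'n ^ 'n" and \<sigma> :: "'n \<Rightarrow> 'n"
  assumes "bij \<sigma>"
  shows "det (\<chi> i j. A $ \<sigma> i $ \<sigma> j) = det A"
proof -
  have p: "\<sigma> permutes UNIV"
    using assms by (intro bij_imp_permutes) auto
  have "det (\<chi> i j. A $ \<sigma> i $ \<sigma> j) = of_int (sign \<sigma>) * det (\<chi> i. A $ \<sigma> i)"
    using det_permute_columns[OF p, of "\<chi> i. A $ \<sigma> i"] by simp
  also have "det (\<chi> i. A $ \<sigma> i) = of_int (sign \<sigma>) * det A"
    using det_permute_rows[OF p, of A] by simp
  also have "of_int (sign \<sigma>) * (of_int (sign \<sigma>) * det A) = det A"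
    by (simp add: sign_def)
  finally show ?thesis .
qed

lemma act_hreg_iff:
  assumes "bij \<sigma>"
  shows "act \<sigma> p \<in> hreg q \<longleftrightarrow> p \<in> hreg q"
proof -
  have D: "det (\<chi> i j. Zc q p S (\<sigma> i) (\<sigma> j)) = det (\<chi> i j. Zc q p S i j)" for S
    using det_permute_both[OF assms, of "\<chi> i j. Zc q p S i j"] by simp
  have all: "(\<forall>i. Q (\<sigma> i)) \<longleftrightarrow> (\<forall>i. Q i)" for Q
    using surjD[OF bij_is_surj[OF assms]] by metis
  have inj: "\<sigma> i = \<sigma> j \<longleftrightarrow> i = j" for i j
    using assms by (auto simp: bij_def inj_def)
  have all2: "(\<forall>i j. i \<noteq> j \<longrightarrow> Q (\<sigma> i) (\<sigma> j)) \<longleftrightarrow> (\<forall>i j. i \<noteq> j \<longrightarrow> Q i j)" for Q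
    using all[of "\<lambda>i. \<forall>j. i \<noteq> j \<longrightarrow> Q i j"] all[of "\<lambda>j. \<sigma> i \<noteq> j \<longrightarrow> Q (\<sigma> i) j" for i]
    by (simp add: inj)
  show ?thesis
    unfolding hreg_def mem_Collect_eq coords_act Zc_act D
    using all[of "\<lambda>i. xc p i \<noteq> 0"] all[of "\<lambda>i. (\<Sum>\<alpha>\<in>UNIV. ac p i \<alpha>) = 1"]
      all2[of "\<lambda>i j. xc p i \<noteq> xc p j \<and> xc p i \<noteq> q * xc p j"]
    by simp
qed

lemma hregD:
  assumes "p \<in> hreg q"
  shows "xc p i \<noteq> 0" "i \<noteq> j \<Longrightarrow> xc p i \<noteq> xc p j" "i \<noteq> j \<Longrightarrow> xc p i \<noteq> q * xc p j"
    "(\<Sum>\<alpha>\<in>UNIV. ac p i \<alpha>) = 1"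
    "det (\<chi> i j. Zc q p {} i j) \<noteq> 0" "det (\<chi> i j. Zc q p {..\<alpha>} i j) \<noteq> 0"
  using assms by (auto simp: hreg_def)

text \<open>On the diagonal the denominator is 1 - q, which is where q \<noteq> 1 enters; off the
  diagonal it vanishes only if x_i = q x_j.\<close>

lemma hreg_denominator:
  assumes "p \<in> hreg q" "q \<noteq> 1"
  shows "xc p i * inverse (xc p j) - q \<noteq> 0"
proof (cases "i = j")
  case False
  then show ?thesis
    using hregD(1)[OF assms(1), of j] hregD(3)[OF assms(1) False] by (simp add: field_simps)
qed (use assms hregD(1)[OF assms(1)] in auto)

text \<open>The linearization of the sum condition on a, the only closed condition in
  \<open>hreg\<close>; the x- and b-directions are free.\<close>

definition tangent :: "('n::finite, 'd::finite) pt \<Rightarrow> bool" where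
  "tangent v \<longleftrightarrow> (\<forall>i. (\<Sum>\<alpha>\<in>UNIV. ac v i \<alpha>) = 0)"

text \<open>The sum condition holds along the whole line because v is tangent; the finitely many
  non-vanishing conditions persist near t = 0 by continuity. It is needed because ring elements are
  extended by 0: a line leaving \<open>hreg\<close> at once would make derivatives of
  \<open>on_hreg q f\<close> meaningless.\<close>

lemma eventually_line_hreg:
  assumes p: "p \<in> hreg q" and q: "q \<noteq> 1" and v: "tangent v"
  shows "\<forall>\<^sub>F t in nhds 0. line p v t \<in> hreg q"
proof -
  have nz: "\<forall>\<^sub>F t in nhds 0. F t \<noteq> 0" if "isCont F 0" "F 0 \<noteq> 0" for F :: "complex \<Rightarrow> complex"
    using that tendsto_imp_eventually_ne[of F "F 0" "at 0" 0]
    by (simp add: isCont_def eventually_nhds_conv_at)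
  have Zcont: "isCont (\<lambda>t. Zc q (line p v t) S i j) 0" for S i j
    unfolding Zc_def fc_def coords_line
    using hregD(1)[OF p, of j] hreg_denominator[OF p q, of i j]
    by (intro continuous_intros) auto
  have dcont: "isCont (\<lambda>t. det (\<chi> i j. Zc q (line p v t) S i j)) 0" for S
    unfolding det_def vec_lambda_beta by (intro continuous_intros Zcont)
  have "\<forall>\<^sub>F t in nhds 0. (\<forall>i\<in>UNIV. xc (line p v t) i \<noteq> 0) \<and>
     (\<forall>i\<in>UNIV. \<forall>j\<in>UNIV. i \<noteq> j \<longrightarrow> xc (line p v t) i - xc (line p v t) j \<noteq> 0 \<and>
         xc (line p v t) i - q * xc (line p v t) j \<noteq> 0) \<and>
     det (\<chi> i j. Zc q (line p v t) {} i j) \<noteq> 0 \<and>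
     (\<forall>\<alpha>\<in>UNIV. det (\<chi> i j. Zc q (line p v t) {..\<alpha>} i j) \<noteq> 0)"
    unfolding eventually_conj_iff eventually_ball_finite_distrib[OF finite]
  proof (intro conjI ballI)
    fix i j :: 'a
    show "\<forall>\<^sub>F t in nhds 0. i \<noteq> j \<longrightarrow> xc (line p v t) i - xc (line p v t) j \<noteq> 0 \<and>
         xc (line p v t) i - q * xc (line p v t) j \<noteq> 0"
    proof (cases "i = j")
      case False
      show ?thesis
        using nz[of "\<lambda>t. xc (line p v t) i - xc (line p v t) j"]
          nz[of "\<lambda>t. xc (line p v t) i - q * xc (line p v t) j"] hregD(2,3)[OF p False]
        by (auto simp: eventually_conj_iff intro!: continuous_intros)
    qed simp
  qed (use hregD[OF p] in \<open>auto intro!: nz dcont continuous_intros\<close>)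
  then show ?thesis
  proof (rule eventually_mono)
    fix t
    have "(\<Sum>\<alpha>\<in>UNIV. ac (line p v t) i \<alpha>) = 1" for i
      using v hregD(4)[OF p, of i] by (simp add: tangent_def sum.distrib sum_distrib_left[symmetric])
    moreover assume "(\<forall>i\<in>UNIV. xc (line p v t) i \<noteq> 0) \<and>
     (\<forall>i\<in>UNIV. \<forall>j\<in>UNIV. i \<noteq> j \<longrightarrow> xc (line p v t) i - xc (line p v t) j \<noteq> 0 \<and>
         xc (line p v t) i - q * xc (line p v t) j \<noteq> 0) \<and>
     det (\<chi> i j. Zc q (line p v t) {} i j) \<noteq> 0 \<and>
     (\<forall>\<alpha>\<in>UNIV. det (\<chi> i j. Zc q (line p v t) {..\<alpha>} i j) \<noteq> 0)"
    ultimately show "line p v t \<in> hreg q"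
      unfolding hreg_def by auto
  qed
qed

lemma poly_fun_line_differentiable:
  "P \<in> poly_fun \<Longrightarrow> (\<lambda>t. P (line p v t)) field_differentiable at t0"
  by (induction rule: poly_fun.induct) (auto intro!: derivative_intros)

definition dird :: "('n::finite, 'd::finite) pt \<Rightarrow> (('n, 'd) pt \<Rightarrow> complex) \<Rightarrow> ('n, 'd) pt \<Rightarrow> complex" where
  "dird v f p = deriv (\<lambda>t. f (line p v t)) 0"

lemma on_hreg_line_derivative:
  assumes "p \<in> hreg q" "q \<noteq> 1" "tangent v"
    and "((\<lambda>t. f (line p v t)) has_field_derivative D) (at 0)"
  shows "((\<lambda>t. on_hreg q f (line p v t)) has_field_derivative D) (at 0)"
proof -
  have "\<forall>\<^sub>F t in nhds 0. on_hreg q f (line p v t) = f (line p v t)"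
    using eventually_line_hreg[OF assms(1-3)] by (rule eventually_mono) (simp add: on_hreg_def)
  then show ?thesis
    using assms(1,4) by (subst DERIV_cong_ev[OF refl _ refl]) auto
qed

lemma dird_on_hreg:
  assumes "p \<in> hreg q" "q \<noteq> 1" "tangent v"
    and "((\<lambda>t. f (line p v t)) has_field_derivative D) (at 0)"
  shows "dird v (on_hreg q f) p = D"
  unfolding dird_def using on_hreg_line_derivative[OF assms] by (rule DERIV_imp_deriv)

text \<open>Secures the existence of the derivative; without it \<open>deriv\<close> in
  \<open>dird\<close> would be an unspecified value.\<close>

lemma regular_line_differentiable:
  assumes "p \<in> hreg q" "q \<noteq> 1" "tangent v" "f \<in> regular q"
  shows "((\<lambda>t. f (line p v t)) has_field_derivative dird v f p) (at 0)"
proof -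
  obtain P Q where PQ: "P \<in> poly_fun" "Q \<in> poly_fun" "\<forall>p\<in>hreg q. Q p \<noteq> 0"
      "f = on_hreg q (\<lambda>p. P p / Q p)"
    using assms(4) unfolding regular_def by blast
  have "(\<lambda>t. P (line p v t) / Q (line p v t)) field_differentiable at 0"
    using poly_fun_line_differentiable[OF PQ(1)] poly_fun_line_differentiable[OF PQ(2)] PQ(3) assms(1)
    by (intro field_differentiable_divide) auto
  then obtain D where "((\<lambda>t. P (line p v t) / Q (line p v t)) has_field_derivative D) (at 0)"
    unfolding field_differentiable_def by blast
  then have "((\<lambda>t. f (line p v t)) has_field_derivative D) (at 0)"
    unfolding PQ(4) using assms by (intro on_hreg_line_derivative) auto
  then show ?thesis
    unfolding dird_def by (metis DERIV_imp_deriv)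
qed

lemma dird_tangent_vector:
  fixes p :: "('n::finite, 'd::{finite, linorder}) pt"
  assumes "p \<in> hreg q" "q \<noteq> 1" "tangent v"
  shows "tangent_vector q p (\<lambda>f. dird v f p)"
  unfolding tangent_vector_def
proof (intro conjI ballI allI)
  fix f g :: "('n, 'd) pt \<Rightarrow> complex" and c assume fg: "f \<in> regular q" "g \<in> regular q"
  note [derivative_intros] = regular_line_differentiable[OF assms fg(1)]
    regular_line_differentiable[OF assms fg(2)]
  show "dird v (\<lambda>p'. c * f p' + g p') p = c * dird v f p + dird v g p"
    unfolding dird_def[of v "\<lambda>p'. c * f p' + g p'"]
    by (rule DERIV_imp_deriv) (auto intro!: derivative_eq_intros)
  show "dird v (\<lambda>p'. f p' * g p') p = f p * dird v g p + dird v f p * g p"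
    unfolding dird_def[of v "\<lambda>p'. f p' * g p'"]
    by (rule DERIV_imp_deriv) (auto intro!: derivative_eq_intros)
qed

section \<open>Regular functions and their derivations\<close>

lemma poly_fun_diff: "P \<in> poly_fun \<Longrightarrow> Q \<in> poly_fun \<Longrightarrow> (\<lambda>p. P p - Q p) \<in> poly_fun"
  using poly_fun.add[OF _ poly_fun.mult[OF poly_fun.const[of "-1"]], of P Q] by simp

lemma regularI:
  assumes "P \<in> poly_fun" "Q \<in> poly_fun" "\<And>p. p \<in> hreg q \<Longrightarrow> Q p \<noteq> 0"
    and "\<And>p. p \<in> hreg q \<Longrightarrow> f p = P p / Q p" "\<And>p. p \<notin> hreg q \<Longrightarrow> f p = 0"
  shows "f \<in> regular q"
proof -
  have "f = on_hreg q (\<lambda>p. P p / Q p)"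
    using assms(4,5) by (auto simp: on_hreg_def)
  then show ?thesis
    using assms(1-3) unfolding regular_def by blast
qed

lemma regularE:
  assumes "f \<in> regular q"
  obtains P Q where "P \<in> poly_fun" "Q \<in> poly_fun" "\<And>p. p \<in> hreg q \<Longrightarrow> Q p \<noteq> 0"
    "f = on_hreg q (\<lambda>p. P p / Q p)"
  using assms unfolding regular_def by blast

lemma regular_outside: "f \<in> regular q \<Longrightarrow> p \<notin> hreg q \<Longrightarrow> f p = 0"
  by (auto simp: regular_def on_hreg_def)

lemma on_hreg_poly_regular: "P \<in> poly_fun \<Longrightarrow> on_hreg q P \<in> regular q"
  by (rule regularI[of P "\<lambda>p. 1"]) (auto simp: on_hreg_def intro: poly_fun.const)

lemma coordinate_regular [simp]: "xf q i \<in> regular q" "af q i \<alpha> \<in> regular q" "bf q i \<alpha> \<in> regular q"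
  unfolding xf_def af_def bf_def by (intro on_hreg_poly_regular poly_fun.intros)+

lemma regular_mult:
  assumes "f \<in> regular q" "g \<in> regular q"
  shows "(\<lambda>p. f p * g p) \<in> regular q"
proof -
  obtain P Q where *: "P \<in> poly_fun" "Q \<in> poly_fun" "\<And>p. p \<in> hreg q \<Longrightarrow> Q p \<noteq> 0"
      "f = on_hreg q (\<lambda>p. P p / Q p)"
    using regularE[OF assms(1)] by blast
  obtain P' Q' where **: "P' \<in> poly_fun" "Q' \<in> poly_fun" "\<And>p. p \<in> hreg q \<Longrightarrow> Q' p \<noteq> 0"
      "g = on_hreg q (\<lambda>p. P' p / Q' p)"
    using regularE[OF assms(2)] by blast
  show ?thesis
    by (rule regularI[of "\<lambda>p. P p * P' p" "\<lambda>p. Q p * Q' p"])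
      (use * ** in \<open>auto simp: on_hreg_def intro: poly_fun.mult\<close>)
qed

lemma regular_lin:
  assumes "f \<in> regular q" "g \<in> regular q"
  shows "(\<lambda>p. c * f p + g p) \<in> regular q"
proof -
  obtain P Q where *: "P \<in> poly_fun" "Q \<in> poly_fun" "\<And>p. p \<in> hreg q \<Longrightarrow> Q p \<noteq> 0"
      "f = on_hreg q (\<lambda>p. P p / Q p)"
    using regularE[OF assms(1)] by blast
  obtain P' Q' where **: "P' \<in> poly_fun" "Q' \<in> poly_fun" "\<And>p. p \<in> hreg q \<Longrightarrow> Q' p \<noteq> 0"
      "g = on_hreg q (\<lambda>p. P' p / Q' p)"
    using regularE[OF assms(2)] by blast
  have "(\<lambda>p. c * P p * Q' p + Q p * P' p) \<in> poly_fun"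
    by (intro poly_fun.add poly_fun.mult poly_fun.const * **)
  moreover have "(\<lambda>p. Q p * Q' p) \<in> poly_fun"
    by (intro poly_fun.mult * **)
  ultimately show ?thesis
    by (rule regularI) (use * ** in \<open>auto simp: on_hreg_def field_simps\<close>)
qed

lemma regular_zero: "(\<lambda>p. 0) \<in> regular q"
  using on_hreg_poly_regular[OF poly_fun.const, of q 0] by (simp add: on_hreg_def)

lemma regular_add: "f \<in> regular q \<Longrightarrow> g \<in> regular q \<Longrightarrow> (\<lambda>p. f p + g p) \<in> regular q"
  using regular_lin[of f q g 1] by simp

lemma regular_cmult: "f \<in> regular q \<Longrightarrow> (\<lambda>p. c * f p) \<in> regular q"
  using regular_lin[OF _ regular_zero, of f q c] by simp

lemma regular_diff: "f \<in> regular q \<Longrightarrow> g \<in> regular q \<Longrightarrow> (\<lambda>p. f p - g p) \<in> regular q"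
  using regular_lin[of g q f "-1"] by simp

lemmas regular_intros = regular_zero regular_add regular_diff regular_cmult regular_mult

lemma tangent_vector_zero:
  assumes "tangent_vector q p D"
  shows "D (\<lambda>p. 0) = 0"
proof -
  have "\<forall>f\<in>regular q. \<forall>g\<in>regular q. \<forall>c. D (\<lambda>p'. c * f p' + g p') = c * D f + D g"
    using assms by (simp add: tangent_vector_def)
  from this[rule_format, OF regular_zero regular_zero, of 1] show ?thesis by simp
qed

text \<open>A quotient $f = P/Q$ is handled by differentiating $f Q = P$.\<close>

lemma tangent_vector_eq_zero:
  fixes p :: "('n::finite, 'd::{finite, linorder}) pt"
  assumes D: "tangent_vector q p D" and p: "p \<in> hreg q"
    and gen: "\<And>i. D (xf q i) = 0" "\<And>i \<alpha>. D (af q i \<alpha>) = 0" "\<And>i \<alpha>. D (bf q i \<alpha>) = 0"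
    and f: "f \<in> regular q"
  shows "D f = 0"
proof -
  have lin: "D (\<lambda>p'. c * f p' + g p') = c * D f + D g"
    and leib: "D (\<lambda>p'. f p' * g p') = f p * D g + D f * g p"
    if "f \<in> regular q" "g \<in> regular q" for f g c
    using D that unfolding tangent_vector_def by blast+
  have one: "on_hreg q (\<lambda>p. 1) \<in> regular q"
    by (intro on_hreg_poly_regular poly_fun.const)
  \<comment> \<open>The unit of the ring is the indicator of \<open>hreg\<close>; from 1 * 1 = 1 the
    Leibniz rule gives D 1 = 2 * D 1.\<close>
  have "(\<lambda>p'. on_hreg q (\<lambda>p. 1) p' * on_hreg q (\<lambda>p. 1) p') = on_hreg q (\<lambda>p. 1)"
    by (auto simp: on_hreg_def)
  from leib[OF one one, unfolded this] p have D1: "D (on_hreg q (\<lambda>p. 1)) = 0"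
    by (simp add: on_hreg_def)
  have poly: "D (on_hreg q P) = 0" if "P \<in> poly_fun" for P
    using that
  proof induction
    case (const c)
    have "(\<lambda>p'. c * on_hreg q (\<lambda>p. 1) p' + 0) = on_hreg q (\<lambda>p. c)"
      by (auto simp: on_hreg_def)
    from lin[OF one regular_zero, of c, unfolded this] D1 tangent_vector_zero[OF D] show ?case
      by simp
  next
    case (add P Q)
    have "(\<lambda>p'. 1 * on_hreg q P p' + on_hreg q Q p') = on_hreg q (\<lambda>p. P p + Q p)"
      by (auto simp: on_hreg_def)
    with lin[of "on_hreg q P" "on_hreg q Q" 1] add show ?case by (simp add: on_hreg_poly_regular)
  next
    case (mult P Q)
    have "(\<lambda>p'. on_hreg q P p' * on_hreg q Q p') = on_hreg q (\<lambda>p. P p * Q p)"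
      by (auto simp: on_hreg_def)
    with leib[of "on_hreg q P" "on_hreg q Q"] mult show ?case by (simp add: on_hreg_poly_regular)
  qed (use gen in \<open>simp_all add: xf_def af_def bf_def\<close>)
  from regularE[OF f] obtain P Q where PQ: "P \<in> poly_fun" "Q \<in> poly_fun" "\<And>p. p \<in> hreg q \<Longrightarrow> Q p \<noteq> 0"
    "f = on_hreg q (\<lambda>p. P p / Q p)"
    by blast
  have "(\<lambda>p'. f p' * on_hreg q Q p') = on_hreg q P"
    using PQ(3,4) by (auto simp: on_hreg_def)
  with leib[OF f on_hreg_poly_regular[OF PQ(2)]] poly[OF PQ(1)] poly[OF PQ(2)]
  have "D f * Q p = 0"
    using p by (simp add: on_hreg_def)
  then show ?thesis
    using PQ(3)[OF p] by simp
qed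

section \<open>Derivations of the coordinate ring\<close>

definition derivation ::
  "complex \<Rightarrow> ((('n::finite, 'd::{finite, linorder}) pt \<Rightarrow> complex) \<Rightarrow> ('n, 'd) pt \<Rightarrow> complex) \<Rightarrow> bool" where
  "derivation q X \<longleftrightarrow> (\<forall>f\<in>regular q. X f \<in> regular q) \<and>
     (\<forall>f\<in>regular q. \<forall>g\<in>regular q. \<forall>c. X (\<lambda>p. c * f p + g p) = (\<lambda>p. c * X f p + X g p)) \<and>
     (\<forall>f\<in>regular q. \<forall>g\<in>regular q. X (\<lambda>p. f p * g p) = (\<lambda>p. f p * X g p + X f p * g p))"

definition equivariant ::
  "complex \<Rightarrow> ((('n::finite, 'd::{finite, linorder}) pt \<Rightarrow> complex) \<Rightarrow> ('n, 'd) pt \<Rightarrow> complex) \<Rightarrow> bool" where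
  "equivariant q X \<longleftrightarrow> (\<forall>\<sigma>. bij \<sigma> \<longrightarrow> (\<forall>f\<in>regular q. X (f \<circ> act \<sigma>) = X f \<circ> act \<sigma>))"

lemma derivation_regular: "derivation q X \<Longrightarrow> f \<in> regular q \<Longrightarrow> X f \<in> regular q"
  by (simp add: derivation_def)

lemma derivation_lin:
  "derivation q X \<Longrightarrow> f \<in> regular q \<Longrightarrow> g \<in> regular q \<Longrightarrow>
    X (\<lambda>p. c * f p + g p) = (\<lambda>p. c * X f p + X g p)"
  by (simp add: derivation_def)

lemma derivation_mult:
  "derivation q X \<Longrightarrow> f \<in> regular q \<Longrightarrow> g \<in> regular q \<Longrightarrow>
    X (\<lambda>p. f p * g p) = (\<lambda>p. f p * X g p + X f p * g p)"
  by (simp add: derivation_def)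

lemma derivation_zero:
  assumes "derivation q X" shows "X (\<lambda>p. 0) = (\<lambda>p. 0)"
proof -
  have "X (\<lambda>p. 1 * 0 + 0) = (\<lambda>p. 1 * X (\<lambda>p. 0) p + X (\<lambda>p. 0) p)"
    using derivation_lin[OF assms regular_zero regular_zero] .
  then have "X (\<lambda>p. 0) = (\<lambda>p. X (\<lambda>p. 0) p + X (\<lambda>p. 0) p)" by simp
  then show ?thesis by (metis add_cancel_right_right)
qed

lemma derivation_cmult:
  "derivation q X \<Longrightarrow> f \<in> regular q \<Longrightarrow> X (\<lambda>p. c * f p) = (\<lambda>p. c * X f p)"
  using derivation_lin[of q X f "\<lambda>p. 0" c] by (simp add: derivation_zero regular_zero)

lemma derivation_add:
  "derivation q X \<Longrightarrow> f \<in> regular q \<Longrightarrow> g \<in> regular q \<Longrightarrow> X (\<lambda>p. f p + g p) = (\<lambda>p. X f p + X g p)"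
  using derivation_lin[of q X f g 1] by simp

lemma derivation_diff:
  "derivation q X \<Longrightarrow> f \<in> regular q \<Longrightarrow> g \<in> regular q \<Longrightarrow> X (\<lambda>p. f p - g p) = (\<lambda>p. X f p - X g p)"
  using derivation_lin[of q X g f "-1"] by (simp add: fun_eq_iff)

lemma regular_sum:
  "(\<And>i. i \<in> I \<Longrightarrow> f i \<in> regular q) \<Longrightarrow> (\<lambda>p. \<Sum>i\<in>I. f i p) \<in> regular q"
  by (induction I rule: infinite_finite_induct) (auto intro: regular_intros)

lemma derivation_sum:
  assumes "derivation q X"
  shows "(\<And>i. i \<in> I \<Longrightarrow> f i \<in> regular q) \<Longrightarrow> X (\<lambda>p. \<Sum>i\<in>I. f i p) = (\<lambda>p. \<Sum>i\<in>I. X (f i) p)"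
  by (induction I rule: infinite_finite_induct)
    (auto simp: derivation_zero[OF assms] derivation_add[OF assms] regular_sum)

text \<open>The argument has the shape of a value of a bracket with a wedge added to it. In the
  applications D is one of the vector fields or the original bracket with one argument
  fixed.\<close>

lemma derivation_wedge_form:
  assumes D: "derivation q D"
    and reg: "u \<in> regular q" "f \<in> regular q" "g \<in> regular q" "h \<in> regular q" "k \<in> regular q"
  shows "D (\<lambda>p. u p + c * (f p * g p - h p * k p)) =
    (\<lambda>p. D u p + c * ((f p * D g p + D f p * g p) - (h p * D k p + D h p * k p)))"
proof -
  have "D (\<lambda>p. f p * g p - h p * k p) =
    (\<lambda>p. (f p * D g p + D f p * g p) - (h p * D k p + D h p * k p))"
    using derivation_diff[OF D regular_mult[OF reg(2,3)] regular_mult[OF reg(4,5)]]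
    unfolding derivation_mult[OF D reg(2,3)] derivation_mult[OF D reg(4,5)] .
  then show ?thesis
    using derivation_add[OF D reg(1) regular_cmult[where c = c],
        OF regular_diff[OF regular_mult[OF reg(2,3)] regular_mult[OF reg(4,5)]]]
      derivation_cmult[OF D regular_diff[OF regular_mult[OF reg(2,3)] regular_mult[OF reg(4,5)]]]
    by (simp only:)
qed

section \<open>Adding wedge products of commuting symmetries to a Poisson bracket\<close>

definition wedge ::
  "((('n, 'd) pt \<Rightarrow> complex) \<Rightarrow> ('n, 'd) pt \<Rightarrow> complex) \<Rightarrow>
   ((('n, 'd) pt \<Rightarrow> complex) \<Rightarrow> ('n, 'd) pt \<Rightarrow> complex) \<Rightarrow> ('n::finite, 'd::finite) bracket" where
  "wedge X Y f g p = X f p * Y g p - Y f p * X g p"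

text \<open>Vanishing of the Lie derivative of the bivector B along X.\<close>

definition preserves ::
  "complex \<Rightarrow> ((('n::finite, 'd::{finite, linorder}) pt \<Rightarrow> complex) \<Rightarrow> ('n, 'd) pt \<Rightarrow> complex) \<Rightarrow>
   ('n, 'd) bracket \<Rightarrow> bool" where
  "preserves q X B \<longleftrightarrow>
     (\<forall>f\<in>regular q. \<forall>g\<in>regular q. X (B f g) = (\<lambda>p. B (X f) g p + B f (X g) p))"

definition commuting ::
  "complex \<Rightarrow> ((('n::finite, 'd::{finite, linorder}) pt \<Rightarrow> complex) \<Rightarrow> ('n, 'd) pt \<Rightarrow> complex) \<Rightarrow>
   ((('n, 'd) pt \<Rightarrow> complex) \<Rightarrow> ('n, 'd) pt \<Rightarrow> complex) \<Rightarrow> bool" where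
  "commuting q X Y \<longleftrightarrow> (\<forall>f\<in>regular q. X (Y f) = Y (X f))"

lemma poisson_regular: "poisson_bracket q B \<Longrightarrow> f \<in> regular q \<Longrightarrow> g \<in> regular q \<Longrightarrow> B f g \<in> regular q"
  unfolding poisson_bracket_def by blast

lemma poisson_antisym:
  assumes "poisson_bracket q B" "f \<in> regular q" "g \<in> regular q"
  shows "B f g p = - B g f p"
proof -
  have "B f g = (\<lambda>p. - B g f p)"
    using assms unfolding poisson_bracket_def by blast
  then show ?thesis by metis
qed

lemma poisson_jacobi:
  "poisson_bracket q B \<Longrightarrow> f \<in> regular q \<Longrightarrow> g \<in> regular q \<Longrightarrow> h \<in> regular q \<Longrightarrow>
    B f (B g h) p + B g (B h f) p + B h (B f g) p = 0"
  unfolding poisson_bracket_def by blast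

lemma poisson_derivation1:
  assumes "poisson_bracket q B" "g \<in> regular q"
  shows "derivation q (\<lambda>f. B f g)"
  using assms unfolding poisson_bracket_def derivation_def by blast

lemma poisson_derivation2:
  fixes B :: "('n::finite, 'd::{finite, linorder}) bracket"
  assumes B: "poisson_bracket q B" and g: "g \<in> regular q"
  shows "derivation q (B g)"
proof -
  note D = poisson_derivation1[OF assms]
  have eq: "B g f = (\<lambda>p. - B f g p)" if "f \<in> regular q" for f
    by (rule ext) (rule poisson_antisym[OF B g that])
  show ?thesis
    unfolding derivation_def
  proof (intro conjI ballI allI)
    fix f h :: "('n, 'd) pt \<Rightarrow> complex" and c assume fh: "f \<in> regular q" "h \<in> regular q"
    show "B g (\<lambda>p. c * f p + h p) = (\<lambda>p. c * B g f p + B g h p)"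
      unfolding eq[OF fh(1)] eq[OF fh(2)] eq[OF regular_lin[OF fh]] derivation_lin[OF D fh] by simp
    show "B g (\<lambda>p. f p * h p) = (\<lambda>p. f p * B g h p + B g f p * h p)"
      unfolding eq[OF fh(1)] eq[OF fh(2)] eq[OF regular_mult[OF fh]] derivation_mult[OF D fh] by simp
  qed (rule poisson_regular[OF B g])
qed

lemma poisson_equivariant:
  "poisson_bracket q B \<Longrightarrow> bij \<sigma> \<Longrightarrow> f \<in> regular q \<Longrightarrow> g \<in> regular q \<Longrightarrow>
    B (f \<circ> act \<sigma>) (g \<circ> act \<sigma>) = B f g \<circ> act \<sigma>"
  unfolding poisson_bracket_def by blast

text \<open>In terms of the Schouten bracket, the cross term of B with X \<and> Y is built from the
  Lie derivatives of B along X and Y, and the bracket of X \<and> Y with itself is a multiple of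
  [X,Y] \<and> X \<and> Y; all of these vanish. The proof carries this out on the Jacobi sum of
  three functions.\<close>

lemma poisson_add_wedge:
  fixes B :: "('n::finite, 'd::{finite, linorder}) bracket"
  assumes B: "poisson_bracket q B" and X: "derivation q X" "equivariant q X" "preserves q X B"
    and Y: "derivation q Y" "equivariant q Y" "preserves q Y B" and XY: "commuting q X Y"
  shows "poisson_bracket q (\<lambda>f g p. B f g p + c * wedge X Y f g p)"
proof -
  define C where "C f g p = B f g p + c * wedge X Y f g p" for f g p
  note reg = regular_intros derivation_regular[OF X(1)] derivation_regular[OF Y(1)] poisson_regular[OF B]
  have C: "C f g = (\<lambda>p. B f g p + c * (X f p * Y g p - Y f p * X g p))" for f g
    by (simp add: C_def wedge_def fun_eq_iff)
  have Creg: "C f g \<in> regular q" if "f \<in> regular q" "g \<in> regular q" for f g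
    unfolding C using that by (intro reg)
  have DC: "D (C f g) p = D (B f g) p + c * ((X f p * D (Y g) p + D (X f) p * Y g p) -
      (Y f p * D (X g) p + D (Y f) p * X g p))"
    if "derivation q D" "f \<in> regular q" "g \<in> regular q" for D f g p
    unfolding C using that by (subst derivation_wedge_form) (auto intro: reg(6-8))
  have pX: "X (B f g) p = B (X f) g p + B f (X g) p" and pY: "Y (B f g) p = B (Y f) g p + B f (Y g) p"
    if "f \<in> regular q" "g \<in> regular q" for f g p
    using X(3) Y(3) that by (simp_all add: preserves_def)
  have com: "X (Y f) = Y (X f)" if "f \<in> regular q" for f
    using XY that by (simp add: commuting_def)
  have jac: "C f (C g h) p + C g (C h f) p + C h (C f g) p = 0"
    if fgh: "f \<in> regular q" "g \<in> regular q" "h \<in> regular q" for f g h p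
  proof -
    \<comment> \<open>One of the three cyclic terms. Invariance moves X and Y inside B, and mixed
      second derivatives are all written as Y (X _), so that equal terms become syntactically
      equal.\<close>
    have exp: "C f (C g h) p = B f (B g h) p
        + c * (X g p * B f (Y h) p + B f (X g) p * Y h p - (Y g p * B f (X h) p + B f (Y g) p * X h p))
        + c * (X f p * (B (Y g) h p + B g (Y h) p + c * (X g p * Y (Y h) p + Y (X g) p * Y h p
              - (Y g p * Y (X h) p + Y (Y g) p * X h p)))
            - Y f p * (B (X g) h p + B g (X h) p + c * (X g p * Y (X h) p + X (X g) p * Y h p
              - (Y g p * X (X h) p + Y (X g) p * X h p))))"
      if fgh: "f \<in> regular q" "g \<in> regular q" "h \<in> regular q" for f g h
    proof -
      have "C f (C g h) p = B f (C g h) p + c * (X f p * Y (C g h) p - Y f p * X (C g h) p)"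
        by (simp add: C_def wedge_def)
      then show ?thesis
        using fgh by (simp add: DC[OF poisson_derivation2[OF B]] DC[OF X(1)] DC[OF Y(1)] pX pY com)
    qed
    \<comment> \<open>Orients the brackets that contain one differentiated function in the same way
      in all three rotations; after that the terms linear and quadratic in c cancel.\<close>
    have "B (Y g) h p = - B h (Y g) p" "B (X g) h p = - B h (X g) p"
      "B (Y h) f p = - B f (Y h) p" "B (X h) f p = - B f (X h) p"
      "B (Y f) g p = - B g (Y f) p" "B (X f) g p = - B g (X f) p"
      using fgh by (auto intro!: poisson_antisym[OF B] reg)
    then show ?thesis
      using poisson_jacobi[OF B fgh, of p]
      unfolding exp[OF fgh] exp[OF fgh(2,3,1)] exp[OF fgh(3,1,2)] by (simp add: algebra_simps)
  qed
  have D1: "derivation q (\<lambda>f. C f h)" if h: "h \<in> regular q" for h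
    unfolding derivation_def
  proof (intro conjI ballI allI)
    fix f g :: "('n, 'd) pt \<Rightarrow> complex" and k assume fg: "f \<in> regular q" "g \<in> regular q"
    note D = X(1) Y(1) poisson_derivation1[OF B h]
    show "C (\<lambda>p. k * f p + g p) h = (\<lambda>p. k * C f h p + C g h p)"
      unfolding C D[THEN derivation_lin, OF fg] by (simp add: algebra_simps)
    show "C (\<lambda>p. f p * g p) h = (\<lambda>p. f p * C g h p + C f h p * g p)"
      unfolding C D[THEN derivation_mult, OF fg] by (simp add: algebra_simps)
  qed (rule Creg[OF _ h])
  have anti: "C f g = (\<lambda>p. - C g f p)" if "f \<in> regular q" "g \<in> regular q" for f g
    using poisson_antisym[OF B that] by (simp add: C algebra_simps)
  have eqv: "C (f \<circ> act \<sigma>) (g \<circ> act \<sigma>) = C f g \<circ> act \<sigma>"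
    if "bij \<sigma>" "f \<in> regular q" "g \<in> regular q" for \<sigma> f g
    using that X(2) Y(2) by (simp add: C equivariant_def poisson_equivariant[OF B] fun_eq_iff)
  have "poisson_bracket q C"
    unfolding poisson_bracket_def
    by (intro conjI ballI allI impI Creg jac anti eqv derivation_lin[OF D1] derivation_mult[OF D1])
  then show ?thesis
    by (simp add: C_def[abs_def])
qed

text \<open>The Lie derivative of X \<and> Y along Z is [Z,X] \<and> Y + X \<and> [Z,Y], hence 0.
  This allows wedges to be added one after another.\<close>

lemma preserves_add_wedge:
  fixes B :: "('n::finite, 'd::{finite, linorder}) bracket"
  assumes B: "poisson_bracket q B" and X: "derivation q X" "commuting q Z X"
    and Y: "derivation q Y" "commuting q Z Y" and Z: "derivation q Z" "preserves q Z B"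
  shows "preserves q Z (\<lambda>f g p. B f g p + c * wedge X Y f g p)"
  unfolding preserves_def wedge_def
proof (intro ballI)
  fix f g :: "('n, 'd) pt \<Rightarrow> complex" assume fg: "f \<in> regular q" "g \<in> regular q"
  note reg = regular_intros derivation_regular[OF X(1)] derivation_regular[OF Y(1)] poisson_regular[OF B]
  have com: "Z (X f) = X (Z f)" "Z (Y f) = Y (Z f)" if "f \<in> regular q" for f
    using X(2) Y(2) that by (simp_all add: commuting_def)
  show "Z (\<lambda>p. B f g p + c * (X f p * Y g p - Y f p * X g p)) =
    (\<lambda>p. B (Z f) g p + c * (X (Z f) p * Y g p - Y (Z f) p * X g p) +
       (B f (Z g) p + c * (X f p * Y (Z g) p - Y f p * X (Z g) p)))"
    using fg Z(2) unfolding preserves_def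
    by (subst derivation_wedge_form[OF Z(1)]) (auto intro: reg(6-8) simp: com algebra_simps)
qed

section \<open>The infinitesimal torus action\<close>

text \<open>The torus rescales $a_i^\mu$ by $t$ and $b_i^\mu$ by $t^{-1}$; dividing by the gauge
  factor that restores $\sum_\alpha a_i^\alpha = 1$ gives the following velocity.\<close>

definition torus_vec :: "'d \<Rightarrow> ('n::finite, 'd::finite) pt \<Rightarrow> ('n, 'd) pt" where
  "torus_vec \<mu> p = (0, (\<chi> i \<alpha>. ac p i \<alpha> * (of_bool (\<alpha> = \<mu>) - ac p i \<mu>)),
     (\<chi> i \<alpha>. bc p i \<alpha> * (ac p i \<mu> - of_bool (\<alpha> = \<mu>))))"

text \<open>The orbit through p is replaced by the straight line with the velocity frozen at p,
  which has the same first derivative.\<close>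

definition torus ::
  "complex \<Rightarrow> 'd \<Rightarrow> (('n::finite, 'd::{finite, linorder}) pt \<Rightarrow> complex) \<Rightarrow> ('n, 'd) pt \<Rightarrow> complex" where
  "torus q \<mu> f = on_hreg q (\<lambda>p. dird (torus_vec \<mu> p) f p)"

lemma coords_torus_vec:
  "xc (torus_vec \<mu> p) i = 0"
  "ac (torus_vec \<mu> p) i \<alpha> = ac p i \<alpha> * (of_bool (\<alpha> = \<mu>) - ac p i \<mu>)"
  "bc (torus_vec \<mu> p) i \<alpha> = bc p i \<alpha> * (ac p i \<mu> - of_bool (\<alpha> = \<mu>))"
  by (simp_all add: torus_vec_def xc_def ac_def bc_def)

lemma sum_of_bool_mult:
  fixes f :: "'a::finite \<Rightarrow> 'b::comm_ring_1"
  shows "(\<Sum>\<alpha>\<in>UNIV. f \<alpha> * of_bool (\<alpha> = \<mu>)) = f \<mu>" "(\<Sum>\<alpha>\<in>UNIV. of_bool (\<alpha> = \<mu>) * f \<alpha>) = f \<mu>"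
  by (simp_all add: of_bool_def if_distrib if_distribR cong: if_cong)

lemma tangent_torus_vec: "p \<in> hreg q \<Longrightarrow> tangent (torus_vec \<mu> p)"
  using hregD(4)[of p q]
  by (simp add: tangent_def coords_torus_vec right_diff_distrib sum_subtractf sum_of_bool_mult
      sum_distrib_right[symmetric])

text \<open>The velocity is polynomial in the coordinates, so the field maps polynomials to
  polynomials; the quotient rule then keeps \<open>torus q \<mu>\<close> inside the regular
  functions.\<close>

lemma torus_poly:
  assumes "P \<in> poly_fun"
  shows "\<exists>P'\<in>poly_fun. \<forall>p. ((\<lambda>t. P (line p (torus_vec \<mu> p) t)) has_field_derivative P' p) (at 0)"
  using assms
proof induction
  case (const c)
  show ?case by (rule bexI[OF _ poly_fun.const[of 0]]) auto
next
  case (x i)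
  show ?case by (rule bexI[OF _ poly_fun.const[of 0]]) (auto simp: coords_torus_vec)
next
  case (a i \<alpha>)
  show ?case
    by (rule bexI[of _ "\<lambda>p. ac p i \<alpha> * (of_bool (\<alpha> = \<mu>) - ac p i \<mu>)"],
        force simp: coords_torus_vec intro!: derivative_eq_intros)
      (intro poly_fun.mult poly_fun_diff poly_fun.const poly_fun.a)
next
  case (b i \<alpha>)
  show ?case
    by (rule bexI[of _ "\<lambda>p. bc p i \<alpha> * (ac p i \<mu> - of_bool (\<alpha> = \<mu>))"],
        force simp: coords_torus_vec intro!: derivative_eq_intros)
      (intro poly_fun.mult poly_fun_diff poly_fun.const poly_fun.a poly_fun.b)
next
  case (add P Q)
  then obtain P' Q' where PQ: "P' \<in> poly_fun" "Q' \<in> poly_fun"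
    and d: "\<And>p. ((\<lambda>t. P (line p (torus_vec \<mu> p) t)) has_field_derivative P' p) (at 0)"
      "\<And>p. ((\<lambda>t. Q (line p (torus_vec \<mu> p) t)) has_field_derivative Q' p) (at 0)"
    by blast
  show ?case
    by (rule bexI[OF _ poly_fun.add[OF PQ]]) (auto intro!: derivative_intros d)
next
  case (mult P Q)
  then obtain P' Q' where PQ: "P' \<in> poly_fun" "Q' \<in> poly_fun"
    and d: "\<And>p. ((\<lambda>t. P (line p (torus_vec \<mu> p) t)) has_field_derivative P' p) (at 0)"
      "\<And>p. ((\<lambda>t. Q (line p (torus_vec \<mu> p) t)) has_field_derivative Q' p) (at 0)"
    by blast
  show ?case
    by (rule bexI[OF _ poly_fun.add[OF poly_fun.mult[OF PQ(1) mult.hyps(2)] poly_fun.mult[OF PQ(2) mult.hyps(1)]]])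
      (intro allI, rule DERIV_cong[OF DERIV_mult[OF d]], simp)
qed

lemma torus_on_hreg:
  assumes "q \<noteq> 1" "p \<in> hreg q"
    and "((\<lambda>t. f (line p (torus_vec \<mu> p) t)) has_field_derivative D) (at 0)"
  shows "torus q \<mu> (on_hreg q f) p = D"
  using dird_on_hreg[OF assms(2,1) tangent_torus_vec[OF assms(2)] assms(3)] assms(2)
  by (simp add: torus_def on_hreg_def)

lemma torus_outside: "p \<notin> hreg q \<Longrightarrow> torus q \<mu> f p = 0"
  by (simp add: torus_def on_hreg_def)

lemma torus_derivation:
  assumes q: "q \<noteq> 1"
  shows "derivation q (torus q \<mu> :: (('n::finite, 'd::{finite, linorder}) pt \<Rightarrow> complex) \<Rightarrow> _)"
  unfolding derivation_def
proof (intro conjI ballI allI)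
  fix f g :: "('n, 'd) pt \<Rightarrow> complex" and c assume fg: "f \<in> regular q" "g \<in> regular q"
  have D: "dird (torus_vec \<mu> p) (\<lambda>p. c * f p + g p) p =
      c * dird (torus_vec \<mu> p) f p + dird (torus_vec \<mu> p) g p"
    "dird (torus_vec \<mu> p) (\<lambda>p. f p * g p) p =
      f p * dird (torus_vec \<mu> p) g p + dird (torus_vec \<mu> p) f p * g p" if "p \<in> hreg q" for p
    using dird_tangent_vector[OF that q tangent_torus_vec[OF that]] fg
    unfolding tangent_vector_def by blast+
  show "torus q \<mu> (\<lambda>p. c * f p + g p) = (\<lambda>p. c * torus q \<mu> f p + torus q \<mu> g p)"
    using D(1) by (intro ext) (simp add: torus_def on_hreg_def)
  show "torus q \<mu> (\<lambda>p. f p * g p) = (\<lambda>p. f p * torus q \<mu> g p + torus q \<mu> f p * g p)"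
    using D(2) by (intro ext) (simp add: torus_def on_hreg_def)
next
  fix f :: "('n, 'd) pt \<Rightarrow> complex" assume "f \<in> regular q"
  then obtain P Q where PQ: "P \<in> poly_fun" "Q \<in> poly_fun" "\<And>p. p \<in> hreg q \<Longrightarrow> Q p \<noteq> 0"
      "f = on_hreg q (\<lambda>p. P p / Q p)"
    using regularE by blast
  obtain P' Q' where PQ': "P' \<in> poly_fun" "Q' \<in> poly_fun"
    and d: "\<And>p. ((\<lambda>t. P (line p (torus_vec \<mu> p) t)) has_field_derivative P' p) (at 0)"
      "\<And>p. ((\<lambda>t. Q (line p (torus_vec \<mu> p) t)) has_field_derivative Q' p) (at 0)"
    using torus_poly[OF PQ(1)] torus_poly[OF PQ(2)] by metis
  show "torus q \<mu> f \<in> regular q"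
  proof (rule regularI)
    show "(\<lambda>p. P' p * Q p - P p * Q' p) \<in> poly_fun" "(\<lambda>p. Q p * Q p) \<in> poly_fun"
      by (intro poly_fun_diff poly_fun.mult PQ PQ')+
    fix p :: "('n, 'd) pt" assume p: "p \<in> hreg q"
    then show "Q p * Q p \<noteq> 0"
      using PQ(3) by simp
    show "torus q \<mu> f p = (P' p * Q p - P p * Q' p) / (Q p * Q p)"
      unfolding PQ(4) using DERIV_divide[OF d(1)[of p] d(2)[of p]] PQ(3)[OF p]
      by (intro torus_on_hreg[OF q p]) simp
  qed (rule torus_outside)
qed

lemma act_line_torus: "act \<sigma> (line p (torus_vec \<mu> p) t) = line (act \<sigma> p) (torus_vec \<mu> (act \<sigma> p)) t"
  by (rule pt_eqI) (simp_all add: coords_torus_vec)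

text \<open>The torus acts on upper indices by the same formula for every lower index, so lines in
  its direction are permuted among each other.\<close>

lemma torus_equivariant: "equivariant q (torus q \<mu>)"
  unfolding equivariant_def
  by (auto simp: torus_def on_hreg_def dird_def act_hreg_iff act_line_torus fun_eq_iff)

lemma torus_coordinates:
  assumes "q \<noteq> 1"
  shows "torus q \<mu> (xf q i) = (\<lambda>p. 0)"
    "torus q \<mu> (af q i \<alpha>) = (\<lambda>p. af q i \<alpha> p * (of_bool (\<alpha> = \<mu>) - af q i \<mu> p))"
    "torus q \<mu> (bf q i \<alpha>) = (\<lambda>p. bf q i \<alpha> p * (af q i \<mu> p - of_bool (\<alpha> = \<mu>)))"
proof -
  have "torus q \<mu> (xf q i) p = 0 \<and>
     torus q \<mu> (af q i \<alpha>) p = af q i \<alpha> p * (of_bool (\<alpha> = \<mu>) - af q i \<mu> p) \<and>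
     torus q \<mu> (bf q i \<alpha>) p = bf q i \<alpha> p * (af q i \<mu> p - of_bool (\<alpha> = \<mu>))" for p
  proof (cases "p \<in> hreg q")
    case True
    then show ?thesis
      unfolding xf_def af_def bf_def
      by (intro conjI torus_on_hreg[OF assms])
        (auto simp: on_hreg_def coords_torus_vec intro!: derivative_eq_intros)
  qed (simp add: torus_outside af_def bf_def on_hreg_def)
  then show "torus q \<mu> (xf q i) = (\<lambda>p. 0)"
    "torus q \<mu> (af q i \<alpha>) = (\<lambda>p. af q i \<alpha> p * (of_bool (\<alpha> = \<mu>) - af q i \<mu> p))"
    "torus q \<mu> (bf q i \<alpha>) = (\<lambda>p. bf q i \<alpha> p * (af q i \<mu> p - of_bool (\<alpha> = \<mu>)))"
    by auto
qed

text \<open>This is the shape of the torus derivative of a coordinate. A nonzero constant is not in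
  \<open>regular q\<close>, whose elements vanish off \<open>hreg\<close>, so the product rule
  applies only after expanding to k f - f g.\<close>

lemma derivation_affine:
  assumes X: "derivation q X" and fg: "f \<in> regular q" "g \<in> regular q"
  shows "X (\<lambda>p. f p * (k - g p)) = (\<lambda>p. X f p * (k - g p) - f p * X g p)"
    "X (\<lambda>p. f p * (g p - k)) = (\<lambda>p. X f p * (g p - k) + f p * X g p)"
proof -
  note r = regular_mult[OF fg] regular_cmult[where c = k, OF fg(1)]
  have "(\<lambda>p. f p * (k - g p)) = (\<lambda>p. k * f p - f p * g p)" "(\<lambda>p. f p * (g p - k)) = (\<lambda>p. f p * g p - k * f p)"
    by (simp_all add: algebra_simps)
  then show "X (\<lambda>p. f p * (k - g p)) = (\<lambda>p. X f p * (k - g p) - f p * X g p)"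
    "X (\<lambda>p. f p * (g p - k)) = (\<lambda>p. X f p * (g p - k) + f p * X g p)"
    by (simp_all add: derivation_diff[OF X r] derivation_diff[OF X r(2,1)] derivation_mult[OF X fg]
        derivation_cmult[OF X fg(1)] algebra_simps)
qed

text \<open>The cross terms X f * Y g + Y f * X g of the second derivative of a product are
  symmetric in X and Y and cancel. Hence commutation has to be tested on coordinates only.\<close>

lemma commutator_tangent_vector:
  fixes X Y :: "(('n::finite, 'd::{finite, linorder}) pt \<Rightarrow> complex) \<Rightarrow> ('n, 'd) pt \<Rightarrow> complex"
  assumes X: "derivation q X" and Y: "derivation q Y"
  shows "tangent_vector q p (\<lambda>f. X (Y f) p - Y (X f) p)"
  unfolding tangent_vector_def
proof (intro conjI ballI allI)
  fix f g :: "('n, 'd) pt \<Rightarrow> complex" and c assume fg: "f \<in> regular q" "g \<in> regular q"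
  note Xr = derivation_regular[OF X fg(1)] derivation_regular[OF X fg(2)]
  note Yr = derivation_regular[OF Y fg(1)] derivation_regular[OF Y fg(2)]
  show "X (Y (\<lambda>p'. c * f p' + g p')) p - Y (X (\<lambda>p'. c * f p' + g p')) p =
      c * (X (Y f) p - Y (X f) p) + (X (Y g) p - Y (X g) p)"
    unfolding derivation_lin[OF X fg] derivation_lin[OF Y fg] derivation_lin[OF X Yr]
      derivation_lin[OF Y Xr] by (simp add: algebra_simps)
  show "X (Y (\<lambda>p'. f p' * g p')) p - Y (X (\<lambda>p'. f p' * g p')) p =
      f p * (X (Y g) p - Y (X g) p) + (X (Y f) p - Y (X f) p) * g p"
    unfolding derivation_mult[OF X fg] derivation_mult[OF Y fg]
      derivation_add[OF X regular_mult[OF fg(1) Yr(2)] regular_mult[OF Yr(1) fg(2)]]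
      derivation_add[OF Y regular_mult[OF fg(1) Xr(2)] regular_mult[OF Xr(1) fg(2)]]
      derivation_mult[OF X fg(1) Yr(2)] derivation_mult[OF X Yr(1) fg(2)]
      derivation_mult[OF Y fg(1) Xr(2)] derivation_mult[OF Y Xr(1) fg(2)]
    by (simp add: algebra_simps)
qed

lemma torus_commuting:
  assumes q: "q \<noteq> 1"
  shows "commuting q (torus q \<mu>) (torus q \<nu> :: (('n::finite, 'd::{finite, linorder}) pt \<Rightarrow> complex) \<Rightarrow> _)"
  unfolding commuting_def
proof (intro ballI ext)
  fix f :: "('n, 'd) pt \<Rightarrow> complex" and p assume f: "f \<in> regular q"
  note D = torus_derivation[OF q]
  show "torus q \<mu> (torus q \<nu> f) p = torus q \<nu> (torus q \<mu> f) p"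
  proof (cases "p \<in> hreg q")
    case True
    have "torus q \<mu> (torus q \<nu> f) p - torus q \<nu> (torus q \<mu> f) p = 0"
    proof (rule tangent_vector_eq_zero[OF commutator_tangent_vector[OF D D] True _ _ _ f])
      note simps = torus_coordinates[OF q] derivation_zero[OF D] derivation_affine[OF D] coordinate_regular
      show "torus q \<mu> (torus q \<nu> (xf q i)) p - torus q \<nu> (torus q \<mu> (xf q i)) p = 0" for i
        by (simp only: simps diff_self)
      show "torus q \<mu> (torus q \<nu> (af q i \<alpha>)) p - torus q \<nu> (torus q \<mu> (af q i \<alpha>)) p = 0" for i \<alpha>
        by (simp only: simps) (simp add: algebra_simps)
      show "torus q \<mu> (torus q \<nu> (bf q i \<alpha>)) p - torus q \<nu> (torus q \<mu> (bf q i \<alpha>)) p = 0" for i \<alpha>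
        by (simp only: simps) (simp add: algebra_simps)
    qed
    then show ?thesis by simp
  qed (simp add: torus_outside)
qed

text \<open>The defect \<open>L f g p\<close> is an antisymmetric biderivation, so it is determined
  by pairs of coordinates, and antisymmetry reduces the nine types of pairs to six.\<close>

lemma preservesI:
  fixes B :: "('n::finite, 'd::{finite, linorder}) bracket"
  assumes B: "poisson_bracket q B" and X: "derivation q X"
    and gen: "\<And>p i j. p \<in> hreg q \<Longrightarrow>
        X (B (xf q i) (xf q j)) p = B (X (xf q i)) (xf q j) p + B (xf q i) (X (xf q j)) p"
      "\<And>p i j \<beta>. p \<in> hreg q \<Longrightarrow>
        X (B (xf q i) (af q j \<beta>)) p = B (X (xf q i)) (af q j \<beta>) p + B (xf q i) (X (af q j \<beta>)) p"
      "\<And>p i j \<beta>. p \<in> hreg q \<Longrightarrow>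
        X (B (xf q i) (bf q j \<beta>)) p = B (X (xf q i)) (bf q j \<beta>) p + B (xf q i) (X (bf q j \<beta>)) p"
      "\<And>p i \<alpha> j \<beta>. p \<in> hreg q \<Longrightarrow>
        X (B (af q i \<alpha>) (af q j \<beta>)) p = B (X (af q i \<alpha>)) (af q j \<beta>) p + B (af q i \<alpha>) (X (af q j \<beta>)) p"
      "\<And>p i \<alpha> j \<beta>. p \<in> hreg q \<Longrightarrow>
        X (B (af q i \<alpha>) (bf q j \<beta>)) p = B (X (af q i \<alpha>)) (bf q j \<beta>) p + B (af q i \<alpha>) (X (bf q j \<beta>)) p"
      "\<And>p i \<alpha> j \<beta>. p \<in> hreg q \<Longrightarrow>
        X (B (bf q i \<alpha>) (bf q j \<beta>)) p = B (X (bf q i \<alpha>)) (bf q j \<beta>) p + B (bf q i \<alpha>) (X (bf q j \<beta>)) p"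
  shows "preserves q X B"
proof -
  note reg = derivation_regular[OF X] poisson_regular[OF B]
  define L where "L f g p = X (B f g) p - (B (X f) g p + B f (X g) p)" for f g p
  have anti: "L f g p = - L g f p" if fg: "f \<in> regular q" "g \<in> regular q" for f g p
  proof -
    have "B f g = (\<lambda>p. (-1) * B g f p)"
      by (rule ext) (simp add: poisson_antisym[OF B fg])
    then have "X (B f g) = (\<lambda>p. (-1) * X (B g f) p)"
      using derivation_cmult[OF X poisson_regular[OF B fg(2,1)], of "-1"] by simp
    then show ?thesis
      using poisson_antisym[OF B reg(1)[OF fg(1)] fg(2), of p] poisson_antisym[OF B fg(1) reg(1)[OF fg(2)], of p]
      by (simp add: L_def)
  qed
  have tv: "tangent_vector q p (\<lambda>f. L f g p)" if g: "g \<in> regular q" for g p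
    unfolding tangent_vector_def
  proof (intro conjI ballI allI)
    fix f h :: "('n, 'd) pt \<Rightarrow> complex" and c assume fh: "f \<in> regular q" "h \<in> regular q"
    note Bg = poisson_derivation1[OF B g] and BXg = poisson_derivation1[OF B reg(1)[OF g]]
    note r = fh reg(1)[OF fh(1)] reg(1)[OF fh(2)] reg(2)[OF fh(1) g] reg(2)[OF fh(2) g]
    show "L (\<lambda>p'. c * f p' + h p') g p = c * L f g p + L h g p"
      unfolding L_def derivation_lin[OF Bg fh] derivation_lin[OF BXg fh] derivation_lin[OF X fh]
        derivation_lin[OF X r(5,6)] derivation_lin[OF Bg r(3,4)]
      by (simp add: algebra_simps)
    show "L (\<lambda>p'. f p' * h p') g p = f p * L h g p + L f g p * h p"
      unfolding L_def derivation_mult[OF Bg fh] derivation_mult[OF BXg fh] derivation_mult[OF X fh]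
        derivation_add[OF X regular_mult[OF r(1,6)] regular_mult[OF r(5,2)]]
        derivation_mult[OF X r(1,6)] derivation_mult[OF X r(5,2)]
        derivation_add[OF Bg regular_mult[OF r(1,4)] regular_mult[OF r(3,2)]]
        derivation_mult[OF Bg r(1,4)] derivation_mult[OF Bg r(3,2)]
      by (simp add: algebra_simps)
  qed
  have zero: "L f g p = 0" if p: "p \<in> hreg q" and fg: "f \<in> regular q" "g \<in> regular q" for f g p
  proof -
    have gen0: "L (xf q i) (xf q j) p = 0" "L (xf q i) (af q j \<beta>) p = 0" "L (xf q i) (bf q j \<beta>) p = 0"
      "L (af q i \<alpha>) (af q j \<beta>) p = 0" "L (af q i \<alpha>) (bf q j \<beta>) p = 0" "L (bf q i \<alpha>) (bf q j \<beta>) p = 0"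
      for i \<alpha> j \<beta>
      using gen[OF p] by (simp_all add: L_def)
    have gen1: "L (af q i \<alpha>) (xf q j) p = 0" "L (bf q i \<alpha>) (xf q j) p = 0" "L (bf q i \<alpha>) (af q j \<beta>) p = 0"
      for i \<alpha> j \<beta>
      using gen0 by (simp_all add: anti[OF coordinate_regular(2) coordinate_regular(1)]
          anti[OF coordinate_regular(3) coordinate_regular(1)] anti[OF coordinate_regular(3) coordinate_regular(2)])
    \<comment> \<open>Generality is gained in one slot at a time: first f is arbitrary against a
      coordinate, then antisymmetry exchanges the slots and g becomes arbitrary.\<close>
    have "L f (xf q j) p = 0" "L f (af q j \<beta>) p = 0" "L f (bf q j \<beta>) p = 0" for j \<beta>
      by (rule tangent_vector_eq_zero[OF tv p _ _ _ fg(1)]; simp add: gen0 gen1)+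
    then have "L (xf q j) f p = 0" "L (af q j \<beta>) f p = 0" "L (bf q j \<beta>) f p = 0" for j \<beta>
      using anti[OF coordinate_regular(1) fg(1)] anti[OF coordinate_regular(2) fg(1)]
        anti[OF coordinate_regular(3) fg(1)] by simp_all
    then have "L g f p = 0"
      by (intro tangent_vector_eq_zero[OF tv[OF fg(1)] p _ _ _ fg(2)])
    then show ?thesis
      using anti[OF fg] by simp
  qed
  show ?thesis
    unfolding preserves_def
  proof (intro ballI ext)
    fix f g :: "('n, 'd) pt \<Rightarrow> complex" and p assume fg: "f \<in> regular q" "g \<in> regular q"
    show "X (B f g) p = B (X f) g p + B f (X g) p"
    proof (cases "p \<in> hreg q")
      case True
      then show ?thesis
        using zero[OF True fg] by (simp add: L_def)
    next
      case False
      then show ?thesis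
        using regular_outside[OF _ False] reg(1)[OF fg(1)] reg(1)[OF fg(2)] reg(1)[OF reg(2)[OF fg]]
          reg(2)[OF _ fg(2)] reg(2)[OF fg(1)] by (metis add_0)
    qed
  qed
qed

section \<open>The torus preserves the Chalykh-Fairon bracket\<close>

text \<open>\<open>osum\<close> and \<open>psum\<close> absorb the sums over upper indices in the
  bracket formulas. Their torus derivatives are polynomials in themselves and the coordinates, so
  the later verifications see them as atoms.\<close>

definition osum :: "('n::finite, 'd::{finite, linorder}) pt \<Rightarrow> 'n \<Rightarrow> 'd \<Rightarrow> complex" where
  "osum p i \<alpha> = (\<Sum>\<gamma>\<in>UNIV. ordsgn \<alpha> \<gamma> * ac p i \<gamma>)"

definition psum :: "('n::finite, 'd::{finite, linorder}) pt \<Rightarrow> 'd \<Rightarrow> 'n \<Rightarrow> 'n \<Rightarrow> complex" where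
  "psum p \<beta> i j = (\<Sum>\<gamma>\<in>{..<\<beta>}. ac p i \<gamma> * bc p j \<gamma>)"

lemma sum_lessThan_of_bool:
  fixes f :: "'d::{finite, linorder} \<Rightarrow> complex"
  shows "(\<Sum>\<gamma>\<in>{..<\<beta>}. f \<gamma>) = (\<Sum>\<gamma>\<in>UNIV. of_bool (\<gamma> < \<beta>) * f \<gamma>)"
  by (rule sum.mono_neutral_cong_left) auto

text \<open>By the gauge condition, 1 - a_i^\<beta> is the sum below \<beta> plus the sum above it,
  while \<open>osum\<close> is the sum above minus the sum below.\<close>

lemma partial_sum_osum:
  assumes "p \<in> hreg q"
  shows "(\<Sum>\<gamma>\<in>{..<\<beta>}. ac p i \<gamma>) = (1 - ac p i \<beta> - osum p i \<beta>) / 2"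
proof -
  have "1 - ac p i \<beta> - osum p i \<beta> =
      (\<Sum>\<gamma>\<in>UNIV. ac p i \<gamma> - of_bool (\<gamma> = \<beta>) * ac p i \<gamma> - ordsgn \<beta> \<gamma> * ac p i \<gamma>)"
    by (simp add: sum_subtractf hregD(4)[OF assms] osum_def sum_of_bool_mult)
  also have "\<dots> = (\<Sum>\<gamma>\<in>UNIV. of_bool (\<gamma> < \<beta>) * (2 * ac p i \<gamma>))"
    by (rule sum.cong) (auto simp: ordsgn_def)
  also have "\<dots> = 2 * (\<Sum>\<gamma>\<in>{..<\<beta>}. ac p i \<gamma>)"
    by (simp add: sum_lessThan_of_bool[symmetric] sum_distrib_left)
  finally show ?thesis by simp
qed

lemma aa0_osum:
  "aa0 p i \<alpha> j \<beta> = 1/2 * (phi p i j * (ac p i \<alpha> * ac p j \<beta> + ac p j \<alpha> * ac p i \<beta> - ac p j \<alpha> * ac p j \<beta>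
        - ac p i \<alpha> * ac p i \<beta>))
    + 1/2 * (ordsgn \<beta> \<alpha> * (ac p i \<alpha> * ac p j \<beta> + ac p j \<alpha> * ac p i \<beta>))
    + 1/2 * (ac p j \<beta> * (ac p i \<alpha> * osum p j \<alpha> + ac p j \<alpha> * osum p i \<alpha>))
    - 1/2 * (ac p i \<alpha> * (ac p j \<beta> * osum p i \<beta> + ac p i \<beta> * osum p j \<beta>))"
  by (simp add: aa0_def Let_def osum_def sum_distrib_left sum.distrib[symmetric] algebra_simps)

text \<open>The values \<open>ab0\<close> with all sums absorbed. The rewriting of partial sums uses
  the gauge condition, hence the hypothesis p \<in> hreg q when the two are identified;
  \<open>bb_form\<close> does the same for \<open>bb0\<close>.\<close>

definition ab_form :: "complex \<Rightarrow> ('n::finite, 'd::{finite, linorder}) pt \<Rightarrow> 'n \<Rightarrow> 'd \<Rightarrow> 'n \<Rightarrow> 'd \<Rightarrow> complex" where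
  "ab_form q p i \<alpha> j \<beta> = (ac p i \<alpha> - of_bool (\<alpha> = \<beta>)) * (Zc q p {} i j + psum p \<beta> i j)
    - 1/2 * (phi p i j * ((ac p i \<alpha> - ac p j \<alpha>) * bc p j \<beta>))
    + of_bool (\<alpha> < \<beta>) * (ac p i \<alpha> * bc p j \<beta>)
    - 1/2 * (ac p i \<alpha> * (bc p j \<beta> * (1 - ac p i \<beta> - osum p i \<beta>)))
    - 1/2 * (bc p j \<beta> * (ac p i \<alpha> * osum p j \<alpha> + ac p j \<alpha> * osum p i \<alpha>))"

definition bb_form :: "complex \<Rightarrow> ('n::finite, 'd::{finite, linorder}) pt \<Rightarrow> 'n \<Rightarrow> 'd \<Rightarrow> 'n \<Rightarrow> 'd \<Rightarrow> complex" where
  "bb_form q p i \<alpha> j \<beta> = 1/2 * (phi p i j * (bc p i \<alpha> * bc p j \<beta> + bc p j \<alpha> * bc p i \<beta>))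
    - bc p i \<alpha> * (Zc q p {} i j + psum p \<beta> i j) + bc p j \<beta> * (Zc q p {} j i + psum p \<alpha> j i)
    + 1/2 * (ordsgn \<beta> \<alpha> * (bc p i \<alpha> * bc p j \<beta> - bc p j \<alpha> * bc p i \<beta>))
    + 1/2 * (bc p i \<alpha> * (bc p j \<beta> * (1 - ac p i \<beta> - osum p i \<beta>)))
    - 1/2 * (bc p i \<alpha> * (bc p j \<beta> * (1 - ac p j \<alpha> - osum p j \<alpha>)))"

lemma partial_sum_diff:
  assumes "p \<in> hreg q"
  shows "(\<Sum>\<gamma>\<in>{..<\<beta>}. ac p i \<gamma> * (bc p j \<gamma> - bc p j \<beta>)) =
    psum p \<beta> i j - 1/2 * ((1 - ac p i \<beta> - osum p i \<beta>) * bc p j \<beta>)"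
proof -
  have "(\<Sum>\<gamma>\<in>{..<\<beta>}. ac p i \<gamma> * (bc p j \<gamma> - bc p j \<beta>)) =
      psum p \<beta> i j - (\<Sum>\<gamma>\<in>{..<\<beta>}. ac p i \<gamma>) * bc p j \<beta>"
    by (simp add: psum_def right_diff_distrib sum_subtractf sum_distrib_right)
  then show ?thesis
    by (simp add: partial_sum_osum[OF assms])
qed

lemma ab0_form:
  assumes "p \<in> hreg q"
  shows "ab0 q p i \<alpha> j \<beta> = ab_form q p i \<alpha> j \<beta>"
proof -
  have "(\<Sum>\<gamma>\<in>UNIV. ordsgn \<alpha> \<gamma> * bc p j \<beta> * (ac p i \<alpha> * ac p j \<gamma> + ac p j \<alpha> * ac p i \<gamma>)) =
      bc p j \<beta> * (ac p i \<alpha> * osum p j \<alpha> + ac p j \<alpha> * osum p i \<alpha>)"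
    by (simp add: osum_def sum_distrib_left sum.distrib algebra_simps)
  then show ?thesis
    unfolding ab0_def Let_def psum_def[symmetric] partial_sum_diff[OF assms] ab_form_def
    by (simp add: algebra_simps)
qed

lemma bb0_form:
  assumes "p \<in> hreg q"
  shows "bb0 q p i \<alpha> j \<beta> = bb_form q p i \<alpha> j \<beta>"
  unfolding bb0_def Let_def partial_sum_diff[OF assms] bb_form_def by (simp add: algebra_simps)

text \<open>In a product a_i^\<gamma> b_j^\<gamma> the two rescalings cancel and only the gauge
  factors of i and j remain. So f_ij, its partial sums and Z_ij all have the same weight a_j^\<mu> -
  a_i^\<mu>, independent of \<gamma>.\<close>

lemma torus_line_derivative:
  "((\<lambda>t. ac (line p (torus_vec \<mu> p) t) i \<alpha>) has_field_derivative
      ac p i \<alpha> * (of_bool (\<alpha> = \<mu>) - ac p i \<mu>)) (at 0)"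
  "((\<lambda>t. bc (line p (torus_vec \<mu> p) t) i \<alpha>) has_field_derivative
      bc p i \<alpha> * (ac p i \<mu> - of_bool (\<alpha> = \<mu>))) (at 0)"
  "((\<lambda>t. phi (line p (torus_vec \<mu> p) t) i j) has_field_derivative 0) (at 0)"
  "((\<lambda>t. osum (line p (torus_vec \<mu> p) t) i \<alpha>) has_field_derivative
      ordsgn \<alpha> \<mu> * ac p i \<mu> - ac p i \<mu> * osum p i \<alpha>) (at 0)"
  "((\<lambda>t. psum (line p (torus_vec \<mu> p) t) \<beta> i j) has_field_derivative
      psum p \<beta> i j * (ac p j \<mu> - ac p i \<mu>)) (at 0)"
  "((\<lambda>t. Zc q (line p (torus_vec \<mu> p) t) {} i j) has_field_derivative
      Zc q p {} i j * (ac p j \<mu> - ac p i \<mu>)) (at 0)"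
proof -
  show a: "((\<lambda>t. ac (line p (torus_vec \<mu> p) t) i \<alpha>) has_field_derivative
      ac p i \<alpha> * (of_bool (\<alpha> = \<mu>) - ac p i \<mu>)) (at 0)" for i \<alpha>
    by (force simp: coords_torus_vec intro!: derivative_eq_intros)
  show b: "((\<lambda>t. bc (line p (torus_vec \<mu> p) t) i \<alpha>) has_field_derivative
      bc p i \<alpha> * (ac p i \<mu> - of_bool (\<alpha> = \<mu>))) (at 0)" for i \<alpha>
    by (force simp: coords_torus_vec intro!: derivative_eq_intros)
  show "((\<lambda>t. phi (line p (torus_vec \<mu> p) t) i j) has_field_derivative 0) (at 0)"
    by (simp add: phi_def coords_torus_vec)
  have "(\<Sum>\<gamma>\<in>UNIV. ordsgn \<alpha> \<gamma> * (ac p i \<gamma> * (of_bool (\<gamma> = \<mu>) - ac p i \<mu>))) =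
      ordsgn \<alpha> \<mu> * ac p i \<mu> - ac p i \<mu> * osum p i \<alpha>"
    using sum_of_bool_mult(1)[of "\<lambda>\<gamma>. ordsgn \<alpha> \<gamma> * ac p i \<gamma>" \<mu>]
    by (simp add: right_diff_distrib sum_subtractf osum_def sum_distrib_left mult_ac)
  then show "((\<lambda>t. osum (line p (torus_vec \<mu> p) t) i \<alpha>) has_field_derivative
      ordsgn \<alpha> \<mu> * ac p i \<mu> - ac p i \<mu> * osum p i \<alpha>) (at 0)"
    unfolding osum_def[of "line p (torus_vec \<mu> p) t" for t]
    by (rule DERIV_cong[rotated]) (intro DERIV_sum DERIV_cmult a)
  \<comment> \<open>Stated for any index set G: the initial segments give \<open>psum\<close>, the
    full set gives \<open>fc\<close> and thereby \<open>Zc\<close>.\<close>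
  have S: "((\<lambda>t. \<Sum>\<gamma>\<in>G. ac (line p (torus_vec \<mu> p) t) i \<gamma> * bc (line p (torus_vec \<mu> p) t) j \<gamma>)
      has_field_derivative (\<Sum>\<gamma>\<in>G. ac p i \<gamma> * bc p j \<gamma>) * (ac p j \<mu> - ac p i \<mu>)) (at 0)" for G
  proof (rule DERIV_cong[OF DERIV_sum])
    show "((\<lambda>t. ac (line p (torus_vec \<mu> p) t) i \<gamma> * bc (line p (torus_vec \<mu> p) t) j \<gamma>)
        has_field_derivative ac p i \<gamma> * bc p j \<gamma> * (ac p j \<mu> - ac p i \<mu>)) (at 0)" for \<gamma>
      by (rule DERIV_cong[OF DERIV_mult[OF a b]]) (simp add: algebra_simps)
  qed (simp add: sum_distrib_right)
  show "((\<lambda>t. psum (line p (torus_vec \<mu> p) t) \<beta> i j) has_field_derivative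
      psum p \<beta> i j * (ac p j \<mu> - ac p i \<mu>)) (at 0)"
    unfolding psum_def by (rule S)
  have "((\<lambda>t. fc (line p (torus_vec \<mu> p) t) i j * (q / (xc p i * inverse (xc p j) - q))) has_field_derivative
      fc p i j * (ac p j \<mu> - ac p i \<mu>) * (q / (xc p i * inverse (xc p j) - q))) (at 0)"
    unfolding fc_def by (rule DERIV_cmult_right) (rule S)
  then show "((\<lambda>t. Zc q (line p (torus_vec \<mu> p) t) {} i j) has_field_derivative
      Zc q p {} i j * (ac p j \<mu> - ac p i \<mu>)) (at 0)"
    by (simp add: Zc_def coords_torus_vec mult_ac)
qed

lemma phi_sym: "phi p j i = - phi p i j"
proof -
  have "(xc p j + xc p i) / (xc p j - xc p i) = - ((xc p i + xc p j) / (xc p i - xc p j))"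
    by (metis add.commute minus_diff_eq minus_divide_right)
  then show ?thesis
    by (auto simp: phi_def)
qed

lemma ordsgn_simps [simp]:
  "ordsgn \<alpha> \<alpha> = 0" "\<alpha> < \<beta> \<Longrightarrow> ordsgn \<alpha> \<beta> = 1" "\<beta> < \<alpha> \<Longrightarrow> ordsgn \<alpha> \<beta> = -1"
  by (auto simp: ordsgn_def)

lemmas torus_derivative_rules = torus_line_derivative DERIV_const DERIV_add DERIV_diff DERIV_mult

text \<open>The right-hand side is what invariance demands: T applied to either argument, with T
  a_i^\<alpha> = a_i^\<alpha> (\<delta> - a_i^\<mu>) expanded by the Leibniz rule. Fixing the
  relative order of \<alpha>, \<beta>, \<mu> turns all signs and indicators into numbers.\<close>

lemma aa0_torus:
  "((\<lambda>t. aa0 (line p (torus_vec \<mu> p) t) i \<alpha> j \<beta>) has_field_derivative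
     (of_bool (\<alpha> = \<mu>) - ac p i \<mu>) * aa0 p i \<alpha> j \<beta> - ac p i \<alpha> * aa0 p i \<mu> j \<beta>
     + (of_bool (\<beta> = \<mu>) - ac p j \<mu>) * aa0 p i \<alpha> j \<beta> - ac p j \<beta> * aa0 p i \<alpha> j \<mu>) (at 0)"
  unfolding aa0_osum
  by (rule DERIV_cong, (rule torus_derivative_rules)+,
      cases \<alpha> \<beta> rule: linorder_cases; cases \<alpha> \<mu> rule: linorder_cases; cases \<beta> \<mu> rule: linorder_cases)
    (simp_all add: less_imp_not_eq less_imp_not_eq2 less_imp_not_less field_simps)

lemma ab_form_torus:
  "((\<lambda>t. ab_form q (line p (torus_vec \<mu> p) t) i \<alpha> j \<beta>) has_field_derivative
     (of_bool (\<alpha> = \<mu>) - ac p i \<mu>) * ab_form q p i \<alpha> j \<beta> - ac p i \<alpha> * ab_form q p i \<mu> j \<beta>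
     + (ac p j \<mu> - of_bool (\<beta> = \<mu>)) * ab_form q p i \<alpha> j \<beta> + bc p j \<beta> * aa0 p i \<alpha> j \<mu>) (at 0)"
  unfolding aa0_osum ab_form_def
  by (rule DERIV_cong, (rule torus_derivative_rules)+,
      cases \<alpha> \<beta> rule: linorder_cases; cases \<alpha> \<mu> rule: linorder_cases; cases \<beta> \<mu> rule: linorder_cases)
    (simp_all add: less_imp_not_eq less_imp_not_eq2 less_imp_not_less field_simps)

text \<open>The last term is {b_i^\<alpha>, a_j^\<mu>}, written as minus the tabulated value with
  arguments exchanged; this is the source of the minus sign and the swapped indices.\<close>

lemma bb_form_torus:
  "((\<lambda>t. bb_form q (line p (torus_vec \<mu> p) t) i \<alpha> j \<beta>) has_field_derivative
     (ac p i \<mu> - of_bool (\<alpha> = \<mu>)) * bb_form q p i \<alpha> j \<beta> + bc p i \<alpha> * ab_form q p i \<mu> j \<beta>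
     + (ac p j \<mu> - of_bool (\<beta> = \<mu>)) * bb_form q p i \<alpha> j \<beta> - bc p j \<beta> * ab_form q p j \<mu> i \<alpha>) (at 0)"
  unfolding ab_form_def bb_form_def phi_sym[of p j i]
  by (rule DERIV_cong, (rule torus_derivative_rules)+,
      cases \<alpha> \<beta> rule: linorder_cases; cases \<alpha> \<mu> rule: linorder_cases; cases \<beta> \<mu> rule: linorder_cases)
    (simp_all add: less_imp_not_eq less_imp_not_eq2 less_imp_not_less field_simps)


lemma chalykh_fairon_poisson: "chalykh_fairon q B \<Longrightarrow> poisson_bracket q B"
  by (simp add: chalykh_fairon_def)

lemma chalykh_fairon_coordinates:
  assumes "chalykh_fairon q B"
  shows "B (xf q i) (xf q j) = (\<lambda>p. 0)" "B (xf q i) (af q j \<beta>) = (\<lambda>p. 0)"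
    "B (xf q i) (bf q j \<beta>) = (\<lambda>p. of_bool (i = j) * (xf q i p * bf q j \<beta> p))"
    "B (af q i \<alpha>) (af q j \<beta>) = on_hreg q (\<lambda>p. aa0 p i \<alpha> j \<beta>)"
    "B (af q i \<alpha>) (bf q j \<beta>) = on_hreg q (\<lambda>p. ab_form q p i \<alpha> j \<beta>)"
    "B (bf q i \<alpha>) (bf q j \<beta>) = on_hreg q (\<lambda>p. bb_form q p i \<alpha> j \<beta>)"
proof -
  note out = regular_outside[OF poisson_regular[OF chalykh_fairon_poisson[OF assms]]]
  have v: "has_values q B aa0 (ab0 q) (bb0 q)"
    using assms by (simp add: chalykh_fairon_def)
  have "B (xf q i) (xf q j) p = 0 \<and> B (xf q i) (af q j \<beta>) p = 0 \<and>
    B (xf q i) (bf q j \<beta>) p = of_bool (i = j) * (xf q i p * bf q j \<beta> p) \<and>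
    B (af q i \<alpha>) (af q j \<beta>) p = on_hreg q (\<lambda>p. aa0 p i \<alpha> j \<beta>) p \<and>
    B (af q i \<alpha>) (bf q j \<beta>) p = on_hreg q (\<lambda>p. ab_form q p i \<alpha> j \<beta>) p \<and>
    B (bf q i \<alpha>) (bf q j \<beta>) p = on_hreg q (\<lambda>p. bb_form q p i \<alpha> j \<beta>) p" for p
  proof (cases "p \<in> hreg q")
    case True
    then show ?thesis
      using v by (simp add: has_values_def on_hreg_def ab0_form bb0_form xf_def bf_def)
  next
    case False
    then show ?thesis
      by (simp add: out regular_outside[OF coordinate_regular(1)] on_hreg_def)
  qed
  then show "B (xf q i) (xf q j) = (\<lambda>p. 0)" "B (xf q i) (af q j \<beta>) = (\<lambda>p. 0)"
    "B (xf q i) (bf q j \<beta>) = (\<lambda>p. of_bool (i = j) * (xf q i p * bf q j \<beta> p))"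
    "B (af q i \<alpha>) (af q j \<beta>) = on_hreg q (\<lambda>p. aa0 p i \<alpha> j \<beta>)"
    "B (af q i \<alpha>) (bf q j \<beta>) = on_hreg q (\<lambda>p. ab_form q p i \<alpha> j \<beta>)"
    "B (bf q i \<alpha>) (bf q j \<beta>) = on_hreg q (\<lambda>p. bb_form q p i \<alpha> j \<beta>)"
    by blast+
qed

lemma torus_preserves_chalykh_fairon:
  fixes B :: "('n::finite, 'd::{finite, linorder}) bracket"
  assumes q: "q \<noteq> 1" and cf: "chalykh_fairon q B"
  shows "preserves q (torus q \<mu>) B"
proof -
  note B = chalykh_fairon_poisson[OF cf] and val = chalykh_fairon_coordinates[OF cf]
  note T = torus_derivation[OF q] and tor = torus_coordinates[OF q]
  note D1 = poisson_derivation1[OF B] and D2 = poisson_derivation2[OF B]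
  note ev = torus_on_hreg[OF q]
  note simps = tor val derivation_affine[OF D1] derivation_affine[OF D2] derivation_zero[OF D1]
    derivation_zero[OF D2] derivation_zero[OF T] coordinate_regular
    derivation_cmult[OF T regular_mult] derivation_mult[OF T]
  show ?thesis
  proof (rule preservesI[OF B T])
    fix p :: "('n, 'd) pt" and i j :: 'n and \<alpha> \<beta> :: 'd
    assume p: "p \<in> hreg q"
    have ba: "B (bf q i \<alpha>) (af q j \<beta>) p = - ab_form q p j \<beta> i \<alpha>" for i \<alpha> j \<beta>
      using p by (simp add: poisson_antisym[OF B coordinate_regular(3,2)] val on_hreg_def)
    show "torus q \<mu> (B (xf q i) (xf q j)) p =
        B (torus q \<mu> (xf q i)) (xf q j) p + B (xf q i) (torus q \<mu> (xf q j)) p"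
      by (simp only: simps) simp
    show "torus q \<mu> (B (xf q i) (af q j \<beta>)) p =
        B (torus q \<mu> (xf q i)) (af q j \<beta>) p + B (xf q i) (torus q \<mu> (af q j \<beta>)) p"
      by (simp only: simps) simp
    show "torus q \<mu> (B (xf q i) (bf q j \<beta>)) p =
        B (torus q \<mu> (xf q i)) (bf q j \<beta>) p + B (xf q i) (torus q \<mu> (bf q j \<beta>)) p"
      by (simp only: simps) (simp add: algebra_simps)
    show "torus q \<mu> (B (af q i \<alpha>) (af q j \<beta>)) p =
        B (torus q \<mu> (af q i \<alpha>)) (af q j \<beta>) p + B (af q i \<alpha>) (torus q \<mu> (af q j \<beta>)) p"
      by (simp only: simps ev[OF p aa0_torus]) (use p in \<open>simp add: on_hreg_def af_def algebra_simps\<close>)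
    show "torus q \<mu> (B (af q i \<alpha>) (bf q j \<beta>)) p =
        B (torus q \<mu> (af q i \<alpha>)) (bf q j \<beta>) p + B (af q i \<alpha>) (torus q \<mu> (bf q j \<beta>)) p"
      by (simp only: simps ev[OF p ab_form_torus])
        (use p in \<open>simp add: on_hreg_def af_def bf_def algebra_simps\<close>)
    show "torus q \<mu> (B (bf q i \<alpha>) (bf q j \<beta>)) p =
        B (torus q \<mu> (bf q i \<alpha>)) (bf q j \<beta>) p + B (bf q i \<alpha>) (torus q \<mu> (bf q j \<beta>)) p"
      by (simp only: simps ev[OF p bb_form_torus] ba)
        (use p in \<open>simp add: on_hreg_def af_def bf_def algebra_simps\<close>)
  qed
qed

section \<open>The equations of motion\<close>

text \<open>Built from \<open>af\<close> and \<open>bf\<close> rather than \<open>fc\<close>, so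
  that it is visibly a ring element on which derivations act term by term.\<close>

definition trace_fun :: "complex \<Rightarrow> ('n::finite, 'd::{finite, linorder}) pt \<Rightarrow> complex" where
  "trace_fun q p = (\<Sum>j\<in>UNIV. \<Sum>\<alpha>\<in>UNIV. af q j \<alpha> p * bf q j \<alpha> p)"

lemma trace_fun_regular: "trace_fun q \<in> regular q"
  unfolding trace_fun_def[abs_def] by (intro regular_sum regular_mult coordinate_regular)

lemma trace_fun_eq: "trace_fun q = on_hreg q (\<lambda>p. \<Sum>j\<in>UNIV. fc p j j)"
  by (auto simp: trace_fun_def on_hreg_def af_def bf_def fc_def)

lemma trace_fun_invariant:
  "invariant_fun (trace_fun q :: ('n::finite, 'd::{finite, linorder}) pt \<Rightarrow> complex)"
  unfolding invariant_fun_def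
proof (intro allI impI ext)
  fix \<sigma> :: "'n \<Rightarrow> 'n" and p :: "('n, 'd) pt" assume s: "bij \<sigma>"
  have "(\<Sum>j\<in>UNIV. fc p (\<sigma> j) (\<sigma> j)) = (\<Sum>j\<in>UNIV. fc p j j)"
    using s by (intro sum.reindex_bij_betw) auto
  then show "(trace_fun q \<circ> act \<sigma>) p = trace_fun q p"
    by (simp add: trace_fun_eq on_hreg_def act_hreg_iff[OF s])
qed

lemma derivation_trace_fun:
  assumes D: "derivation q D"
  shows "D (trace_fun q) p = (\<Sum>j\<in>UNIV. \<Sum>\<alpha>\<in>UNIV. af q j \<alpha> p * D (bf q j \<alpha>) p + D (af q j \<alpha>) p * bf q j \<alpha> p)"
proof -
  have "D (\<lambda>p. \<Sum>\<alpha>\<in>UNIV. af q j \<alpha> p * bf q j \<alpha> p) =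
      (\<lambda>p. \<Sum>\<alpha>\<in>UNIV. af q j \<alpha> p * D (bf q j \<alpha>) p + D (af q j \<alpha>) p * bf q j \<alpha> p)" for j
    by (subst derivation_sum[OF D]) (auto intro: regular_mult simp: derivation_mult[OF D])
  then show ?thesis
    unfolding trace_fun_def[abs_def]
    by (subst derivation_sum[OF D]) (auto intro!: regular_sum regular_mult)
qed

lemma torus_trace_fun:
  assumes "q \<noteq> 1"
  shows "torus q \<mu> (trace_fun q) p = 0"
  unfolding derivation_trace_fun[OF torus_derivation[OF assms]] torus_coordinates[OF assms]
  by (simp add: algebra_simps)

text \<open>The indicator of \<alpha> < \<beta> is half of 1 - [\<alpha> = \<beta>] -
  o(\<beta>,\<alpha>), and with the opposite sign of o that of \<beta> < \<alpha>.\<close>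

lemma sum_of_bool_less:
  "(\<Sum>\<alpha>\<in>UNIV. of_bool (\<alpha> < \<beta>) * f \<alpha>) = 1/2 * ((\<Sum>\<alpha>\<in>UNIV. f \<alpha>) - f \<beta> - (\<Sum>\<alpha>\<in>UNIV. ordsgn \<beta> \<alpha> * f \<alpha>))"
  "(\<Sum>\<alpha>\<in>UNIV. of_bool (\<beta> < \<alpha>) * f \<alpha>) = 1/2 * ((\<Sum>\<alpha>\<in>UNIV. f \<alpha>) - f \<beta> + (\<Sum>\<alpha>\<in>UNIV. ordsgn \<beta> \<alpha> * f \<alpha>))"
  for f :: "'d::{finite, linorder} \<Rightarrow> complex"
proof -
  have f: "f \<beta> = (\<Sum>\<alpha>\<in>UNIV. of_bool (\<alpha> = \<beta>) * f \<alpha>)"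
    by (simp add: sum_of_bool_mult)
  show "(\<Sum>\<alpha>\<in>UNIV. of_bool (\<alpha> < \<beta>) * f \<alpha>) = 1/2 * ((\<Sum>\<alpha>\<in>UNIV. f \<alpha>) - f \<beta> - (\<Sum>\<alpha>\<in>UNIV. ordsgn \<beta> \<alpha> * f \<alpha>))"
    unfolding f sum_distrib_left sum_subtractf[symmetric]
    by (rule sum.cong) (auto simp: ordsgn_def)
  show "(\<Sum>\<alpha>\<in>UNIV. of_bool (\<beta> < \<alpha>) * f \<alpha>) = 1/2 * ((\<Sum>\<alpha>\<in>UNIV. f \<alpha>) - f \<beta> + (\<Sum>\<alpha>\<in>UNIV. ordsgn \<beta> \<alpha> * f \<alpha>))"
    unfolding f sum_distrib_left sum_subtractf[symmetric] sum.distrib[symmetric]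
    by (rule sum.cong) (auto simp: ordsgn_def)
qed

lemma psum_ordsgn:
  "psum p \<beta> i j = 1/2 * (fc p i j - ac p i \<beta> * bc p j \<beta> - (\<Sum>\<alpha>\<in>UNIV. ordsgn \<beta> \<alpha> * (ac p i \<alpha> * bc p j \<alpha>)))"
  unfolding psum_def sum_lessThan_of_bool sum_of_bool_less fc_def ..

text \<open>Exchanging the two summations turns the partial sums of a_k^\<gamma> b_j^\<gamma> into
  sums of a_j^\<alpha> above \<gamma>, and the gauge condition evaluates these as (1 - a_j^\<gamma>
  + \<open>osum\<close>) / 2.\<close>

lemma sum_psum:
  assumes "p \<in> hreg q"
  shows "(\<Sum>\<alpha>\<in>UNIV. ac p j \<alpha> * psum p \<alpha> k j) =
    1/2 * (fc p k j - (\<Sum>\<alpha>\<in>UNIV. ac p k \<alpha> * ac p j \<alpha> * bc p j \<alpha>) + (\<Sum>\<alpha>\<in>UNIV. ac p k \<alpha> * bc p j \<alpha> * osum p j \<alpha>))"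
proof -
  have "(\<Sum>\<alpha>\<in>UNIV. ac p j \<alpha> * psum p \<alpha> k j) =
      (\<Sum>\<alpha>\<in>UNIV. \<Sum>\<gamma>\<in>UNIV. ac p k \<gamma> * bc p j \<gamma> * (of_bool (\<gamma> < \<alpha>) * ac p j \<alpha>))"
    by (simp add: psum_def sum_lessThan_of_bool sum_distrib_left mult_ac)
  also have "\<dots> = (\<Sum>\<gamma>\<in>UNIV. \<Sum>\<alpha>\<in>UNIV. ac p k \<gamma> * bc p j \<gamma> * (of_bool (\<gamma> < \<alpha>) * ac p j \<alpha>))"
    by (rule sum.swap)
  also have "\<dots> = (\<Sum>\<gamma>\<in>UNIV. ac p k \<gamma> * bc p j \<gamma> * (1/2 * (1 - ac p j \<gamma> + osum p j \<gamma>)))"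
    unfolding sum_distrib_left[symmetric] sum_of_bool_less osum_def hregD(4)[OF assms] ..
  also have "\<dots> = 1/2 * (fc p k j - (\<Sum>\<alpha>\<in>UNIV. ac p k \<alpha> * ac p j \<alpha> * bc p j \<alpha>) + (\<Sum>\<alpha>\<in>UNIV. ac p k \<alpha> * bc p j \<alpha> * osum p j \<alpha>))"
    unfolding fc_def sum_distrib_left sum_subtractf[symmetric] sum.distrib[symmetric]
    by (rule sum.cong) (auto simp: algebra_simps)
  finally show ?thesis .
qed

text \<open>This is the bracket of f_jj with a_k^\<beta>. All order-dependent sums cancel, which is
  why the equations of motion do not see the ordering of the upper indices.\<close>

lemma sum_trace_a:
  assumes p: "p \<in> hreg q"
  shows "(\<Sum>\<alpha>\<in>UNIV. bc p j \<alpha> * aa0 p j \<alpha> k \<beta> - ac p j \<alpha> * ab_form q p k \<beta> j \<alpha>) =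
    (ac p j \<beta> - ac p k \<beta>) * (1/2 * (phi p j k * fc p k j) + 1/2 * fc p k j + Zc q p {} k j)"
proof -
  \<comment> \<open>Each summand type gets a name, so that the sum becomes a linear combination of
    \<open>sum A UNIV\<close>, \<open>sum B UNIV\<close> and so on, with coefficients free of
    \<alpha>, and the final identity is plain algebra.\<close>
  define A where "A \<alpha> = ac p j \<alpha> * bc p j \<alpha>" for \<alpha>
  define B where "B \<alpha> = ac p k \<alpha> * bc p j \<alpha>" for \<alpha>
  define C where "C \<alpha> = ac p k \<alpha> * ac p j \<alpha> * bc p j \<alpha>" for \<alpha>
  define V where "V \<alpha> = ordsgn \<beta> \<alpha> * A \<alpha>" for \<alpha>
  define W where "W \<alpha> = ordsgn \<beta> \<alpha> * B \<alpha>" for \<alpha>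
  define P where "P \<alpha> = ac p j \<alpha> * psum p \<alpha> k j" for \<alpha>
  define I where "I \<alpha> = ac p j \<alpha>" for \<alpha>
  define O1 where "O1 \<alpha> = ac p k \<alpha> * bc p j \<alpha> * osum p j \<alpha>" for \<alpha>
  define U where "U \<alpha> = of_bool (\<beta> < \<alpha>) * A \<alpha>" for \<alpha>
  note defs = V_def W_def P_def I_def O1_def U_def A_def B_def C_def
  have "bc p j \<alpha> * aa0 p j \<alpha> k \<beta> - ac p j \<alpha> * ab_form q p k \<beta> j \<alpha> =
      1/2 * phi p j k * (ac p j \<beta> - ac p k \<beta>) * B \<alpha>
      + 1/2 * ac p k \<beta> * V \<alpha> + 1/2 * ac p j \<beta> * W \<alpha> + 1/2 * ac p k \<beta> * O1 \<alpha>
      - ac p k \<beta> * Zc q p {} k j * I \<alpha> - ac p k \<beta> * P \<alpha>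
      + Zc q p {} k j * (of_bool (\<alpha> = \<beta>) * I \<alpha>) + of_bool (\<alpha> = \<beta>) * P \<alpha>
      - ac p k \<beta> * U \<alpha> + 1/2 * ac p k \<beta> * A \<alpha> - 1/2 * ac p k \<beta> * C \<alpha>" for \<alpha>
    unfolding aa0_osum ab_form_def defs phi_sym[of p k j] eq_commute[of \<beta> \<alpha>]
    by (simp add: field_simps)
  then have total: "(\<Sum>\<alpha>\<in>UNIV. bc p j \<alpha> * aa0 p j \<alpha> k \<beta> - ac p j \<alpha> * ab_form q p k \<beta> j \<alpha>) =
      1/2 * phi p j k * (ac p j \<beta> - ac p k \<beta>) * sum B UNIV
      + 1/2 * ac p k \<beta> * sum V UNIV + 1/2 * ac p j \<beta> * sum W UNIV
      + 1/2 * ac p k \<beta> * sum O1 UNIV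
      - ac p k \<beta> * Zc q p {} k j * sum I UNIV - ac p k \<beta> * sum P UNIV
      + Zc q p {} k j * I \<beta> + P \<beta>
      - ac p k \<beta> * sum U UNIV + 1/2 * ac p k \<beta> * sum A UNIV - 1/2 * ac p k \<beta> * sum C UNIV"
    by (simp only: sum.distrib sum_subtractf sum_distrib_left[symmetric] sum_of_bool_mult)
  have E1: "sum U UNIV = 1/2 * (sum A UNIV - A \<beta> + sum V UNIV)"
    unfolding U_def V_def by (rule sum_of_bool_less)
  have E2: "P \<beta> = ac p j \<beta> * (1/2 * (sum B UNIV - B \<beta> - sum W UNIV))"
    unfolding P_def psum_ordsgn W_def B_def fc_def ..
  have E3: "sum P UNIV = 1/2 * (sum B UNIV - sum C UNIV + sum O1 UNIV)"
    unfolding P_def sum_psum[OF p] C_def O1_def B_def fc_def ..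
  have E4: "sum I UNIV = 1" "I \<beta> = ac p j \<beta>"
    using hregD(4)[OF p] by (simp_all add: I_def)
  have E5: "A \<beta> = ac p j \<beta> * bc p j \<beta>" "B \<beta> = ac p k \<beta> * bc p j \<beta>"
    by (simp_all add: A_def B_def)
  have E6: "fc p k j = sum B UNIV"
    by (simp add: B_def fc_def)
  show ?thesis
    unfolding total E1 E2 E3 E4 E5 E6 by (simp add: field_simps)
qed

text \<open>This is the bracket of f_jj with b_k^\<beta>. The coefficient of b_k^\<beta> is the one
  from \<open>sum_trace_a\<close>; that of b_j^\<beta> is its negative with j and k
  exchanged.\<close>

lemma sum_trace_b:
  assumes p: "p \<in> hreg q"
  shows "(\<Sum>\<alpha>\<in>UNIV. ac p j \<alpha> * bb_form q p j \<alpha> k \<beta> + bc p j \<alpha> * ab_form q p j \<alpha> k \<beta>) =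
    bc p k \<beta> * (1/2 * (phi p j k * fc p k j) + 1/2 * fc p k j + Zc q p {} k j)
    + bc p j \<beta> * (1/2 * (phi p j k * fc p j k) - 1/2 * fc p j k - Zc q p {} j k)"
proof -
  define A where "A \<alpha> = ac p j \<alpha> * bc p j \<alpha>" for \<alpha>
  define B where "B \<alpha> = ac p k \<alpha> * bc p j \<alpha>" for \<alpha>
  define B' where "B' \<alpha> = ac p j \<alpha> * bc p k \<alpha>" for \<alpha>
  define C where "C \<alpha> = ac p k \<alpha> * ac p j \<alpha> * bc p j \<alpha>" for \<alpha>
  define V where "V \<alpha> = ordsgn \<beta> \<alpha> * A \<alpha>" for \<alpha>
  define W where "W \<alpha> = ordsgn \<beta> \<alpha> * B' \<alpha>" for \<alpha>
  define P where "P \<alpha> = ac p j \<alpha> * psum p \<alpha> k j" for \<alpha>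
  define I where "I \<alpha> = ac p j \<alpha>" for \<alpha>
  define J where "J \<alpha> = bc p j \<alpha>" for \<alpha>
  define O1 where "O1 \<alpha> = ac p k \<alpha> * bc p j \<alpha> * osum p j \<alpha>" for \<alpha>
  define U where "U \<alpha> = of_bool (\<alpha> < \<beta>) * A \<alpha>" for \<alpha>
  note defs = V_def W_def P_def I_def J_def O1_def U_def A_def B_def B'_def C_def
  have "ac p j \<alpha> * bb_form q p j \<alpha> k \<beta> + bc p j \<alpha> * ab_form q p j \<alpha> k \<beta> =
      1/2 * phi p j k * bc p k \<beta> * B \<alpha> + 1/2 * phi p j k * bc p j \<beta> * B' \<alpha>
      - (Zc q p {} j k + psum p \<beta> j k) * (of_bool (\<alpha> = \<beta>) * J \<alpha>)
      + bc p k \<beta> * Zc q p {} k j * I \<alpha> + bc p k \<beta> * P \<alpha> + bc p k \<beta> * U \<alpha>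
      + 1/2 * bc p k \<beta> * V \<alpha> - 1/2 * bc p j \<beta> * W \<alpha>
      - 1/2 * bc p k \<beta> * A \<alpha> + 1/2 * bc p k \<beta> * C \<alpha> - 1/2 * bc p k \<beta> * O1 \<alpha>" for \<alpha>
    unfolding bb_form_def ab_form_def defs
    by (simp add: field_simps)
  then have total: "(\<Sum>\<alpha>\<in>UNIV. ac p j \<alpha> * bb_form q p j \<alpha> k \<beta> + bc p j \<alpha> * ab_form q p j \<alpha> k \<beta>) =
      1/2 * phi p j k * bc p k \<beta> * sum B UNIV + 1/2 * phi p j k * bc p j \<beta> * sum B' UNIV
      - (Zc q p {} j k + psum p \<beta> j k) * J \<beta>
      + bc p k \<beta> * Zc q p {} k j * sum I UNIV + bc p k \<beta> * sum P UNIV + bc p k \<beta> * sum U UNIV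
      + 1/2 * bc p k \<beta> * sum V UNIV - 1/2 * bc p j \<beta> * sum W UNIV
      - 1/2 * bc p k \<beta> * sum A UNIV + 1/2 * bc p k \<beta> * sum C UNIV - 1/2 * bc p k \<beta> * sum O1 UNIV"
    by (simp only: sum.distrib sum_subtractf sum_distrib_left[symmetric] sum_of_bool_mult)
  have E1: "sum U UNIV = 1/2 * (sum A UNIV - A \<beta> - sum V UNIV)"
    unfolding U_def V_def by (rule sum_of_bool_less)
  have E2: "psum p \<beta> j k = 1/2 * (sum B' UNIV - B' \<beta> - sum W UNIV)"
    unfolding psum_ordsgn W_def B'_def fc_def ..
  have E3: "sum P UNIV = 1/2 * (sum B UNIV - sum C UNIV + sum O1 UNIV)"
    unfolding P_def sum_psum[OF p] C_def O1_def B_def fc_def ..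
  have E4: "sum I UNIV = 1" "J \<beta> = bc p j \<beta>"
    using hregD(4)[OF p] by (simp_all add: I_def J_def)
  have E5: "A \<beta> = ac p j \<beta> * bc p j \<beta>" "B' \<beta> = ac p j \<beta> * bc p k \<beta>"
    by (simp_all add: A_def B'_def)
  have E6: "fc p k j = sum B UNIV" "fc p j k = sum B' UNIV"
    by (simp_all add: B_def B'_def fc_def)
  show ?thesis
    unfolding total E1 E2 E3 E4 E5 E6 by (simp add: field_simps)
qed

text \<open>Since (x_k + q x_j) / (x_k - q x_j) = 1 + 2 q x_j / (x_k - q x_j), the second fraction
  of V contributes f_kj + 2 Z_kj. This links the potential of the equations of motion to the
  structure functions of the bracket.\<close>

lemma Vc_phi:
  assumes p: "p \<in> hreg q" and q: "q \<noteq> 1" and kj: "k \<noteq> j"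
  shows "Vc q p k j * fc p k j = phi p k j * fc p k j - fc p k j - 2 * Zc q p {} k j"
proof -
  have "xc p k - q * xc p j \<noteq> 0" "xc p j \<noteq> 0"
    using hregD[OF p] kj by auto
  moreover from this have "q * (fc p k j / (xc p k * inverse (xc p j) - q)) = q * xc p j * fc p k j / (xc p k - q * xc p j)"
    using hreg_denominator[OF p q, of k j] by (simp add: field_simps)
  moreover have "(xc p k + q * xc p j) / (xc p k - q * xc p j) = 1 + 2 * q * xc p j / (xc p k - q * xc p j)"
    using calculation(1) by (simp add: field_simps)
  ultimately show ?thesis
    using kj by (simp add: Vc_def phi_def Zc_def algebra_simps)
qed

lemma chalykh_fairon_spin_RS:
  fixes B :: "('n::finite, 'd::{finite, linorder}) bracket"
  assumes q: "q \<noteq> 1" and cf: "chalykh_fairon q B"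
  shows "spin_RS_equations q (\<lambda>f p. - 2 * B (trace_fun q) f p)"
  unfolding spin_RS_equations_def
proof (intro ballI allI conjI)
  fix p :: "('n, 'd) pt" and k :: 'n and \<beta> :: 'd
  assume p: "p \<in> hreg q"
  note B = chalykh_fairon_poisson[OF cf] and val = chalykh_fairon_coordinates[OF cf]
  note D = derivation_trace_fun[OF poisson_derivation1[OF B]]
  note anti = poisson_antisym[OF B coordinate_regular(3,1)] poisson_antisym[OF B coordinate_regular(2,1)]
    poisson_antisym[OF B coordinate_regular(3,2)]
  have "B (trace_fun q) (xf q k) p = (\<Sum>j\<in>UNIV. \<Sum>\<alpha>\<in>UNIV. - (of_bool (j = k) * (xc p k * (ac p j \<alpha> * bc p j \<alpha>))))"
    unfolding D[OF coordinate_regular(1)]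
    by (intro sum.cong refl) (simp only: anti val, use p in \<open>auto simp: on_hreg_def xf_def af_def bf_def\<close>)
  also have "\<dots> = - (\<Sum>j\<in>UNIV. of_bool (j = k) * (xc p k * fc p j j))"
    by (simp add: sum_negf sum_distrib_left[symmetric] fc_def)
  also have "\<dots> = - (xc p k * fc p k k)"
    by (subst sum_of_bool_mult) simp
  finally show "- 2 * B (trace_fun q) (xf q k) p = 2 * fc p k k * xc p k"
    by simp
  have "B (trace_fun q) (af q k \<beta>) p =
      (\<Sum>j\<in>UNIV. \<Sum>\<alpha>\<in>UNIV. bc p j \<alpha> * aa0 p j \<alpha> k \<beta> - ac p j \<alpha> * ab_form q p k \<beta> j \<alpha>)"
    unfolding D[OF coordinate_regular(2)]
    by (intro sum.cong refl) (simp only: anti val, use p in \<open>simp add: on_hreg_def af_def bf_def mult_ac\<close>)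
  then have "- 2 * B (trace_fun q) (af q k \<beta>) p =
      (\<Sum>j\<in>UNIV. (ac p j \<beta> - ac p k \<beta>) * (phi p k j * fc p k j - fc p k j - 2 * Zc q p {} k j))"
    by (simp only: sum_trace_a[OF p] sum_distrib_left, intro sum.cong refl)
      (simp add: phi_sym[of p k] field_simps)
  \<comment> \<open>The term j = k carries the factor a_k^\<beta> - a_k^\<beta>. It has to go before
    V appears, because \<open>Vc_phi\<close> holds off the diagonal.\<close>
  also have "\<dots> = (\<Sum>j\<in>UNIV - {k}. (ac p j \<beta> - ac p k \<beta>) * (phi p k j * fc p k j - fc p k j - 2 * Zc q p {} k j))"
    by (subst sum.remove[OF finite UNIV_I, of _ k]) simp
  also have "\<dots> = (\<Sum>j\<in>UNIV - {k}. Vc q p k j * fc p k j * (ac p j \<beta> - ac p k \<beta>))"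
    by (intro sum.cong refl) (use Vc_phi[OF p q] in auto)
  finally show "- 2 * B (trace_fun q) (af q k \<beta>) p =
      (\<Sum>j\<in>UNIV - {k}. Vc q p k j * fc p k j * (ac p j \<beta> - ac p k \<beta>))" .
  have "B (trace_fun q) (bf q k \<beta>) p =
      (\<Sum>j\<in>UNIV. \<Sum>\<alpha>\<in>UNIV. ac p j \<alpha> * bb_form q p j \<alpha> k \<beta> + bc p j \<alpha> * ab_form q p j \<alpha> k \<beta>)"
    unfolding D[OF coordinate_regular(3)]
    by (intro sum.cong refl) (simp only: val, use p in \<open>simp add: on_hreg_def af_def bf_def mult_ac\<close>)
  then have "- 2 * B (trace_fun q) (bf q k \<beta>) p =
      (\<Sum>j\<in>UNIV. bc p k \<beta> * (phi p k j * fc p k j - fc p k j - 2 * Zc q p {} k j)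
        - bc p j \<beta> * (phi p j k * fc p j k - fc p j k - 2 * Zc q p {} j k))"
    by (simp only: sum_trace_b[OF p] sum_distrib_left, intro sum.cong refl)
      (simp add: phi_sym[of p k] field_simps)
  \<comment> \<open>For j = k the two products are the same and cancel.\<close>
  also have "\<dots> = (\<Sum>j\<in>UNIV - {k}. bc p k \<beta> * (phi p k j * fc p k j - fc p k j - 2 * Zc q p {} k j)
        - bc p j \<beta> * (phi p j k * fc p j k - fc p j k - 2 * Zc q p {} j k))"
    by (subst sum.remove[OF finite UNIV_I, of _ k]) simp
  also have "\<dots> = (\<Sum>j\<in>UNIV - {k}. Vc q p k j * fc p k j * bc p k \<beta> - Vc q p j k * fc p j k * bc p j \<beta>)"
    by (intro sum.cong refl) (use Vc_phi[OF p q] in \<open>auto simp: mult_ac\<close>)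
  finally show "- 2 * B (trace_fun q) (bf q k \<beta>) p =
      (\<Sum>j\<in>UNIV - {k}. Vc q p k j * fc p k j * bc p k \<beta> - Vc q p j k * fc p j k * bc p j \<beta>)" .
qed

section \<open>A point with non-vanishing spin components\<close>

text \<open>Multiplying by the product of all x - y_k turns the relation into a polynomial P of
  degree below n that vanishes at the n distinct points x_i. So P = 0, and evaluating it at y_j
  isolates v_j.\<close>

lemma cauchy_matrix_kernel:
  fixes x y v :: "'n::finite \<Rightarrow> 'a::field"
  assumes "inj x" "inj y" "\<And>i j. x i \<noteq> y j" and v: "\<And>i. (\<Sum>j\<in>UNIV. v j / (x i - y j)) = 0"
  shows "v j = 0"
proof -
  define R where "R j = (\<Prod>k\<in>UNIV - {j}. [:- y k, 1:])" for j
  define P where "P = (\<Sum>j\<in>UNIV. smult (v j) (R j))"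
  have "degree (R j) \<le> CARD('n) - 1" for j
    using degree_prod_sum_le[of "UNIV - {j}" "\<lambda>k. [:- y k, 1:]"] by (simp add: R_def card_Diff_singleton)
  then have deg: "degree P \<le> CARD('n) - 1"
    unfolding P_def by (intro degree_sum_le) (auto intro: order_trans[OF degree_smult_le])
  have "poly P (x i) = 0" for i
  proof -
    have "poly (R j) (x i) = (\<Prod>k\<in>UNIV. x i - y k) / (x i - y j)" for j
      using prod.remove[of UNIV j "\<lambda>k. x i - y k"] assms(3)[of i j] by (simp add: R_def poly_prod)
    then have "poly P (x i) = (\<Prod>k\<in>UNIV. x i - y k) * (\<Sum>j\<in>UNIV. v j / (x i - y j))"
      by (simp add: P_def poly_sum sum_distrib_left mult_ac)
    then show ?thesis using v by simp
  qed
  then have "range x \<subseteq> {z. poly P z = 0}" by auto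
  moreover have "card (range x) = CARD('n)"
    using assms(1) by (rule card_image)
  ultimately have "P = 0"
    using deg card_mono[OF poly_roots_finite[of P], of "range x"] card_poly_roots_bound[of P]
      zero_less_card_finite[where 'a = 'n]
    by linarith
  have "poly (R k) (y j) = 0" if "k \<noteq> j" for k
    using that by (auto simp: R_def poly_prod)
  then have "poly P (y j) = v j * poly (R j) (y j)"
    unfolding P_def poly_sum poly_smult by (subst sum.remove[of UNIV j]) auto
  moreover have "poly (R j) (y j) \<noteq> 0"
    using assms(2) by (auto simp: R_def poly_prod inj_def)
  ultimately show ?thesis
    using \<open>P = 0\<close> by simp
qed

lemma det_nonzero_iff_kernel:
  fixes A :: "'a::field ^ 'n ^ 'n"
  shows "det A \<noteq> 0 \<longleftrightarrow> (\<forall>v. A *v v = 0 \<longrightarrow> v = 0)"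
  by (metis invertible_det_nz matrix_left_invertible_ker invertible_left_inverse)

text \<open>Adding multiples of the all-ones matrix $J$ to $A$ makes the determinant an affine function
  of the multiplier, so there is at most one exceptional value.\<close>

lemma det_add_constant_unique_root:
  fixes A :: "complex ^ 'n ^ 'n"
  assumes "det A \<noteq> 0" "det (\<chi> i j. A $ i $ j + s) = 0" "det (\<chi> i j. A $ i $ j + s') = 0"
  shows "s = s'"
proof -
  have mult: "(\<chi> i j. A $ i $ j + s) *v v = A *v v + (\<chi> i. s * (\<Sum>j\<in>UNIV. v $ j))" for s v
    by (simp add: vec_eq_iff matrix_vector_mult_def algebra_simps sum.distrib sum_distrib_left)
  \<comment> \<open>A kernel vector of A + s J satisfies A v = - s S 1 with S its coordinate sum.
    Invertibility of A excludes S = 0, so S can be normalized to 1; comparing s' v with s v' then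
    gives s = s'.\<close>
  have kernel: "\<exists>v. A *v v = (\<chi> i. - s) \<and> (\<Sum>j\<in>UNIV. v $ j) = 1"
    if s: "det (\<chi> i j. A $ i $ j + s) = 0" for s
  proof -
    obtain v where v: "(\<chi> i j. A $ i $ j + s) *v v = 0" "v \<noteq> 0"
      using s det_nonzero_iff_kernel by blast
    define S where "S = (\<Sum>j\<in>UNIV. v $ j)"
    have Av: "A *v v = (\<chi> i. - (s * S))"
      using v(1) unfolding mult S_def[symmetric] by (simp add: vec_eq_iff add_eq_0_iff2)
    have "S \<noteq> 0"
    proof
      assume "S = 0"
      then have "A *v v = 0" using Av by (simp add: vec_eq_iff)
      then show False using assms(1) v(2) det_nonzero_iff_kernel by blast
    qed
    then have "A *v (inverse S *s v) = (\<chi> i. - s) \<and> (\<Sum>j\<in>UNIV. (inverse S *s v) $ j) = 1"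
      using Av by (simp add: vec_eq_iff vector_scalar_commute sum_distrib_left[symmetric] S_def[symmetric])
    then show ?thesis by blast
  qed
  obtain v v' where v: "A *v v = (\<chi> i. - s)" "(\<Sum>j\<in>UNIV. v $ j) = 1"
      "A *v v' = (\<chi> i. - s')" "(\<Sum>j\<in>UNIV. v' $ j) = 1"
    using kernel[OF assms(2)] kernel[OF assms(3)] by blast
  have "A *v (s' *s v - s *s v') = 0"
    by (simp add: matrix_vector_mult_diff_distrib vector_scalar_commute v vec_eq_iff)
  then have "s' *s v = s *s v'"
    using assms(1) det_nonzero_iff_kernel by force
  then have "(\<Sum>j\<in>UNIV. s' * v $ j) = (\<Sum>j\<in>UNIV. s * v' $ j)"
    by (simp add: vec_eq_iff)
  then show ?thesis
    by (simp add: sum_distrib_left[symmetric] v)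
qed

text \<open>Distinct powers of a real M exceeding 1, |q| and 1/|q|: a quotient of two of them has
  modulus at least M, at most 1/M, or equals 1, and so is never q.\<close>

lemma exists_generic_positions:
  fixes q :: complex
  assumes "q \<noteq> 0" "q \<noteq> 1"
  shows "\<exists>x :: 'n::finite \<Rightarrow> complex. inj x \<and> (\<forall>i. x i \<noteq> 0) \<and> (\<forall>i j. x i \<noteq> q * x j)"
proof -
  obtain e :: "'n \<Rightarrow> nat" where e: "inj e"
    using finite_imp_inj_to_nat_seg[of "UNIV :: 'n set"] by auto
  define M where "M = norm q + inverse (norm q) + 1"
  have M: "M > 1" "M > norm q" "norm q * M > 1"
    using assms(1) by (auto simp: M_def algebra_simps add_pos_pos)
  define x where "x i = complex_of_real (M ^ e i)" for i
  have "x i \<noteq> q * x j" for i j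
  proof
    assume "x i = q * x j"
    then have n: "M ^ e i = norm q * M ^ e j"
      using M(1) by (metis (no_types, lifting) norm_mult norm_of_real abs_of_pos x_def zero_less_one
          less_trans zero_less_power)
    consider "e i = e j" | "e i > e j" | "e i < e j" by linarith
    then show False
    proof cases
      case 1
      then have "i = j" using e by (simp add: inj_def)
      then show False
        using \<open>x i = q * x j\<close> assms(2) M(1) by (simp add: x_def)
    next
      case 2
      then have "M ^ e i \<ge> M * M ^ e j"
        using M(1) power_increasing[of "Suc (e j)" "e i" M] by simp
      then have "M * M ^ e j \<le> norm q * M ^ e j" using n by simp
      moreover have "norm q * M ^ e j < M * M ^ e j" using M(1,2) by simp
      ultimately show False by simp
    next
      case 3
      then have "M ^ e j \<ge> M * M ^ e i"
        using M(1) power_increasing[of "Suc (e i)" "e j" M] by simp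
      then have "norm q * (M * M ^ e i) \<le> M ^ e i"
        using n mult_left_mono[of "M * M ^ e i" "M ^ e j" "norm q"] by simp
      moreover have "M ^ e i < norm q * (M * M ^ e i)"
        using M(1,3) mult_strict_right_mono[of 1 "norm q * M" "M ^ e i"] by (simp add: mult_ac)
      ultimately show False by simp
    qed
  qed
  moreover have "inj x"
    using e M(1) by (auto simp: inj_def x_def of_real_eq_iff simp del: of_real_power)
  moreover have "x i \<noteq> 0" for i
    using M(1) by (simp add: x_def)
  ultimately show ?thesis by blast
qed

text \<open>All entries except the last equal t, so the partial sums are k t and, at the end, 1; the
  latter is why s0 = 1 has to be excluded.\<close>

lemma exists_partial_sums:
  fixes s0 :: complex
  assumes "s0 \<noteq> 1" "CARD('d::{finite, linorder}) \<ge> 2"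
  shows "\<exists>c :: 'd \<Rightarrow> complex. (\<Sum>\<alpha>\<in>UNIV. c \<alpha>) = 1 \<and> (\<forall>\<alpha>. c \<alpha> \<noteq> 0) \<and> (\<forall>\<alpha>. (\<Sum>\<beta>\<in>{..\<alpha>}. c \<beta>) \<noteq> s0)"
proof -
  define m :: 'd where "m = Max UNIV"
  have m: "\<alpha> \<le> m" for \<alpha> by (simp add: m_def)
  \<comment> \<open>The forbidden values: 0 and 1 / (d - 1) would make an entry vanish, and s0 / k
    would make the partial sum k t equal to s0. The member k = 0 is merely s0 / 0 = 0.\<close>
  have "finite ({0, 1 / of_nat (CARD('d) - 1)} \<union> (\<lambda>k. s0 / of_nat k) ` {..CARD('d)})"
    by simp
  then obtain t where t: "t \<notin> {0, 1 / of_nat (CARD('d) - 1)} \<union> (\<lambda>k. s0 / of_nat k) ` {..CARD('d)}"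
    using ex_new_if_finite[OF infinite_UNIV_char_0] by blast
  define c where "c \<alpha> = (if \<alpha> = m then 1 - of_nat (CARD('d) - 1) * t else t)" for \<alpha>
  have "(\<Sum>\<alpha>\<in>UNIV. c \<alpha>) = c m + (\<Sum>\<alpha>\<in>UNIV - {m}. t)"
    by (subst sum.remove[of UNIV m]) (auto simp: c_def)
  then have total: "(\<Sum>\<alpha>\<in>UNIV. c \<alpha>) = 1"
    by (simp add: c_def)
  have "of_nat (CARD('d) - 1) \<noteq> (0 :: complex)"
    using assms(2) by simp
  then have "c \<alpha> \<noteq> 0" for \<alpha>
    using t by (auto simp: c_def field_simps)
  moreover have "(\<Sum>\<beta>\<in>{..\<alpha>}. c \<beta>) \<noteq> s0" for \<alpha>
  proof (cases "\<alpha> = m")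
    case True
    then have "{..\<alpha>} = UNIV" using m by auto
    then show ?thesis using total assms(1) by simp
  next
    case False
    then have "m \<notin> {..\<alpha>}" using m[of \<alpha>] by auto
    then have "(\<Sum>\<beta>\<in>{..\<alpha>}. c \<beta>) = (\<Sum>\<beta>\<in>{..\<alpha>}. t)"
      by (intro sum.cong) (auto simp: c_def)
    then have s: "(\<Sum>\<beta>\<in>{..\<alpha>}. c \<beta>) = of_nat (card {..\<alpha>}) * t" by simp
    have "card {..\<alpha>} \<le> CARD('d)" "card {..\<alpha>} \<noteq> 0"
      by (auto intro: card_mono)
    then have "t \<noteq> s0 / of_nat (card {..\<alpha>})"
      using t by blast
    then show ?thesis
      unfolding s using \<open>card {..\<alpha>} \<noteq> 0\<close> by (auto simp: field_simps)
  qed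
  ultimately show ?thesis using total by blast
qed

lemma hreg_point:
  assumes q: "q \<noteq> 0" "q \<noteq> 1" and d: "CARD('d) \<ge> 2"
  shows "\<exists>p :: ('n::finite, 'd::{finite, linorder}) pt. p \<in> hreg q \<and> (\<forall>i \<alpha>. ac p i \<alpha> \<noteq> 0)"
proof -
  obtain x :: "'n \<Rightarrow> complex" where x: "inj x" "\<And>i. x i \<noteq> 0" "\<And>i j. x i \<noteq> q * x j"
    using exists_generic_positions[OF q] by blast
  \<comment> \<open>With b = 1 all f_ij equal 1, and q / (x_i / x_j - q) becomes this entry: a
    Cauchy matrix in x_i and q x_j with columns scaled by q x_j. Each Z_\<alpha> is A plus a partial
    sum of c in every entry.\<close>
  define A :: "complex ^ 'n ^ 'n" where "A = (\<chi> i j. q * x j / (x i - q * x j))"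
  have nz: "x i - q * x j \<noteq> 0" for i j using x(3)[of i j] by simp
  have inj: "inj (\<lambda>j. q * x j)" using x(1) q(1) by (auto simp: inj_def)
  have det0: "det A \<noteq> 0"
    unfolding det_nonzero_iff_kernel
  proof (intro allI impI)
    fix v assume "A *v v = 0"
    then have "(\<Sum>j\<in>UNIV. (q * x j * v $ j) / (x i - q * x j)) = 0" for i
      by (simp add: vec_eq_iff matrix_vector_mult_def A_def)
    then have "q * x j * v $ j = 0" for j
      by (rule cauchy_matrix_kernel[OF x(1) inj x(3)])
    then show "v = 0" using q(1) x(2) by (simp add: vec_eq_iff)
  qed
  \<comment> \<open>Adding 1 gives x_i / (x_i - q x_j), a Cauchy matrix with scaled rows. So 1 is
    not the exceptional multiplier, as it must not be: the last partial sum is always 1.\<close>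
  have det1: "det (\<chi> i j. A $ i $ j + 1) \<noteq> 0"
    unfolding det_nonzero_iff_kernel
  proof (intro allI impI)
    fix v assume v: "(\<chi> i j. A $ i $ j + 1) *v v = 0"
    have "A $ i $ j + 1 = x i / (x i - q * x j)" for i j
      using nz[of i j] by (simp add: A_def field_simps)
    then have "x i * (\<Sum>j\<in>UNIV. v $ j / (x i - q * x j)) = 0" for i
      using v by (simp add: vec_eq_iff matrix_vector_mult_def sum_distrib_left)
    then have "(\<Sum>j\<in>UNIV. v $ j / (x i - q * x j)) = 0" for i
      using x(2) by simp
    then have "v $ j = 0" for j
      by (rule cauchy_matrix_kernel[OF x(1) inj x(3)])
    then show "v = 0" by (simp add: vec_eq_iff)
  qed
  obtain s0 where s0: "s0 \<noteq> 1" "\<And>s. s \<noteq> s0 \<Longrightarrow> det (\<chi> i j. A $ i $ j + s) \<noteq> 0"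
  proof (cases "\<exists>s. det (\<chi> i j. A $ i $ j + s) = 0")
    case True
    then show ?thesis using that det1 det_add_constant_unique_root[OF det0] by metis
  next
    case False
    \<comment> \<open>Without an exceptional value any number other than 1 can serve as
      \<open>s0\<close>.\<close>
    then show ?thesis using that[of 0] by auto
  qed
  obtain c :: "'d \<Rightarrow> complex" where c: "(\<Sum>\<alpha>\<in>UNIV. c \<alpha>) = 1" "\<And>\<alpha>. c \<alpha> \<noteq> 0"
      "\<And>\<alpha>. (\<Sum>\<beta>\<in>{..\<alpha>}. c \<beta>) \<noteq> s0"
    using exists_partial_sums[OF s0(1) d] by blast
  define p :: "('n, 'd) pt" where "p = ((\<chi> i. x i), (\<chi> i \<alpha>. c \<alpha>), (\<chi> i \<alpha>. 1))"
  have coords: "xc p i = x i" "ac p i \<alpha> = c \<alpha>" "bc p i \<alpha> = 1" for i \<alpha>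
    by (simp_all add: p_def xc_def ac_def bc_def)
  have Z: "Zc q p S i j = A $ i $ j + (\<Sum>\<beta>\<in>S. c \<beta>)" for S i j
    using x(2)[of j] nz[of i j] by (simp add: Zc_def fc_def coords c(1) A_def field_simps)
  have "p \<in> hreg q"
    unfolding hreg_def mem_Collect_eq coords Z
    using x s0(2)[OF c(3)] det0 c(1) by (auto simp: inj_def)
  then show ?thesis
    using c(2) coords by metis
qed

section \<open>The pencil\<close>

definition torus_invariant :: "complex \<Rightarrow> ('n::finite, 'd::{finite, linorder}) bracket \<Rightarrow> bool" where
  "torus_invariant q B \<longleftrightarrow> poisson_bracket q B \<and> (\<forall>\<mu>. preserves q (torus q \<mu>) B)"

text \<open>Supplies the starting bracket for the wedges with an arbitrary coefficient, including 0
  for combinations in which B0 does not occur.\<close>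

lemma torus_invariant_cmult:
  fixes B :: "('n::finite, 'd::{finite, linorder}) bracket"
  assumes q: "q \<noteq> 1" and inv: "torus_invariant q B"
  shows "torus_invariant q (\<lambda>f g p. c * B f g p)"
proof -
  have B: "poisson_bracket q B" using inv by (simp add: torus_invariant_def)
  note D1 = poisson_derivation1[OF B] and D2 = poisson_derivation2[OF B]
  have "preserves q (torus q \<mu>) (\<lambda>f g p. c * B f g p)" for \<mu>
    unfolding preserves_def
  proof (intro ballI)
    fix f g :: "('n, 'd) pt \<Rightarrow> complex" assume fg: "f \<in> regular q" "g \<in> regular q"
    then have "torus q \<mu> (B f g) = (\<lambda>p. B (torus q \<mu> f) g p + B f (torus q \<mu> g) p)"
      using inv by (simp add: torus_invariant_def preserves_def)
    then show "torus q \<mu> (\<lambda>p. c * B f g p) = (\<lambda>p. c * B (torus q \<mu> f) g p + c * B f (torus q \<mu> g) p)"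
      by (simp add: derivation_cmult[OF torus_derivation[OF q] poisson_regular[OF B fg]] distrib_left)
  qed
  moreover have "poisson_bracket q (\<lambda>f g p. c * B f g p)"
    unfolding poisson_bracket_def
  proof (intro conjI ballI allI impI)
    fix f g h :: "('n, 'd) pt \<Rightarrow> complex" and k p
    assume fgh: "f \<in> regular q" "g \<in> regular q" "h \<in> regular q"
    show "(\<lambda>p. c * B (\<lambda>p. k * f p + g p) h p) = (\<lambda>p. k * (c * B f h p) + c * B g h p)"
      unfolding derivation_lin[OF D1[OF fgh(3)] fgh(1,2)] by (simp add: algebra_simps)
    show "(\<lambda>p. c * B (\<lambda>p. f p * g p) h p) = (\<lambda>p. f p * (c * B g h p) + c * B f h p * g p)"
      unfolding derivation_mult[OF D1[OF fgh(3)] fgh(1,2)] by (simp add: algebra_simps)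
    have "B f (\<lambda>p. c * B g h p) p = c * B f (B g h) p" "B g (\<lambda>p. c * B h f p) p = c * B g (B h f) p"
      "B h (\<lambda>p. c * B f g p) p = c * B h (B f g) p"
      using fgh by (simp_all add: derivation_cmult[OF D2] poisson_regular[OF B])
    then show "c * B f (\<lambda>p. c * B g h p) p + c * B g (\<lambda>p. c * B h f p) p + c * B h (\<lambda>p. c * B f g p) p = 0"
      using poisson_jacobi[OF B fgh, of p] by (simp add: distrib_left[symmetric])
  next
    fix f g :: "('n, 'd) pt \<Rightarrow> complex"
    assume fg: "f \<in> regular q" "g \<in> regular q"
    show "(\<lambda>p. c * B f g p) \<in> regular q"
      by (intro regular_cmult poisson_regular[OF B] fg)
    show "(\<lambda>p. c * B f g p) = (\<lambda>p. - (c * B g f p))"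
      by (rule ext) (subst poisson_antisym[OF B fg], simp)
    fix \<sigma> :: "'n \<Rightarrow> 'n" assume "bij \<sigma>"
    then show "(\<lambda>p. c * B (f \<circ> act \<sigma>) (g \<circ> act \<sigma>) p) = (\<lambda>p. c * B f g p) \<circ> act \<sigma>"
      by (simp add: poisson_equivariant[OF B _ fg] fun_eq_iff)
  qed
  ultimately show ?thesis
    by (simp add: torus_invariant_def)
qed

text \<open>The induction has to carry invariance along with the Poisson property: each new wedge is
  added to a bracket that its two fields must preserve.\<close>

lemma torus_invariant_add_wedges:
  assumes q: "q \<noteq> 1" and inv: "torus_invariant q B"
  shows "torus_invariant q (\<lambda>f g p. B f g p + (\<Sum>k\<in>K. c k * wedge (torus q (u k)) (torus q (v k)) f g p))"
proof (induction K rule: infinite_finite_induct)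
  case (insert k K)
  define C where "C f g p = B f g p + (\<Sum>k\<in>K. c k * wedge (torus q (u k)) (torus q (v k)) f g p)" for f g p
  have C: "torus_invariant q C"
    using insert.IH by (simp add: C_def[abs_def])
  note T = torus_derivation[OF q] torus_equivariant torus_commuting[OF q]
  have "torus_invariant q (\<lambda>f g p. C f g p + c k * wedge (torus q (u k)) (torus q (v k)) f g p)"
    using C unfolding torus_invariant_def
    by (auto intro!: poisson_add_wedge preserves_add_wedge T)
  then show ?case
    using insert.hyps by (simp add: C_def add_ac)
qed (use inv in simp_all)

text \<open>Rescaling all a^\<alpha> by a common factor is undone by the gauge; infinitesimally, the
  sum of \<delta> - a_i^\<mu> over \<mu> is 1 - 1.\<close>

lemma torus_sum:
  fixes f :: "('n::finite, 'd::{finite, linorder}) pt \<Rightarrow> complex"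
  assumes q: "q \<noteq> 1" and f: "f \<in> regular q"
  shows "(\<Sum>\<mu>\<in>UNIV. torus q \<mu> f p) = 0"
proof (cases "p \<in> hreg q")
  case True
  have s: "(\<Sum>\<mu>\<in>UNIV. of_bool (\<alpha> = \<mu>) - ac p i \<mu>) = 0" for \<alpha> i
    by (simp add: sum_subtractf hregD(4)[OF True])
  have "tangent_vector q p (\<lambda>f. \<Sum>\<mu>\<in>UNIV. torus q \<mu> f p)"
    unfolding tangent_vector_def
    by (auto simp: derivation_lin[OF torus_derivation[OF q]] derivation_mult[OF torus_derivation[OF q]]
        sum.distrib sum_distrib_left sum_distrib_right)
  then show ?thesis
  proof (rule tangent_vector_eq_zero[OF _ True _ _ _ f])
    show "(\<Sum>\<mu>\<in>UNIV. torus q \<mu> (xf q i) p) = 0" for i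
      by (simp add: torus_coordinates[OF q])
    show "(\<Sum>\<mu>\<in>UNIV. torus q \<mu> (af q i \<alpha>) p) = 0" for i \<alpha>
      using True s by (simp only: torus_coordinates[OF q] sum_distrib_left[symmetric]) (simp add: af_def on_hreg_def)
    have "(\<Sum>\<mu>\<in>UNIV. ac p i \<mu> - of_bool (\<alpha> = \<mu>)) = 0" for \<alpha> i
      by (simp add: sum_subtractf hregD(4)[OF True])
    then show "(\<Sum>\<mu>\<in>UNIV. torus q \<mu> (bf q i \<alpha>) p) = 0" for i \<alpha>
      using True by (simp only: torus_coordinates[OF q] sum_distrib_left[symmetric]) (simp add: af_def on_hreg_def)
  qed
qed (simp add: torus_outside)

text \<open>The index \<open>m\<close> can be dropped because the torus vector fields add up to zero.\<close>

lemma sum_wedge_pairs: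
  fixes f :: "('n::finite, 'd::{finite, linorder}) pt \<Rightarrow> complex" and m :: 'd
  assumes q: "q \<noteq> 1" and m: "\<And>\<mu>. \<mu> \<le> m" and fg: "f \<in> regular q" "g \<in> regular q"
  shows "(\<Sum>(\<mu>, \<nu>)\<in>{(\<mu>, \<nu>). \<mu> < \<nu> \<and> \<mu> \<noteq> m \<and> \<nu> \<noteq> m}. wedge (torus q \<mu>) (torus q \<nu>) f g p) =
    (\<Sum>\<mu>\<in>UNIV. \<Sum>\<nu>\<in>UNIV. ordsgn \<mu> \<nu> * (torus q \<mu> f p * torus q \<nu> g p))"
proof -
  define X where "X \<mu> = torus q \<mu> f p" for \<mu>
  define Y where "Y \<mu> = torus q \<mu> g p" for \<mu>
  define A where "A = UNIV - {m}"
  have X: "X m = - sum X A" and Y: "Y m = - sum Y A"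
    using torus_sum[OF q fg(1), of p] torus_sum[OF q fg(2), of p] sum.remove[of UNIV m X] sum.remove[of UNIV m Y]
    unfolding X_def[symmetric] Y_def[symmetric] A_def by (auto simp: eq_neg_iff_add_eq_0)
  have split: "sum h UNIV = h m + sum h A" for h :: "'d \<Rightarrow> complex"
    unfolding A_def by (rule sum.remove) auto
  have "{(\<mu>, \<nu>). \<mu> < \<nu> \<and> \<mu> \<noteq> m \<and> \<nu> \<noteq> m} = {z \<in> A \<times> A. fst z < snd z}"
    by (auto simp: A_def)
  then have "(\<Sum>(\<mu>, \<nu>)\<in>{(\<mu>, \<nu>). \<mu> < \<nu> \<and> \<mu> \<noteq> m \<and> \<nu> \<noteq> m}. wedge (torus q \<mu>) (torus q \<nu>) f g p) =
      (\<Sum>z\<in>A \<times> A. if fst z < snd z then X (fst z) * Y (snd z) - X (snd z) * Y (fst z) else 0)"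
    by (simp add: sum.inter_filter A_def wedge_def X_def Y_def case_prod_unfold cong: if_cong)
  also have "\<dots> = (\<Sum>\<mu>\<in>A. \<Sum>\<nu>\<in>A. of_bool (\<mu> < \<nu>) * (X \<mu> * Y \<nu>)) - (\<Sum>\<mu>\<in>A. \<Sum>\<nu>\<in>A. of_bool (\<mu> < \<nu>) * (X \<nu> * Y \<mu>))"
    unfolding sum_subtractf[symmetric] sum.cartesian_product
    by (intro sum.cong) auto
  also have "(\<Sum>\<mu>\<in>A. \<Sum>\<nu>\<in>A. of_bool (\<mu> < \<nu>) * (X \<nu> * Y \<mu>)) = (\<Sum>\<mu>\<in>A. \<Sum>\<nu>\<in>A. of_bool (\<nu> < \<mu>) * (X \<mu> * Y \<nu>))"
    by (rule sum.swap)
  also have "(\<Sum>\<mu>\<in>A. \<Sum>\<nu>\<in>A. of_bool (\<mu> < \<nu>) * (X \<mu> * Y \<nu>)) - \<dots> = (\<Sum>\<mu>\<in>A. \<Sum>\<nu>\<in>A. ordsgn \<mu> \<nu> * (X \<mu> * Y \<nu>))"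
    unfolding sum_subtractf[symmetric] by (intro sum.cong) (auto simp: ordsgn_def)
  finally have lhs: "(\<Sum>(\<mu>, \<nu>)\<in>{(\<mu>, \<nu>). \<mu> < \<nu> \<and> \<mu> \<noteq> m \<and> \<nu> \<noteq> m}. wedge (torus q \<mu>) (torus q \<nu>) f g p) =
      (\<Sum>\<mu>\<in>A. \<Sum>\<nu>\<in>A. ordsgn \<mu> \<nu> * (X \<mu> * Y \<nu>))" .
  \<comment> \<open>As m is the largest index, the sign is constant along its row and its column.
    The two border sums are then opposite multiples of \<open>sum X A * sum Y A\<close> and
    cancel.\<close>
  have o: "ordsgn \<mu> m = 1" "ordsgn m \<mu> = - 1" if "\<mu> \<in> A" for \<mu>
    using that m[of \<mu>] by (auto simp: A_def ordsgn_def)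
  have "(\<Sum>\<mu>\<in>UNIV. \<Sum>\<nu>\<in>UNIV. ordsgn \<mu> \<nu> * (X \<mu> * Y \<nu>)) =
      (\<Sum>\<nu>\<in>A. - (X m * Y \<nu>)) + (\<Sum>\<mu>\<in>A. X \<mu> * Y m + (\<Sum>\<nu>\<in>A. ordsgn \<mu> \<nu> * (X \<mu> * Y \<nu>)))"
    by (simp add: split o)
  also have "(\<Sum>\<nu>\<in>A. - (X m * Y \<nu>)) = - (X m * sum Y A)"
    by (simp add: sum_negf sum_distrib_left)
  also have "(\<Sum>\<mu>\<in>A. X \<mu> * Y m + (\<Sum>\<nu>\<in>A. ordsgn \<mu> \<nu> * (X \<mu> * Y \<nu>))) =
      sum X A * Y m + (\<Sum>\<mu>\<in>A. \<Sum>\<nu>\<in>A. ordsgn \<mu> \<nu> * (X \<mu> * Y \<nu>))"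
    by (simp add: sum.distrib sum_distrib_right)
  finally show ?thesis
    unfolding lhs X_def[symmetric] Y_def[symmetric] by (simp add: X Y)
qed

section \<open>The difference of the two brackets on coordinates\<close>

lemma ordsgn_sym: "ordsgn \<beta> \<alpha> = - ordsgn \<alpha> \<beta>"
  by (auto simp: ordsgn_def)

lemma Sig_eq: "Sig p i j = (\<Sum>\<mu>\<in>UNIV. \<Sum>\<nu>\<in>UNIV. ordsgn \<mu> \<nu> * (ac p i \<mu> * ac p j \<nu>))"
  unfolding Sig_def by (subst sum.swap) (simp add: mult_ac)

text \<open>The field T_\<mu> acts on log a_i^\<alpha> by \<delta> - a_i^\<mu>, so this evaluates
  the sum of o(\<mu>,\<nu>) T_\<mu> \<otimes> T_\<nu> on log a_i^\<alpha> and log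
  a_j^\<beta>.\<close>

lemma sum_ordsgn_torus_factors:
  "(\<Sum>\<mu>\<in>UNIV. \<Sum>\<nu>\<in>UNIV. ordsgn \<mu> \<nu> * ((of_bool (\<alpha> = \<mu>) - ac p i \<mu>) * (of_bool (\<beta> = \<nu>) - ac p j \<nu>))) =
    ordsgn \<alpha> \<beta> - osum p j \<alpha> + osum p i \<beta> + Sig p i j"
proof -
  have "(\<Sum>\<nu>\<in>UNIV. ordsgn \<mu> \<nu> * ((of_bool (\<alpha> = \<mu>) - ac p i \<mu>) * (of_bool (\<beta> = \<nu>) - ac p j \<nu>))) =
    of_bool (\<mu> = \<alpha>) * (ordsgn \<mu> \<beta> - osum p j \<mu>) + ordsgn \<beta> \<mu> * ac p i \<mu> + (\<Sum>\<nu>\<in>UNIV. ordsgn \<mu> \<nu> * (ac p i \<mu> * ac p j \<nu>))" for \<mu>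
  proof -
    have "ordsgn \<mu> \<nu> * ((of_bool (\<alpha> = \<mu>) - ac p i \<mu>) * (of_bool (\<beta> = \<nu>) - ac p j \<nu>)) =
      (of_bool (\<mu> = \<alpha>) - ac p i \<mu>) * (of_bool (\<nu> = \<beta>) * ordsgn \<mu> \<nu>) - of_bool (\<mu> = \<alpha>) * (ordsgn \<mu> \<nu> * ac p j \<nu>)
      + ordsgn \<mu> \<nu> * (ac p i \<mu> * ac p j \<nu>)" for \<nu>
      by (simp add: algebra_simps)
    then show ?thesis
      by (simp only: sum.distrib sum_subtractf sum_distrib_left[symmetric] sum_of_bool_mult osum_def[symmetric])
        (simp add: ordsgn_sym[of \<beta>] algebra_simps)
  qed
  then show ?thesis
    by (simp only: sum.distrib sum_of_bool_mult Sig_eq osum_def)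
qed

text \<open>The same kernel governs the three comparisons. Because T_\<mu> log b = - T_\<mu> log a,
  it enters with a plus sign for aa and bb and a minus sign for ab.\<close>

lemma aam_aa0: "aam p i \<alpha> j \<beta> = aa0 p i \<alpha> j \<beta>
    + 1/2 * (ac p i \<alpha> * ac p j \<beta> * (ordsgn \<alpha> \<beta> - osum p j \<alpha> + osum p i \<beta> + Sig p i j))"
proof -
  have "(\<Sum>\<gamma>\<in>UNIV. ordsgn \<alpha> \<gamma> * ac p j \<beta> * ac p j \<alpha> * ac p i \<gamma>) = ac p j \<beta> * ac p j \<alpha> * osum p i \<alpha>"
    "(\<Sum>\<gamma>\<in>UNIV. ordsgn \<beta> \<gamma> * ac p i \<alpha> * ac p i \<beta> * ac p j \<gamma>) = ac p i \<alpha> * ac p i \<beta> * osum p j \<beta>"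
    by (simp_all add: osum_def sum_distrib_left mult_ac)
  then show ?thesis
    unfolding aam_def Let_def aa0_osum by (simp add: ordsgn_sym[of \<beta>] field_simps)
qed

lemma abm_ab0:
  assumes "p \<in> hreg q"
  shows "abm q p i \<alpha> j \<beta> = ab0 q p i \<alpha> j \<beta>
    - 1/2 * (ac p i \<alpha> * bc p j \<beta> * (ordsgn \<alpha> \<beta> - osum p j \<alpha> + osum p i \<beta> + Sig p i j))"
proof -
  have "(\<Sum>\<gamma>\<in>UNIV. ordsgn \<alpha> \<gamma> * bc p j \<beta> * ac p j \<alpha> * ac p i \<gamma>) = bc p j \<beta> * ac p j \<alpha> * osum p i \<alpha>"
    by (simp_all add: osum_def sum_distrib_left mult_ac)
  then show ?thesis
    unfolding abm_def Let_def ab0_form[OF assms] ab_form_def psum_def[symmetric]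
    by (cases \<alpha> \<beta> rule: linorder_cases)
      (simp_all add: less_imp_not_eq less_imp_not_eq2 less_imp_not_less field_simps)
qed

lemma bbm_bb0:
  assumes "p \<in> hreg q"
  shows "bbm q p i \<alpha> j \<beta> = bb0 q p i \<alpha> j \<beta>
    + 1/2 * (bc p i \<alpha> * bc p j \<beta> * (ordsgn \<alpha> \<beta> - osum p j \<alpha> + osum p i \<beta> + Sig p i j))"
  unfolding bbm_def Let_def bb0_form[OF assms] bb_form_def psum_def[symmetric]
  by (simp add: ordsgn_sym[of \<beta>] field_simps)

lemma card_strict_pairs:
  fixes A :: "'a::linorder set"
  assumes "finite A"
  shows "card {(a, b). a < b \<and> a \<in> A \<and> b \<in> A} = card A * (card A - 1) div 2"
proof -
  define S where "S = {(a, b). a < b \<and> a \<in> A \<and> b \<in> A}"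
  have fin: "finite S"
    by (rule finite_subset[of _ "A \<times> A"]) (auto simp: S_def assms)
  have "A \<times> A = (S \<union> prod.swap ` S) \<union> (\<lambda>a. (a, a)) ` A"
    by (force simp: S_def)
  moreover have "card ((S \<union> prod.swap ` S) \<union> (\<lambda>a. (a, a)) ` A) = card (S \<union> prod.swap ` S) + card ((\<lambda>a. (a, a)) ` A)"
    using fin assms by (intro card_Un_disjoint) (auto simp: S_def)
  moreover have "card (S \<union> prod.swap ` S) = card S + card (prod.swap ` S)"
    using fin by (intro card_Un_disjoint) (auto simp: S_def)
  moreover have "card (prod.swap ` S) = card S" "card ((\<lambda>a. (a, a)) ` A) = card A"
    by (auto intro!: card_image inj_onI)
  ultimately have "card A * card A = 2 * card S + card A"
    by (metis card_cartesian_product mult_2)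
  then have "card A * (card A - 1) = 2 * card S"
    by (simp add: right_diff_distrib')
  then show ?thesis
    by (simp add: S_def)
qed

lemma ordsgn_wedge_values:
  fixes p :: "('n::finite, 'd::{finite, linorder}) pt"
  assumes q: "q \<noteq> 1" and p: "p \<in> hreg q"
  defines "W \<equiv> \<lambda>f g. \<Sum>\<mu>\<in>UNIV. \<Sum>\<nu>\<in>UNIV. ordsgn \<mu> \<nu> * (torus q \<mu> f p * torus q \<nu> g p)"
    and "K \<equiv> \<lambda>i \<alpha> j \<beta>. ordsgn \<alpha> \<beta> - osum p j \<alpha> + osum p i \<beta> + Sig p i j"
  shows "W (xf q i) g = 0"
    "W (af q i \<alpha>) (af q j \<beta>) = ac p i \<alpha> * ac p j \<beta> * K i \<alpha> j \<beta>"
    "W (af q i \<alpha>) (bf q j \<beta>) = - (ac p i \<alpha> * bc p j \<beta> * K i \<alpha> j \<beta>)"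
    "W (bf q i \<alpha>) (bf q j \<beta>) = bc p i \<alpha> * bc p j \<beta> * K i \<alpha> j \<beta>"
proof -
  define D where "D i \<alpha> \<mu> = of_bool (\<alpha> = \<mu>) - ac p i \<mu>" for i \<alpha> \<mu>
  have K: "(\<Sum>\<mu>\<in>UNIV. \<Sum>\<nu>\<in>UNIV. ordsgn \<mu> \<nu> * (D i \<alpha> \<mu> * D j \<beta> \<nu>)) = K i \<alpha> j \<beta>" for i \<alpha> j \<beta>
    unfolding D_def K_def by (rule sum_ordsgn_torus_factors)
  have a: "torus q \<mu> (af q i \<alpha>) p = ac p i \<alpha> * D i \<alpha> \<mu>" and b: "torus q \<mu> (bf q i \<alpha>) p = - (bc p i \<alpha> * D i \<alpha> \<mu>)"
    for i \<alpha> \<mu>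
    unfolding torus_coordinates[OF q] using p by (simp_all add: af_def bf_def on_hreg_def D_def algebra_simps)
  show "W (xf q i) g = 0"
    by (simp add: W_def torus_coordinates[OF q])
  show "W (af q i \<alpha>) (af q j \<beta>) = ac p i \<alpha> * ac p j \<beta> * K i \<alpha> j \<beta>"
    "W (af q i \<alpha>) (bf q j \<beta>) = - (ac p i \<alpha> * bc p j \<beta> * K i \<alpha> j \<beta>)"
    "W (bf q i \<alpha>) (bf q j \<beta>) = bc p i \<alpha> * bc p j \<beta> * K i \<alpha> j \<beta>"
    unfolding W_def a b K[symmetric] sum_distrib_left sum_negf[symmetric]
    by (intro sum.cong refl; simp add: mult_ac)+
qed

section \<open>Linear combinations, independence and non-degenerate members\<close>

definition pencil :: "complex \<Rightarrow> ('n::finite, 'd::{finite, linorder}) bracket \<Rightarrow> (nat \<Rightarrow> 'd \<times> 'd) \<Rightarrow> nat \<Rightarrow> ('n, 'd) bracket" where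
  "pencil q B e k = (if k = 0 then B else wedge (torus q (fst (e k))) (torus q (snd (e k))))"

lemma lincomb_pencil:
  assumes "finite F"
  shows "lincomb (pencil q B e) F c = (\<lambda>f g p. (if 0 \<in> F then c 0 else 0) * B f g p +
    (\<Sum>k\<in>F - {0}. c k * wedge (torus q (fst (e k))) (torus q (snd (e k))) f g p))"
proof -
  have "(\<Sum>k\<in>F. c k * pencil q B e k f g p) = (if 0 \<in> F then c 0 else 0) * B f g p +
    (\<Sum>k\<in>F - {0}. c k * pencil q B e k f g p)" for f g p
    using assms by (cases "0 \<in> F") (simp_all add: sum.remove[of F 0] pencil_def)
  moreover have "(\<Sum>k\<in>F - {0}. c k * pencil q B e k f g p) =
    (\<Sum>k\<in>F - {0}. c k * wedge (torus q (fst (e k))) (torus q (snd (e k))) f g p)" for f g p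
    by (intro sum.cong) (auto simp: pencil_def)
  ultimately show ?thesis
    by (simp add: lincomb_def)
qed

lemma lincomb_pencil_poisson:
  assumes "q \<noteq> 1" "torus_invariant q B" "finite F"
  shows "poisson_bracket q (lincomb (pencil q B e) F c)"
proof -
  have "torus_invariant q (lincomb (pencil q B e) F c)"
    unfolding lincomb_pencil[OF assms(3)]
    by (rule torus_invariant_add_wedges[OF assms(1) torus_invariant_cmult[OF assms(1,2)]])
  then show ?thesis
    by (simp add: torus_invariant_def)
qed

lemma wedge_torus_zero:
  assumes "\<And>\<mu>. torus q \<mu> f p = 0"
  shows "wedge (torus q \<mu>) (torus q \<nu>) f g p = 0"
  by (simp add: wedge_def assms)

text \<open>On the functions $a_i^m(p)\, a_i^\rho - a_i^\rho(p)\, a_i^m$ the vector fields with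
  \<open>\<mu> \<noteq> m\<close> act diagonally at \<open>p\<close>.\<close>

lemma pencil_wedges_independent:
  fixes p :: "('n::finite, 'd::{finite, linorder}) pt" and m :: 'd
  assumes q: "q \<noteq> 1" and p: "p \<in> hreg q" and nz: "\<And>i \<alpha>. ac p i \<alpha> \<noteq> 0"
    and e: "inj_on e F" "e ` F \<subseteq> {(\<mu>, \<nu>). \<mu> < \<nu> \<and> \<mu> \<noteq> m \<and> \<nu> \<noteq> m}" and F: "finite F" "0 \<notin> F"
  shows "bivectors_independent_at q p (pencil q B e) F"
  unfolding bivectors_independent_at_def
proof (intro allI impI ballI)
  fix c k assume zero: "\<forall>f\<in>regular q. \<forall>g\<in>regular q. lincomb (pencil q B e) F c f g p = 0" and k: "k \<in> F"
  fix i :: 'n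
  \<comment> \<open>The coefficients are frozen at p, where the differential of
    \<open>u \<rho>\<close> is a multiple of that of log (a_i^\<rho> / a_i^m). In this quotient the
    gauge terms a_i^\<mu> drop out. One arbitrary lower index i suffices.\<close>
  define u where "u \<rho> = (\<lambda>p'. ac p i m * af q i \<rho> p' - ac p i \<rho> * af q i m p')" for \<rho>
  have reg: "u \<rho> \<in> regular q" for \<rho>
    unfolding u_def by (intro regular_diff regular_cmult coordinate_regular)
  have T: "torus q \<mu> (u \<rho>) p = of_bool (\<rho> = \<mu>) * (ac p i \<rho> * ac p i m)" if "\<mu> \<noteq> m" for \<mu> \<rho>
  proof -
    note D = torus_derivation[OF q, of \<mu>]
    note r = regular_cmult[OF coordinate_regular(2)[of q i]]
    have eq: "torus q \<mu> (u \<rho>) = (\<lambda>p'. ac p i m * torus q \<mu> (af q i \<rho>) p' - ac p i \<rho> * torus q \<mu> (af q i m) p')"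
      unfolding u_def using derivation_diff[OF D r[of "ac p i m" \<rho>] r[of "ac p i \<rho>" m]]
      unfolding derivation_cmult[OF D coordinate_regular(2)] .
    show ?thesis
      unfolding eq torus_coordinates[OF q] using p that by (simp add: af_def on_hreg_def algebra_simps)
  qed
  obtain \<rho> \<sigma> where k_eq: "e k = (\<rho>, \<sigma>)" by fastforce
  have rs: "\<rho> < \<sigma>" "\<rho> \<noteq> m" "\<sigma> \<noteq> m"
    using e(2) k k_eq by (auto simp: image_subset_iff)
  have w: "wedge (torus q (fst (e l))) (torus q (snd (e l))) (u \<rho>) (u \<sigma>) p =
      of_bool (l = k) * (ac p i \<rho> * ac p i m * (ac p i \<sigma> * ac p i m))" if l: "l \<in> F" for l
  proof -
    obtain \<mu> \<nu> where l_eq: "e l = (\<mu>, \<nu>)" by fastforce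
    have mn: "\<mu> < \<nu>" "\<mu> \<noteq> m" "\<nu> \<noteq> m"
      using e(2) l l_eq by (auto simp: image_subset_iff)
    have "l = k \<longleftrightarrow> \<rho> = \<mu> \<and> \<sigma> = \<nu>"
      using inj_on_eq_iff[OF e(1) l k] k_eq l_eq by auto
    then have lk: "of_bool (l = k) = (of_bool (\<rho> = \<mu>) * of_bool (\<sigma> = \<nu>) :: complex)"
      by (simp only: of_bool_conj)
    \<comment> \<open>Both pairs are increasing, so the transposed half of the wedge never
      contributes.\<close>
    have "of_bool (\<rho> = \<nu>) * of_bool (\<sigma> = \<mu>) = (0 :: complex)"
      using mn(1) rs(1) by auto
    then show ?thesis
      unfolding wedge_def l_eq fst_conv snd_conv T[OF mn(2)] T[OF mn(3)] lk by (simp add: mult_ac)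
  qed
  have "lincomb (pencil q B e) F c (u \<rho>) (u \<sigma>) p = (\<Sum>l\<in>F. c l * (of_bool (l = k) * (ac p i \<rho> * ac p i m * (ac p i \<sigma> * ac p i m))))"
    using F(2) by (simp add: lincomb_pencil[OF F(1)] w)
  also have "\<dots> = c k * (ac p i \<rho> * ac p i m * (ac p i \<sigma> * ac p i m))"
    using F(1) k by (subst sum.remove[of F k]) (auto intro!: sum.neutral)
  finally show "c k = 0"
    using zero reg nz by simp
qed

text \<open>Without a B0 component, x_i would lie in the radical although its differential is
  nonzero. The point p is essential: on an empty \<open>hreg\<close> non-degeneracy would hold
  vacuously.\<close>

lemma nondegenerate_from_pencil:
  fixes B0 :: "('n::finite, 'd::{finite, linorder}) bracket"
  assumes q: "q \<noteq> 1" and p: "p \<in> (hreg q :: ('n, 'd) pt set)" and B: "nondegenerate q B"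
    and F: "finite F" and lin: "\<And>f g. f \<in> regular q \<Longrightarrow> g \<in> regular q \<Longrightarrow> B f g = lincomb (pencil q B0 e) F c f g"
  shows "0 \<in> F \<and> c 0 \<noteq> 0"
proof (rule ccontr)
  assume no: "\<not> (0 \<in> F \<and> c 0 \<noteq> 0)"
  fix i :: 'n
  \<comment> \<open>The coordinate direction of x_i, which detects that the differential of x_i is
    not zero.\<close>
  define v :: "('n, 'd) pt" where "v = ((\<chi> j. of_bool (j = i)), 0, 0)"
  have v: "xc v i = 1" "ac v j \<alpha> = 0" for j \<alpha>
    by (simp_all add: v_def xc_def ac_def)
  then have tv: "tangent v"
    by (simp add: tangent_def)
  have "torus q \<mu> (xf q i) p = 0" for \<mu>
    by (simp add: torus_coordinates[OF q])
  then have "B (xf q i) g p = 0" if "g \<in> regular q" for g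
    using no by (auto simp: lin[OF coordinate_regular(1) that] lincomb_pencil[OF F] wedge_torus_zero)
  then have "dird v (xf q i) p = 0"
    using B p dird_tangent_vector[OF p q tv] unfolding nondegenerate_def by (metis coordinate_regular(1))
  moreover have "dird v (xf q i) p = 1"
    unfolding xf_def by (rule dird_on_hreg[OF p q tv]) (auto simp: v intro!: derivative_eq_intros)
  ultimately show False by simp
qed

lemma hamiltonian_from_pencil:
  fixes B0 :: "('n::finite, 'd::{finite, linorder}) bracket"
  assumes q: "q \<noteq> 1" and cf: "chalykh_fairon q B0" and F: "finite F" "0 \<in> F" "c 0 \<noteq> 0"
    and lin: "\<And>f g. f \<in> regular q \<Longrightarrow> g \<in> regular q \<Longrightarrow> B f g = lincomb (pencil q B0 e) F c f g"
  shows "hamiltonian_for_spin_RS q B"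
proof -
  \<comment> \<open>Division by \<open>c 0\<close> compensates the coefficient of B0 in the given
    bracket.\<close>
  define h :: "('n, 'd) pt \<Rightarrow> complex" where "h = (\<lambda>p. (- 2 / c 0) * trace_fun q p)"
  have reg: "h \<in> regular q"
    unfolding h_def by (intro regular_cmult trace_fun_regular)
  have "invariant_fun (trace_fun q :: ('n, 'd) pt \<Rightarrow> complex)"
    by (rule trace_fun_invariant)
  then have inv: "invariant_fun h"
    by (simp add: invariant_fun_def h_def fun_eq_iff)
  have "torus q \<mu> h p = 0" for \<mu> p
    unfolding h_def by (simp only: derivation_cmult[OF torus_derivation[OF q] trace_fun_regular]
        torus_trace_fun[OF q] mult_zero_right)
  moreover have "B0 h f p = (- 2 / c 0) * B0 (trace_fun q) f p" if "f \<in> regular q" for f p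
    unfolding h_def
    by (simp only: derivation_cmult[OF poisson_derivation1[OF chalykh_fairon_poisson[OF cf] that] trace_fun_regular])
  ultimately have Bh: "B h f p = - 2 * B0 (trace_fun q) f p" if "f \<in> regular q" for f p
    using that F(3) by (simp add: lin[OF reg that] lincomb_pencil[OF F(1)] F(2) wedge_torus_zero)
  have "spin_RS_equations q (B h)"
    using chalykh_fairon_spin_RS[OF q cf]
    unfolding spin_RS_equations_def Bh[OF coordinate_regular(1)] Bh[OF coordinate_regular(2)]
      Bh[OF coordinate_regular(3)] .
  then show ?thesis
    using reg inv unfolding hamiltonian_for_spin_RS_def by blast
qed

theorem theorem2:
  fixes q :: complex and B0 :: "('n::finite, 'd::{finite, linorder}) bracket"
  assumes "q \<noteq> 0"
    and "\<And>k. 1 \<le> k \<Longrightarrow> k \<le> CARD('n) \<Longrightarrow> q ^ k \<noteq> 1"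
    and "CARD('d) \<ge> 2"
    and "chalykh_fairon q B0"
  shows "\<exists>Bm :: ('n, 'd) bracket. arutyunov_olivucci q Bm \<and>
    (\<exists>(J :: nat set) (P :: nat \<Rightarrow> ('n, 'd) bracket) r.
       poisson_pencil q J P \<and> has_order q J P r \<and>
       (CARD('d) - 1) * (CARD('d) - 2) div 2 \<le> r \<and> r \<le> (CARD('d) - 1) * CARD('d) div 2 \<and>
       from_pencil q J P B0 \<and> from_pencil q J P Bm \<and>
       (\<forall>B. from_pencil q J P B \<and> nondegenerate q B \<longrightarrow> hamiltonian_for_spin_RS q B)) \<and>
    compatible q B0 Bm"
proof -
  \<comment> \<open>The case k = 1 of the root-of-unity hypothesis.\<close>
  have q: "q \<noteq> 1"
    using assms(2)[of 1] zero_less_card_finite[where 'a = 'n] by (simp add: Suc_leI)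
  note cf = assms(4)
  have inv: "torus_invariant q B0"
    using chalykh_fairon_poisson[OF cf] torus_preserves_chalykh_fairon[OF q cf]
    by (simp add: torus_invariant_def)
  obtain p0 :: "('n, 'd) pt" where p0: "p0 \<in> hreg q" "\<And>i \<alpha>. ac p0 i \<alpha> \<noteq> 0"
    using hreg_point[OF assms(1) q assms(3)] by blast
  define m :: 'd where "m = Max UNIV"
  have m: "\<mu> \<le> m" for \<mu> by (simp add: m_def)
  define S where "S = {(\<mu>, \<nu>). \<mu> < \<nu> \<and> \<mu> \<noteq> m \<and> \<nu> \<noteq> m}"
  have cardS: "card S = (CARD('d) - 1) * (CARD('d) - 2) div 2"
    using card_strict_pairs[of "UNIV - {m}"] by (simp add: S_def numeral_2_eq_2)
  obtain e where e: "bij_betw e {1..card S} S"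
    using ex_bij_betw_nat_finite_1[of S] by auto
  define J where "J = {0..card S}"
  define P where "P = pencil q B0 e"
  \<comment> \<open>The largest cardinality that is attained. It is not computed; the bounds
    \<open>card S \<le> r \<le> card S + 1\<close> are enough.\<close>
  define r where "r = Max {card F |F. F \<subseteq> J \<and> (\<exists>p\<in>hreg q. bivectors_independent_at q p P F)}"
  \<comment> \<open>Each pair \<mu> < \<nu> contributes both o(\<mu>,\<nu>) and o(\<nu>,\<mu>)
    through its wedge, so the factor 1/2 of the full double sum is kept.\<close>
  define cm where "cm k = (if k = 0 then 1 else 1/2 :: complex)" for k :: nat
  \<comment> \<open>The second bracket is constructed as a member of the pencil; its prescribed
    values on coordinates are verified at the end.\<close>
  define Bm where "Bm = lincomb P J cm"

  have finJ: "finite J" by (simp add: J_def)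
  have poisson: "poisson_bracket q (lincomb P F c)" if "finite F" for F c
    unfolding P_def by (rule lincomb_pencil_poisson[OF q inv that])
  have pencil: "poisson_pencil q J P"
    using poisson poisson[of "{k}" "\<lambda>_. 1" for k] unfolding poisson_pencil_def by (simp add: lincomb_def)

  have bound: "card F \<le> card S + 1" if "F \<subseteq> J" for F
    using card_mono[OF finJ that] by (simp add: J_def)
  have fin: "finite {card F |F. F \<subseteq> J \<and> (\<exists>p\<in>hreg q. bivectors_independent_at q p P F)}"
    by (rule finite_subset[of _ "{..card S + 1}"]) (use bound in auto)
  have "bivectors_independent_at q p0 P {1..card S}"
    unfolding P_def using e
    by (intro pencil_wedges_independent[OF q p0, where m = m]) (auto simp: bij_betw_def S_def)
  then have mem: "card S \<in> {card F |F. F \<subseteq> J \<and> (\<exists>p\<in>hreg q. bivectors_independent_at q p P F)}"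
    using p0(1) by (force simp: J_def intro!: exI[of _ "{1..card S}"])
  then have r_in: "r \<in> {card F |F. F \<subseteq> J \<and> (\<exists>p\<in>hreg q. bivectors_independent_at q p P F)}"
    unfolding r_def using Max_in[OF fin] by blast
  have order: "has_order q J P r"
    unfolding has_order_def
  proof (intro conjI allI impI)
    show "\<exists>F. finite F \<and> F \<subseteq> J \<and> card F = r \<and> (\<exists>p\<in>hreg q. bivectors_independent_at q p P F)"
      using r_in finite_subset[OF _ finJ] by blast
    fix F assume "finite F \<and> F \<subseteq> J \<and> (\<exists>p\<in>hreg q. bivectors_independent_at q p P F)"
    then show "card F \<le> r"
      unfolding r_def by (intro Max_ge[OF fin]) blast
  qed
  have lower: "(CARD('d) - 1) * (CARD('d) - 2) div 2 \<le> r"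
    unfolding cardS[symmetric] r_def by (rule Max_ge[OF fin mem])
  have "r \<le> card S + 1"
    using r_in bound by blast
  moreover obtain d where d: "CARD('d) = Suc (Suc d)"
    using assms(3) by (metis add_2_eq_Suc le_Suc_ex)
  \<comment> \<open>Before halving, the two bounds differ by 2 (d - 1) \<ge> 2, which absorbs the
    extra 1 due to B0.\<close>
  have "(CARD('d) - 1) * (CARD('d) - 2) + 2 \<le> (CARD('d) - 1) * CARD('d)"
    by (simp add: d)
  ultimately have upper: "r \<le> (CARD('d) - 1) * CARD('d) div 2"
    unfolding cardS by linarith

  have B0: "from_pencil q J P B0"
    unfolding from_pencil_def
    by (rule exI[of _ "{0}"], rule exI[of _ "\<lambda>_. 1"]) (auto simp: lincomb_def J_def P_def pencil_def)
  have Bm: "from_pencil q J P Bm"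
    unfolding from_pencil_def Bm_def using finJ by blast

  have ham: "hamiltonian_for_spin_RS q B" if from_B: "from_pencil q J P B" and "nondegenerate q B" for B
  proof -
    obtain F c where F: "finite F" and lin: "\<And>f g. f \<in> regular q \<Longrightarrow> g \<in> regular q \<Longrightarrow> B f g = lincomb (pencil q B0 e) F c f g"
      using from_B unfolding from_pencil_def P_def by blast
    have "0 \<in> F \<and> c 0 \<noteq> 0"
      by (rule nondegenerate_from_pencil[OF q p0(1) that(2) F lin])
    then show ?thesis
      using hamiltonian_from_pencil[OF q cf F _ _ lin] by blast
  qed

  have J0: "J - {0} = {1..card S}" "0 \<in> J"
    by (auto simp: J_def)
  have Bm_eq: "Bm f g p = B0 f g p + 1/2 * (\<Sum>k\<in>{1..card S}. wedge (torus q (fst (e k))) (torus q (snd (e k))) f g p)"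
    for f g p
    unfolding Bm_def P_def lincomb_pencil[OF finJ] J0(1) by (simp add: J0(2) cm_def sum_distrib_left)
  have "compatible q B0 Bm"
    unfolding compatible_def
  proof (intro allI)
    fix c c' :: complex
    have "c * B0 f g p + c' * Bm f g p = lincomb P J (\<lambda>k. if k = 0 then c + c' else c' / 2) f g p" for f g p
    proof -
      have "(\<Sum>k\<in>{1..card S}. (if k = 0 then c + c' else c' / 2) * wedge (torus q (fst (e k))) (torus q (snd (e k))) f g p)
          = c' / 2 * (\<Sum>k\<in>{1..card S}. wedge (torus q (fst (e k))) (torus q (snd (e k))) f g p)"
        unfolding sum_distrib_left by (rule sum.cong) auto
      then show ?thesis
        unfolding Bm_eq unfolding P_def lincomb_pencil[OF finJ] J0(1) by (simp add: J0(2) distrib_left distrib_right)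
    qed
    then have "(\<lambda>f g p. c * B0 f g p + c' * Bm f g p) = lincomb P J (\<lambda>k. if k = 0 then c + c' else c' / 2)"
      by blast
    then show "poisson_bracket q (\<lambda>f g p. c * B0 f g p + c' * Bm f g p)"
      using poisson[OF finJ] by simp
  qed

  moreover have "arutyunov_olivucci q Bm"
  proof -
    have val: "Bm f g p = B0 f g p + 1/2 * (\<Sum>\<mu>\<in>UNIV. \<Sum>\<nu>\<in>UNIV. ordsgn \<mu> \<nu> * (torus q \<mu> f p * torus q \<nu> g p))"
      if fg: "f \<in> regular q" "g \<in> regular q" for f g p
    proof -
      have "(\<Sum>k\<in>{1..card S}. wedge (torus q (fst (e k))) (torus q (snd (e k))) f g p) =
          (\<Sum>(\<mu>, \<nu>)\<in>S. wedge (torus q \<mu>) (torus q \<nu>) f g p)"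
        unfolding case_prod_unfold by (rule sum.reindex_bij_betw[OF e])
      then show ?thesis
        unfolding Bm_eq sum_wedge_pairs[OF q m fg, folded S_def] by (simp only:)
    qed
    have "has_values q Bm aam (abm q) (bbm q)"
      unfolding has_values_def
    proof (intro ballI allI)
      fix p :: "('n, 'd) pt" and i j :: 'n
      assume p: "p \<in> hreg q"
      have "has_values q B0 aa0 (ab0 q) (bb0 q)"
        using cf by (simp add: chalykh_fairon_def)
      then have v: "B0 (xf q i) (xf q j) p = 0" "\<And>\<alpha>. B0 (xf q i) (af q j \<alpha>) p = 0"
        "\<And>\<alpha>. B0 (xf q i) (bf q j \<alpha>) p = of_bool (i = j) * xc p i * bc p j \<alpha>"
        "\<And>\<alpha> \<beta>. B0 (af q i \<alpha>) (af q j \<beta>) p = aa0 p i \<alpha> j \<beta>"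
        "\<And>\<alpha> \<beta>. B0 (af q i \<alpha>) (bf q j \<beta>) p = ab0 q p i \<alpha> j \<beta>"
        "\<And>\<alpha> \<beta>. B0 (bf q i \<alpha>) (bf q j \<beta>) p = bb0 q p i \<alpha> j \<beta>"
        using p unfolding has_values_def by blast+
      show "Bm (xf q i) (xf q j) p = 0 \<and>
        (\<forall>\<alpha>. Bm (xf q i) (af q j \<alpha>) p = 0) \<and>
        (\<forall>\<alpha>. Bm (xf q i) (bf q j \<alpha>) p = of_bool (i = j) * xc p i * bc p j \<alpha>) \<and>
        (\<forall>\<alpha> \<beta>. Bm (af q i \<alpha>) (af q j \<beta>) p = aam p i \<alpha> j \<beta>) \<and>
        (\<forall>\<alpha> \<beta>. Bm (af q i \<alpha>) (bf q j \<beta>) p = abm q p i \<alpha> j \<beta>) \<and>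
        (\<forall>\<alpha> \<beta>. Bm (bf q i \<alpha>) (bf q j \<beta>) p = bbm q p i \<alpha> j \<beta>)"
        unfolding val[OF coordinate_regular(1) coordinate_regular(1)]
          val[OF coordinate_regular(1) coordinate_regular(2)] val[OF coordinate_regular(1) coordinate_regular(3)]
          val[OF coordinate_regular(2) coordinate_regular(2)] val[OF coordinate_regular(2) coordinate_regular(3)]
          val[OF coordinate_regular(3) coordinate_regular(3)]
          ordsgn_wedge_values[OF q p] aam_aa0 abm_ab0[OF p] bbm_bb0[OF p]
        by (simp add: v)
    qed
    moreover have "poisson_bracket q Bm"
      unfolding Bm_def by (rule poisson[OF finJ])
    ultimately show ?thesis
      by (simp add: arutyunov_olivucci_def)
  qed
  ultimately show ?thesis
    using pencil order lower upper B0 Bm ham by blast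
qed

end
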